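(* Let $V$ be a complex vector space with $\dim V=2k$ equipped with a nondegenerate skew-symmetric bilinear form $\omega$, and let $\mathrm{Sp}(V)$ be its symplectic group. A basis for $\mathbb{C}[V^n]^{\mathrm{Sp}(V)}_d$ is given by the set of all arc diagrams (with multiple edges but without loops) on $n$ vertices, with total degree $d$, such that no strict nesting contains more than $k$ arcs. Here each such arc diagram is interpreted as the product in which $f_{ij}$ appears once for each arc $(i,j)$.
   Context: The subscript $d$ denotes the homogeneous component of polynomial degree $d$. For $1\le i<j\le n$, $f_{ij}(v_1,\dots,v_n)=\omega(v_i,v_j)$. An arc diagram is a loopless multigraph on vertices $1,\dots,n$, with each edge (arc) written $(i,j)$ with $i<j$; its total degree is the sum of vertex degrees (twice the number of arcs). A strict nesting is a set of arcs that are pairwise strictly nested, where $(i,j)$ and $(i',j')$ are strictly nested if $i<i'<j'<j$ or $i'<i<j<j'$. *)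

theory Defs
  imports Complex_Main "HOL-Library.Function_Algebras" "HOL-Library.Multiset"
begin

definition bilinear_form ::
    "(complex \<Rightarrow> 'v::ab_group_add \<Rightarrow> 'v) \<Rightarrow> ('v \<Rightarrow> 'v \<Rightarrow> complex) \<Rightarrow> bool" where
  "bilinear_form smul \<omega> \<longleftrightarrow>
     (\<forall>u. Vector_Spaces.linear smul (*) (\<lambda>v. \<omega> u v)) \<and>
     (\<forall>v. Vector_Spaces.linear smul (*) (\<lambda>u. \<omega> u v))"

definition skew_symmetric :: "('v \<Rightarrow> 'v \<Rightarrow> complex) \<Rightarrow> bool" where
  "skew_symmetric \<omega> \<longleftrightarrow> (\<forall>u v. \<omega> u v = - \<omega> v u)"

text \<open>For a skew-symmetric form the left and the right radical agree.\<close>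

definition nondegenerate :: "('v::zero \<Rightarrow> 'v \<Rightarrow> complex) \<Rightarrow> bool" where
  "nondegenerate \<omega> \<longleftrightarrow> (\<forall>u. (\<forall>v. \<omega> u v = 0) \<longrightarrow> u = 0)"

definition Sp ::
    "(complex \<Rightarrow> 'v::ab_group_add \<Rightarrow> 'v) \<Rightarrow> ('v \<Rightarrow> 'v \<Rightarrow> complex) \<Rightarrow> ('v \<Rightarrow> 'v) set" where
  "Sp smul \<omega> = {g. Vector_Spaces.linear smul smul g \<and> bij g \<and> (\<forall>u v. \<omega> (g u) (g v) = \<omega> u v)}"

text \<open>
  A point of \<open>V\<^sup>n\<close> is represented by a sequence \<open>v :: nat \<Rightarrow> 'v\<close> of which only the entries
  \<open>v 1, \<dots>, v n\<close> matter: the functions below are generated by linear functionals of these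
  entries, so that \<open>\<complex>[V\<^sup>n]\<close> is embedded into the functions on all sequences by pullback along
  \<open>v \<mapsto> (v 1, \<dots>, v n)\<close>.
\<close>

definition fscale :: "complex \<Rightarrow> ('a \<Rightarrow> complex) \<Rightarrow> 'a \<Rightarrow> complex" where
  "fscale c p = (\<lambda>x. c * p x)"

global_interpretation fun_vs: vector_space "fscale :: complex \<Rightarrow> ('a \<Rightarrow> complex) \<Rightarrow> 'a \<Rightarrow> complex"
  by unfold_locales (auto simp: fscale_def fun_eq_iff algebra_simps)

definition form_products ::
    "(complex \<Rightarrow> 'v::ab_group_add \<Rightarrow> 'v) \<Rightarrow> nat \<Rightarrow> nat \<Rightarrow> ((nat \<Rightarrow> 'v) \<Rightarrow> complex) set" where
  "form_products smul n d =
     {(\<lambda>v. \<Prod>l<d. \<phi> l (v (\<iota> l))) | \<phi> \<iota>.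
        \<forall>l<d. Vector_Spaces.linear smul (*) (\<phi> l) \<and> \<iota> l \<in> {1..n}}"

definition homogeneous_polys ::
    "(complex \<Rightarrow> 'v::ab_group_add \<Rightarrow> 'v) \<Rightarrow> nat \<Rightarrow> nat \<Rightarrow> ((nat \<Rightarrow> 'v) \<Rightarrow> complex) set" where
  "homogeneous_polys smul n d = fun_vs.span (form_products smul n d)"

definition polys ::
    "(complex \<Rightarrow> 'v::ab_group_add \<Rightarrow> 'v) \<Rightarrow> nat \<Rightarrow> ((nat \<Rightarrow> 'v) \<Rightarrow> complex) set" where
  "polys smul n = fun_vs.span (\<Union>d. form_products smul n d)"

definition Sp_invariants ::
    "(complex \<Rightarrow> 'v::ab_group_add \<Rightarrow> 'v) \<Rightarrow> ('v \<Rightarrow> 'v \<Rightarrow> complex) \<Rightarrow> nat \<Rightarrow>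
     ((nat \<Rightarrow> 'v) \<Rightarrow> complex) set" where
  "Sp_invariants smul \<omega> n =
     {p \<in> polys smul n. \<forall>g \<in> Sp smul \<omega>. \<forall>v. p (\<lambda>i. g (v i)) = p v}"

definition homogeneous_Sp_invariants ::
    "(complex \<Rightarrow> 'v::ab_group_add \<Rightarrow> 'v) \<Rightarrow> ('v \<Rightarrow> 'v \<Rightarrow> complex) \<Rightarrow> nat \<Rightarrow> nat \<Rightarrow>
     ((nat \<Rightarrow> 'v) \<Rightarrow> complex) set" where
  "homogeneous_Sp_invariants smul \<omega> n d =
     Sp_invariants smul \<omega> n \<inter> homogeneous_polys smul n d"

type_synonym arc = "nat \<times> nat"

definition arc_diagram :: "nat \<Rightarrow> arc multiset \<Rightarrow> bool" where
  "arc_diagram n D \<longleftrightarrow> set_mset D \<subseteq> {(i, j). 1 \<le> i \<and> i < j \<and> j \<le> n}"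

definition vertex_degree :: "arc multiset \<Rightarrow> nat \<Rightarrow> nat" where
  "vertex_degree D x = size {#a \<in># D. fst a = x \<or> snd a = x#}"

definition total_degree :: "nat \<Rightarrow> arc multiset \<Rightarrow> nat" where
  "total_degree n D = (\<Sum>x = 1..n. vertex_degree D x)"

definition strictly_nested :: "arc \<Rightarrow> arc \<Rightarrow> bool" where
  "strictly_nested = (\<lambda>(i, j) (i', j'). (i < i' \<and> i' < j' \<and> j' < j) \<or> (i' < i \<and> i < j \<and> j < j'))"

definition strict_nesting :: "arc set \<Rightarrow> bool" where
  "strict_nesting S \<longleftrightarrow> (\<forall>a \<in> S. \<forall>b \<in> S. a \<noteq> b \<longrightarrow> strictly_nested a b)"

definition admissible_diagrams :: "nat \<Rightarrow> nat \<Rightarrow> nat \<Rightarrow> arc multiset set" where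
  "admissible_diagrams k n d =
     {D. arc_diagram n D \<and> total_degree n D = d \<and>
         (\<forall>S \<subseteq> set_mset D. strict_nesting S \<longrightarrow> card S \<le> k)}"

definition diagram_function ::
    "('v \<Rightarrow> 'v \<Rightarrow> complex) \<Rightarrow> arc multiset \<Rightarrow> (nat \<Rightarrow> 'v) \<Rightarrow> complex" where
  "diagram_function \<omega> D = (\<lambda>v. \<Prod>(i, j) \<in># D. \<omega> (v i) (v j))"

end

theory Submission
  imports Defs "HOL-Library.FuncSet" "HOL-Combinatorics.Permutations"
begin

text \<open>
  Call the product of the functions \<open>\<omega> (v i) (v j)\<close> over the arcs \<open>(i, j)\<close> of a diagram
  its diagram function. There are three claims behind the theorem: every homogeneous invariant is
  a combination of diagram functions, a diagram with a strict nesting of \<open>k + 1\<close> arcs can be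
  rewritten in terms of the other diagrams, and the functions of the remaining, admissible
  diagrams are linearly independent.

  \<^item> Diagram functions span (\<open>span_diagram_functions\<close>). By polarization it is enough to treat a
    multilinear invariant \<open>T\<close> of \<open>d\<close> vectors. Differentiating the invariance under symplectic
    transvections and contracting with dual bases shows that the Casimir element of the symplectic
    Lie algebra kills \<open>T\<close>. Up to normalization this element acts on tensors as \<open>d * (2 * k + 1)\<close>
    plus, summed over the ordered pairs \<open>l \<noteq> m\<close> of arguments, the swaps of \<open>l\<close> and \<open>m\<close> and the terms
    \<open>\<omega> (u l) (u m) * T'\<close>, where \<open>T'\<close> is the contraction of \<open>T\<close> in \<open>l\<close> and \<open>m\<close>, again an invariant
    (\<open>casimir_identity\<close>). By induction on \<open>d\<close> the last terms are combinations of products of forms.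
    So \<open>Q T\<close> is such a combination, where \<open>Q\<close> is \<open>d * (2 * k + 1)\<close> plus the sum of the swaps. The
    matrix units \<open>E\<^bsub>ab\<^esub>\<close> act on tensors as derivations, \<open>E\<^bsub>ba\<^esub>\<close> is the adjoint of \<open>E\<^bsub>ab\<^esub>\<close>, and
    \<open>Q - d\<close> is the sum of all \<open>E\<^bsub>ab\<^esub> * E\<^bsub>ba\<^esub>\<close>. Hence \<open>Q - d\<close> is positive semidefinite, and \<open>Q\<close> is
    injective for \<open>d > 0\<close> (\<open>swap_operator_positive\<close>). As \<open>Q\<close> maps the
    finite-dimensional span of the products of forms to itself, it is onto there, and \<open>T\<close> itself
    lies in this span (\<open>multilinear_invariants\<close>).

  \<^item> Straightening (\<open>straightening\<close>). The alternating sum of a multilinear function over the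
    permutations of \<open>2 * k + 2\<close> vectors of a \<open>2 * k\<close>-dimensional space vanishes. Applied to a product
    of \<open>k + 1\<close> forms this is the Pfaffian relation. If the vectors sit at the ends of \<open>k + 1\<close> nested
    arcs, the permutations that respect the nested matching all contribute the same term, while
    every other matching of these ends has a smaller multiset of arc lengths. So a diagram that
    contains the nesting is a combination of diagrams that are smaller in a well-founded order.

  \<^item> Independence (\<open>admissible_diagrams_independent\<close>). The arcs of an admissible diagram \<open>D\<close> can
    be coloured by nesting depth with \<open>k\<close> colours such that arcs of one colour are never strictly
    nested (\<open>nesting_colouring\<close>). Attach to each colour a hyperbolic pair of the symplectic basis,
    and to \<open>D\<close> the monomial in which the left end of an arc carries the first and the right end the
    second vector of the pair of its colour. This monomial occurs in the function of a diagram \<open>E\<close>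
    only if \<open>E\<close> results from \<open>D\<close> by rematching left and right ends within the colours. Since the
    arcs of one colour are matched in sorted order, the rearrangement inequality says that \<open>D\<close> is
    the unique maximum of the sum of all \<open>i * j\<close> among these \<open>E\<close>. This makes the coefficients
    triangular, and the diagonal ones are sums of ones.
\<close>

section \<open>Multilinear functions\<close>

locale complex_space = vector_space smul
  for smul :: "complex \<Rightarrow> 'v::ab_group_add \<Rightarrow> 'v" (infixr "*s" 75)
begin

text \<open>
  A function of \<open>card I\<close> vectors is encoded as a function of sequences that depends only on the
  entries with index in \<open>I\<close>. Arbitrary index sets are allowed because the contraction of two
  arguments then just removes two indices.
\<close>

definition multilinear_on :: "nat set \<Rightarrow> ((nat \<Rightarrow> 'v) \<Rightarrow> complex) \<Rightarrow> bool" where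
  "multilinear_on I T \<longleftrightarrow>
     (\<forall>u u'. (\<forall>l\<in>I. u l = u' l) \<longrightarrow> T u = T u') \<and>
     (\<forall>u. \<forall>l\<in>I. \<forall>x y. T (u(l := x + y)) = T (u(l := x)) + T (u(l := y))) \<and>
     (\<forall>u. \<forall>l\<in>I. \<forall>c x. T (u(l := c *s x)) = c * T (u(l := x)))"

lemma multilinear_cong:
  "multilinear_on I T \<Longrightarrow> (\<And>l. l \<in> I \<Longrightarrow> u l = u' l) \<Longrightarrow> T u = T u'"
  by (auto simp: multilinear_on_def)

lemma multilinear_add:
  "multilinear_on I T \<Longrightarrow> l \<in> I \<Longrightarrow> T (u(l := x + y)) = T (u(l := x)) + T (u(l := y))"
  by (auto simp: multilinear_on_def)

lemma multilinear_scale: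
  "multilinear_on I T \<Longrightarrow> l \<in> I \<Longrightarrow> T (u(l := c *s x)) = c * T (u(l := x))"
  by (auto simp: multilinear_on_def)

lemma multilinear_zero:
  assumes "multilinear_on I T" "l \<in> I" shows "T (u(l := 0)) = 0"
  using multilinear_scale[OF assms, of u 0 0] by simp

lemma multilinear_zero':
  assumes "multilinear_on I T" "l \<in> I" "u l = 0" shows "T u = 0"
  using multilinear_zero[OF assms(1,2), of u] assms(3) by (simp add: fun_upd_idem)

lemma multilinear_minus:
  assumes "multilinear_on I T" "l \<in> I" shows "T (u(l := - x)) = - T (u(l := x))"
  using multilinear_scale[OF assms, of u "-1" x] by simp

lemma multilinear_sum:
  assumes "multilinear_on I T" "l \<in> I"
  shows "T (u(l := (\<Sum>j\<in>J. g j))) = (\<Sum>j\<in>J. T (u(l := g j)))"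
proof (induction J rule: infinite_finite_induct)
  case (insert j J)
  have "T (u(l := sum g (insert j J))) = T (u(l := g j)) + T (u(l := sum g J))"
    unfolding sum.insert[OF insert.hyps(1,2)] by (rule multilinear_add[OF assms])
  then show ?case using insert by (simp only: sum.insert[OF insert.hyps(1,2)])
next
  case (infinite J)
  then show ?case by (simp only: sum.infinite[OF infinite] multilinear_zero[OF assms])
qed (simp only: sum.empty multilinear_zero[OF assms])

text \<open>
  The expansion is done one argument at a time, so the arguments that are not yet expanded must
  be allowed to have arbitrary values \<open>w\<close>.
\<close>

lemma multilinear_expand_partial:
  assumes "multilinear_on I T" and "finite I'" and "I' \<subseteq> I" and "finite J"
  shows "T (\<lambda>l. if l \<in> I' then \<Sum>j\<in>J. y l j else w l)
       = (\<Sum>t \<in> I' \<rightarrow>\<^sub>E J. T (\<lambda>l. if l \<in> I' then y l (t l) else w l))"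
  using assms(2,3)
proof (induction I' arbitrary: w rule: finite_induct)
  case empty
  then show ?case by simp
next
  case (insert i I')
  have inj: "inj_on (\<lambda>(j, t). t(i := j)) (J \<times> (I' \<rightarrow>\<^sub>E J))"
    using inj_combinator[OF insert.hyps(2), of "\<lambda>_. J"] by simp
  have "T (\<lambda>l. if l \<in> insert i I' then \<Sum>j\<in>J. y l j else w l)
      = T ((\<lambda>l. if l \<in> I' then \<Sum>j\<in>J. y l j else w l)(i := \<Sum>j\<in>J. y i j))"
    by (rule arg_cong[of _ _ T]) auto
  also have "\<dots> = (\<Sum>j\<in>J. T ((\<lambda>l. if l \<in> I' then \<Sum>j\<in>J. y l j else w l)(i := y i j)))"
    using insert.prems by (intro multilinear_sum[OF assms(1)]) auto
  also have "\<dots> = (\<Sum>j\<in>J. T (\<lambda>l. if l \<in> I' then \<Sum>j\<in>J. y l j else (w(i := y i j)) l))"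
    using insert.hyps(2) by (intro sum.cong refl arg_cong[of _ _ T]) auto
  also have "\<dots> = (\<Sum>j\<in>J. \<Sum>t\<in>I' \<rightarrow>\<^sub>E J. T (\<lambda>l. if l \<in> I' then y l (t l) else (w(i := y i j)) l))"
    using insert.prems by (intro sum.cong refl insert.IH) auto
  also have "\<dots> = (\<Sum>(j, t)\<in>J \<times> (I' \<rightarrow>\<^sub>E J).
      T (\<lambda>l. if l \<in> insert i I' then y l ((t(i := j)) l) else w l))"
    unfolding sum.cartesian_product using insert.hyps(2)
    by (intro sum.cong refl) (auto intro!: arg_cong[of _ _ T])
  also have "\<dots> = (\<Sum>t\<in>(\<lambda>(j, t). t(i := j)) ` (J \<times> (I' \<rightarrow>\<^sub>E J)).
      T (\<lambda>l. if l \<in> insert i I' then y l (t l) else w l))"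
    by (subst sum.reindex[OF inj]) (auto intro!: sum.cong)
  also have "(\<lambda>(j, t). t(i := j)) ` (J \<times> (I' \<rightarrow>\<^sub>E J)) = insert i I' \<rightarrow>\<^sub>E J"
    by (simp add: PiE_insert_eq)
  finally show ?case .
qed

lemma multilinear_expand:
  assumes "multilinear_on I T" and "finite I" and "finite J"
  shows "T (\<lambda>l. \<Sum>j\<in>J. y l j) = (\<Sum>t \<in> I \<rightarrow>\<^sub>E J. T (\<lambda>l. y l (t l)))"
proof -
  have "T (\<lambda>l. \<Sum>j\<in>J. y l j) = T (\<lambda>l. if l \<in> I then \<Sum>j\<in>J. y l j else 0)"
    by (rule multilinear_cong[OF assms(1)]) simp
  also have "\<dots> = (\<Sum>t \<in> I \<rightarrow>\<^sub>E J. T (\<lambda>l. if l \<in> I then y l (t l) else 0))"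
    by (rule multilinear_expand_partial[OF assms(1,2) order_refl assms(3)])
  also have "\<dots> = (\<Sum>t \<in> I \<rightarrow>\<^sub>E J. T (\<lambda>l. y l (t l)))"
    by (intro sum.cong refl multilinear_cong[OF assms(1)]) simp
  finally show ?thesis .
qed

lemma multilinear_scale_all:
  assumes "multilinear_on I T" and "finite I"
  shows "T (\<lambda>l. c l *s u l) = (\<Prod>l\<in>I. c l) * T u"
proof -
  have "T (\<lambda>l. if l \<in> I' then c l *s u l else u l) = (\<Prod>l\<in>I'. c l) * T u" if "finite I'" "I' \<subseteq> I" for I'
    using that
  proof (induction I' rule: finite_induct)
    case (insert i I')
    have "T (\<lambda>l. if l \<in> insert i I' then c l *s u l else u l)
      = T ((\<lambda>l. if l \<in> I' then c l *s u l else u l)(i := c i *s u i))"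
      by (rule arg_cong[of _ _ T]) auto
    also have "\<dots> = c i * T ((\<lambda>l. if l \<in> I' then c l *s u l else u l)(i := u i))"
      using insert.prems by (intro multilinear_scale[OF assms(1)]) auto
    also have "(\<lambda>l. if l \<in> I' then c l *s u l else u l)(i := u i) = (\<lambda>l. if l \<in> I' then c l *s u l else u l)"
      using insert.hyps by auto
    finally show ?case using insert by simp
  qed simp
  from this[OF assms(2) order_refl] show ?thesis
    using multilinear_cong[OF assms(1), of "\<lambda>l. if l \<in> I then c l *s u l else u l" "\<lambda>l. c l *s u l"] by simp
qed

lemma subspace_multilinear_on: "fun_vs.subspace {T. multilinear_on I T}"
proof -
  have "multilinear_on I (S + T)" if S: "multilinear_on I S" and T: "multilinear_on I T" for S T
    unfolding multilinear_on_def plus_fun_apply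
  proof (intro conjI allI ballI impI)
    fix u u' :: "nat \<Rightarrow> 'v" assume "\<forall>l\<in>I. u l = u' l"
    then show "S u + T u = S u' + T u'"
      using multilinear_cong[OF S, of u u'] multilinear_cong[OF T, of u u'] by simp
  qed (simp_all only: multilinear_add[OF S] multilinear_add[OF T]
      multilinear_scale[OF S] multilinear_scale[OF T] distrib_left add.assoc add.left_commute)
  moreover have "multilinear_on I (fscale c T)" if T: "multilinear_on I T" for c T
    unfolding multilinear_on_def fscale_def
  proof (intro conjI allI ballI impI)
    fix u u' :: "nat \<Rightarrow> 'v" assume "\<forall>l\<in>I. u l = u' l"
    then show "c * T u = c * T u'" using multilinear_cong[OF T, of u u'] by simp
  qed (simp_all only: multilinear_add[OF T] multilinear_scale[OF T] distrib_left mult.left_commute)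
  ultimately show ?thesis
    by (auto simp: fun_vs.subspace_def multilinear_on_def)
qed

lemma multilinear_on_0: "multilinear_on I (\<lambda>_. 0)"
  by (simp add: multilinear_on_def)

lemma multilinear_on_sum:
  assumes "\<And>j. j \<in> J \<Longrightarrow> multilinear_on I (F j)"
  shows "multilinear_on I (\<lambda>u. \<Sum>j\<in>J. F j u)"
proof -
  have "multilinear_on I (\<Sum>j\<in>J. F j)"
    using fun_vs.subspace_sum[OF subspace_multilinear_on, of J F] assms by simp
  moreover have "(\<Sum>j\<in>J. F j) = (\<lambda>u. \<Sum>j\<in>J. F j u)" 
    by (induction J rule: infinite_finite_induct) (auto simp: fun_eq_iff)
  ultimately show ?thesis by simp
qed

lemma multilinear_on_reindex:
  assumes T: "multilinear_on I T" and t: "bij_betw t I I'"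
  shows "multilinear_on I' (\<lambda>u. T (\<lambda>l. u (t l)))"
proof -
  have upd: "T (\<lambda>l. (u(t m := x)) (t l)) = T ((\<lambda>l. u (t l))(m := x))" if "m \<in> I" for u m x
    using t that by (intro multilinear_cong[OF T]) (auto simp: bij_betw_def inj_on_def)
  have I': "I' = t ` I" using t by (simp add: bij_betw_def)
  show ?thesis
    unfolding multilinear_on_def I'
  proof (intro conjI allI ballI impI)
    fix u u' :: "nat \<Rightarrow> 'v" assume "\<forall>l\<in>t ` I. u l = u' l"
    then show "T (\<lambda>l. u (t l)) = T (\<lambda>l. u' (t l))" by (intro multilinear_cong[OF T]) simp
  next
    fix u :: "nat \<Rightarrow> 'v" and l x y assume "l \<in> t ` I"
    then obtain m where m: "l = t m" "m \<in> I" by auto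
    show "T (\<lambda>j. (u(l := x + y)) (t j)) = T (\<lambda>j. (u(l := x)) (t j)) + T (\<lambda>j. (u(l := y)) (t j))"
      unfolding m(1) upd[OF m(2)] by (rule multilinear_add[OF T m(2)])
  next
    fix u :: "nat \<Rightarrow> 'v" and l c x assume "l \<in> t ` I"
    then obtain m where m: "l = t m" "m \<in> I" by auto
    show "T (\<lambda>j. (u(l := c *s x)) (t j)) = c * T (\<lambda>j. (u(l := x)) (t j))"
      unfolding m(1) upd[OF m(2)] by (rule multilinear_scale[OF T m(2)])
  qed
qed

end

text \<open>
  Inclusion and exclusion: for \<open>A \<noteq> B\<close>, toggling a fixed element of \<open>B - A\<close> pairs off the terms
  with opposite signs.
\<close>

lemma sum_minus_one_interval:
  assumes "finite B" and "A \<subseteq> B"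
  shows "(\<Sum>S | A \<subseteq> S \<and> S \<subseteq> B. (-1) ^ (card B - card S)) = (if A = B then 1 else (0::complex))"
proof (cases "A = B")
  case True
  then have "{S. A \<subseteq> S \<and> S \<subseteq> B} = {B}" by auto
  then show ?thesis using True by simp
next
  case False
  then obtain x where x: "x \<in> B" "x \<notin> A" using assms by auto
  have "(\<Sum>S | A \<subseteq> S \<and> S \<subseteq> B. (-1) ^ (card B - card S))
      = (\<Sum>S \<in> {S. A \<subseteq> S \<and> S \<subseteq> B - {x}} \<union> insert x ` {S. A \<subseteq> S \<and> S \<subseteq> B - {x}}. (-1) ^ (card B - card S) :: complex)"
  proof (intro sum.cong refl set_eqI iffI)
    fix S assume S: "S \<in> {S. A \<subseteq> S \<and> S \<subseteq> B}"
    show "S \<in> {S. A \<subseteq> S \<and> S \<subseteq> B - {x}} \<union> insert x ` {S. A \<subseteq> S \<and> S \<subseteq> B - {x}}"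
    proof (cases "x \<in> S")
      case True
      then have "S = insert x (S - {x})" "S - {x} \<in> {S. A \<subseteq> S \<and> S \<subseteq> B - {x}}" using S x by auto
      then show ?thesis by blast
    qed (use S in auto)
  qed (use x in auto)
  also have "\<dots> = (\<Sum>S | A \<subseteq> S \<and> S \<subseteq> B - {x}. (-1) ^ (card B - card S))
      + (\<Sum>S | A \<subseteq> S \<and> S \<subseteq> B - {x}. (-1) ^ (card B - card (insert x S)))"
  proof (subst sum.union_disjoint)
    have fin: "finite {S. A \<subseteq> S \<and> S \<subseteq> B - {x}}"
      using assms by (auto intro: finite_subset[of _ "Pow B"])
    then show "finite {S. A \<subseteq> S \<and> S \<subseteq> B - {x}}" "finite (insert x ` {S. A \<subseteq> S \<and> S \<subseteq> B - {x}})" by auto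
    have inj: "inj_on (insert x) {S. A \<subseteq> S \<and> S \<subseteq> B - {x}}"
      by (rule inj_onI) (simp add: insert_ident subset_Diff_insert)
    show "(\<Sum>S | A \<subseteq> S \<and> S \<subseteq> B - {x}. (-1) ^ (card B - card S)) +
      (\<Sum>S \<in> insert x ` {S. A \<subseteq> S \<and> S \<subseteq> B - {x}}. (-1) ^ (card B - card S))
     = (\<Sum>S | A \<subseteq> S \<and> S \<subseteq> B - {x}. (-1) ^ (card B - card S))
      + (\<Sum>S | A \<subseteq> S \<and> S \<subseteq> B - {x}. (-1) ^ (card B - card (insert x S)) :: complex)"
      by (subst sum.reindex[OF inj]) simp
  qed auto
  also have "\<dots> = (\<Sum>S | A \<subseteq> S \<and> S \<subseteq> B - {x}. 0)"
    unfolding sum.distrib[symmetric]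
  proof (intro sum.cong refl)
    fix S assume S: "S \<in> {S. A \<subseteq> S \<and> S \<subseteq> B - {x}}"
    then have "finite S" "x \<notin> S" using assms by (auto intro: finite_subset)
    moreover have "card S < card B" using S x assms by (intro psubset_card_mono) auto
    ultimately have "card B - card S = Suc (card B - card (insert x S))" by simp
    then show "(-1) ^ (card B - card S) + (-1) ^ (card B - card (insert x S)) = (0::complex)" by simp
  qed
  finally show ?thesis using False by simp
qed

context complex_space
begin

text \<open>
  The alternating sum extracts the part of \<open>\<Phi>\<close> in which every index \<open>m < d\<close> is used, because the
  maps \<open>t\<close> with a smaller range cancel. For a product of linear functionals this is Ryser's formula
  for the permanent.
\<close>

lemma polarization_formula:
  assumes \<Phi>: "multilinear_on {..<d} \<Phi>"
  shows "(\<Sum>S\<in>Pow {..<d}. (-1) ^ (d - card S) * \<Phi> (\<lambda>l. \<Sum>m\<in>S. y l m))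
    = (\<Sum>t | t \<in> {..<d} \<rightarrow>\<^sub>E {..<d} \<and> t ` {..<d} = {..<d}. \<Phi> (\<lambda>l. y l (t l)))"
proof -
  let ?E = "{..<d} \<rightarrow>\<^sub>E {..<d}"
  have fin: "finite ?E" by (intro finite_PiE) auto
  have "(\<Sum>S\<in>Pow {..<d}. (-1) ^ (d - card S) * \<Phi> (\<lambda>l. \<Sum>m\<in>S. y l m))
    = (\<Sum>S\<in>Pow {..<d}. \<Sum>t \<in> ?E. if t ` {..<d} \<subseteq> S then (-1) ^ (d - card S) * \<Phi> (\<lambda>l. y l (t l)) else 0)"
  proof (intro sum.cong refl)
    fix S assume S: "S \<in> Pow {..<d}"
    then have "finite S" by (auto intro: finite_subset)
    then have "(-1) ^ (d - card S) * \<Phi> (\<lambda>l. \<Sum>m\<in>S. y l m)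
      = (\<Sum>t \<in> {..<d} \<rightarrow>\<^sub>E S. (-1) ^ (d - card S) * \<Phi> (\<lambda>l. y l (t l)))"
      by (simp add: multilinear_expand[OF \<Phi>] sum_distrib_left)
    also have "{..<d} \<rightarrow>\<^sub>E S = {t \<in> ?E. t ` {..<d} \<subseteq> S}"
      using S by (auto simp: PiE_def)
    finally show "(-1) ^ (d - card S) * \<Phi> (\<lambda>l. \<Sum>m\<in>S. y l m)
      = (\<Sum>t \<in> ?E. if t ` {..<d} \<subseteq> S then (-1) ^ (d - card S) * \<Phi> (\<lambda>l. y l (t l)) else 0)"
      by (simp add: sum.inter_filter[OF fin])
  qed
  also have "\<dots> = (\<Sum>t \<in> ?E. \<Sum>S\<in>Pow {..<d}. if t ` {..<d} \<subseteq> S then (-1) ^ (d - card S) * \<Phi> (\<lambda>l. y l (t l)) else 0)"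
    by (rule sum.swap)
  also have "\<dots> = (\<Sum>t \<in> ?E. if t ` {..<d} = {..<d} then \<Phi> (\<lambda>l. y l (t l)) else 0)"
  proof (intro sum.cong refl)
    fix t assume t: "t \<in> ?E"
    have sub: "t ` {..<d} \<subseteq> {..<d}" using t by auto
    have "(\<Sum>S\<in>Pow {..<d}. if t ` {..<d} \<subseteq> S then (-1) ^ (d - card S) * \<Phi> (\<lambda>l. y l (t l)) else 0)
      = (\<Sum>S\<in>{S \<in> Pow {..<d}. t ` {..<d} \<subseteq> S}. (-1) ^ (d - card S) * \<Phi> (\<lambda>l. y l (t l)))"
      by (simp add: sum.inter_filter[symmetric])
    also have "{S \<in> Pow {..<d}. t ` {..<d} \<subseteq> S} = {S. t ` {..<d} \<subseteq> S \<and> S \<subseteq> {..<d}}" by auto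
    also have "(\<Sum>S | t ` {..<d} \<subseteq> S \<and> S \<subseteq> {..<d}. (-1) ^ (d - card S) * \<Phi> (\<lambda>l. y l (t l)))
      = (if t ` {..<d} = {..<d} then 1 else 0) * \<Phi> (\<lambda>l. y l (t l))"
      unfolding sum_distrib_right[symmetric]
      using sum_minus_one_interval[of "{..<d}" "t ` {..<d}"] sub by simp
    finally show "(\<Sum>S\<in>Pow {..<d}. if t ` {..<d} \<subseteq> S then (-1) ^ (d - card S) * \<Phi> (\<lambda>l. y l (t l)) else 0)
      = (if t ` {..<d} = {..<d} then \<Phi> (\<lambda>l. y l (t l)) else 0)" by simp
  qed
  also have "\<dots> = (\<Sum>t \<in> {t \<in> ?E. t ` {..<d} = {..<d}}. \<Phi> (\<lambda>l. y l (t l)))"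
    by (simp add: sum.inter_filter[OF fin])
  finally show ?thesis by simp
qed

end

section \<open>Positivity of the swap operator\<close>

lemma sum_norm_squares_fibres:
  fixes x :: "nat \<Rightarrow> complex"
  assumes "finite I" and "t \<in> I \<rightarrow> {..<N::nat}"
  shows "(\<Sum>l\<in>I. \<Sum>m\<in>I. if t l = t m then x l * cnj (x m) else 0)
    = complex_of_real (\<Sum>a<N. (cmod (\<Sum>l\<in>I. if t l = a then x l else 0))\<^sup>2)"
proof -
  have "complex_of_real (\<Sum>a<N. (cmod (\<Sum>l\<in>I. if t l = a then x l else 0))\<^sup>2)
    = (\<Sum>a<N. (\<Sum>l\<in>I. if t l = a then x l else 0) * cnj (\<Sum>l\<in>I. if t l = a then x l else 0))"
    unfolding of_real_sum complex_norm_square ..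
  also have "\<dots> = (\<Sum>a<N. \<Sum>l\<in>I. \<Sum>m\<in>I. (if t l = a then x l else 0) * cnj (if t m = a then x m else 0))"
    by (simp add: sum_product)
  also have "\<dots> = (\<Sum>l\<in>I. \<Sum>a<N. \<Sum>m\<in>I. (if t l = a then x l else 0) * cnj (if t m = a then x m else 0))"
    by (rule sum.swap)
  also have "\<dots> = (\<Sum>l\<in>I. \<Sum>m\<in>I. \<Sum>a<N. (if t l = a then x l else 0) * cnj (if t m = a then x m else 0))"
    by (intro sum.cong refl sum.swap)
  also have "\<dots> = (\<Sum>l\<in>I. \<Sum>m\<in>I. if t l = t m then x l * cnj (x m) else 0)"
  proof (intro sum.cong refl)
    fix l m assume "l \<in> I" "m \<in> I"
    then have "t l < N" using assms by auto
    have "(\<Sum>a<N. (if t l = a then x l else 0) * cnj (if t m = a then x m else 0))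
      = (\<Sum>a<N. if a = t l then x l * cnj (if t m = a then x m else 0) else 0)"
      by (intro sum.cong refl) auto
    then show "(\<Sum>a<N. (if t l = a then x l else 0) * cnj (if t m = a then x m else 0))
      = (if t l = t m then x l * cnj (x m) else 0)"
      using \<open>t l < N\<close> by (simp add: sum.delta)
  qed
  finally show ?thesis by simp
qed

text \<open>
  View \<open>A\<close> as the family of values of a tensor on the tuples of basis vectors. The sum of the squared
  norms of the images of \<open>A\<close> under all matrix units is nonnegative. Expanded, it is a sum over pairs
  \<open>l, m\<close> of arguments with \<open>t l = t m\<close>: the pairs \<open>l = m\<close> contribute \<open>N * card I\<close> times the
  squared norm of \<open>A\<close>, and the pairs \<open>l \<noteq> m\<close> the scalar products of \<open>A\<close> with its swaps. Hence the
  operator in the hypothesis is bounded below by the positive constant \<open>c\<close> and has no kernel.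
\<close>

lemma swap_operator_positive:
  fixes A :: "(nat \<Rightarrow> nat) \<Rightarrow> complex"
  assumes fin: "finite I" and c: "c > (0::real)"
    and eq: "\<And>s. s \<in> I \<rightarrow>\<^sub>E {..<N} \<Longrightarrow>
      (of_real c + of_nat (N * card I)) * A s + (\<Sum>m\<in>I. \<Sum>l\<in>I - {m}. A (s(l := s m, m := s l))) = 0"
    and s: "s \<in> I \<rightarrow>\<^sub>E {..<N}"
  shows "A s = 0"
proof -
  let ?P = "I \<rightarrow>\<^sub>E {..<N}"
  have finP: "finite ?P" using fin by (intro finite_PiE) auto
  \<comment> \<open>\<open>W\<close> is the sum of the squared norms of the images of \<open>A\<close> under the matrix units \<open>E\<^bsub>ab\<^esub>\<close>, which act as derivations on tensors given by their values on basis tuples\<close>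
  define W where "W = (\<Sum>t\<in>?P. \<Sum>b<N. \<Sum>a<N. (cmod (\<Sum>l\<in>I. if t l = a then A (t(l := b)) else 0))\<^sup>2)"
  have "complex_of_real W = (\<Sum>t\<in>?P. \<Sum>b<N. \<Sum>l\<in>I. \<Sum>m\<in>I.
      if t l = t m then A (t(l := b)) * cnj (A (t(m := b))) else 0)"
    unfolding W_def of_real_sum[where f = "\<lambda>t. \<Sum>b<N. _ t b"] of_real_sum[where f = "\<lambda>b. sum (_ b) _"]
    by (intro sum.cong refl sum_norm_squares_fibres[OF fin, symmetric]) auto
  also have "\<dots> = (\<Sum>t\<in>?P. \<Sum>l\<in>I. \<Sum>b<N. \<Sum>m\<in>I.
      if t l = t m then A (t(l := b)) * cnj (A (t(m := b))) else 0)"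
    by (intro sum.cong refl sum.swap)
  also have "\<dots> = (\<Sum>l\<in>I. \<Sum>t\<in>?P. \<Sum>b<N. \<Sum>m\<in>I.
      if t l = t m then A (t(l := b)) * cnj (A (t(m := b))) else 0)"
    by (rule sum.swap)
  also have "\<dots> = (\<Sum>l\<in>I. \<Sum>t\<in>?P. \<Sum>m\<in>I. \<Sum>b<N.
      if t l = t m then A (t(l := b)) * cnj (A (t(m := b))) else 0)"
    by (intro sum.cong refl sum.swap)
  also have "\<dots> = (\<Sum>l\<in>I. \<Sum>m\<in>I. \<Sum>t\<in>?P. \<Sum>b<N.
      if t l = t m then A (t(l := b)) * cnj (A (t(m := b))) else 0)"
    by (intro sum.cong refl sum.swap)
  also have "\<dots> = (\<Sum>l\<in>I. \<Sum>m\<in>I. \<Sum>s\<in>?P.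
      (if l = m then of_nat N * A s else A (s(l := s m, m := s l))) * cnj (A s))"
  proof (rule sum.cong[OF refl], rule sum.cong[OF refl])
    fix l m assume l: "l \<in> I" and m: "m \<in> I"
    show "(\<Sum>t\<in>?P. \<Sum>b<N. if t l = t m then A (t(l := b)) * cnj (A (t(m := b))) else 0)
      = (\<Sum>s\<in>?P. (if l = m then of_nat N * A s else A (s(l := s m, m := s l))) * cnj (A s))"
    proof (cases "l = m")
      case True
      have "(\<Sum>t\<in>?P. \<Sum>b<N. A (t(l := b)) * cnj (A (t(l := b))))
        = (\<Sum>(t, b)\<in>?P \<times> {..<N}. A (t(l := b)) * cnj (A (t(l := b))))"
        by (rule sum.cartesian_product)
      also have "\<dots> = (\<Sum>(s, a)\<in>?P \<times> {..<N}. A s * cnj (A s))"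
        \<comment> \<open>the overwritten entry \<open>t l\<close> is remembered as \<open>a\<close>\<close>
        by (rule sum.reindex_bij_witness[where i = "\<lambda>(s, a). (s(l := a), s l)" and j = "\<lambda>(t, b). (t(l := b), t l)"])
           (use l in \<open>auto simp: PiE_iff extensional_def\<close>)
      also have "\<dots> = (\<Sum>s\<in>?P. \<Sum>a<N. A s * cnj (A s))"
        by (rule sum.cartesian_product[symmetric])
      finally show ?thesis using True by (simp add: mult.assoc)
    next
      case False
      have "(\<Sum>t\<in>?P. \<Sum>b<N. if t l = t m then A (t(l := b)) * cnj (A (t(m := b))) else 0)
        = (\<Sum>(t, b)\<in>?P \<times> {..<N}. if t l = t m then A (t(l := b)) * cnj (A (t(m := b))) else 0)"
        by (rule sum.cartesian_product)
      also have "\<dots> = (\<Sum>(t, b)\<in>{(t, b). t \<in> ?P \<and> b < N \<and> t l = t m}. A (t(l := b)) * cnj (A (t(m := b))))"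
        by (rule sum.mono_neutral_cong_right) (use finP in \<open>auto split: if_splits\<close>)
      also have "\<dots> = (\<Sum>s\<in>?P. A (s(l := s m, m := s l)) * cnj (A s))"
      proof (rule sum.reindex_bij_witness[where i = "\<lambda>s. (s(m := s l), s m)" and j = "\<lambda>(t, b). t(m := b)"], goal_cases)
        case (1 p)
        then show ?case using False by (auto simp: fun_upd_idem_iff split: prod.splits)
      next
        case (2 p)
        then show ?case using m by (auto simp: PiE_iff extensional_def split: prod.splits)
      next
        case (3 s)
        then show ?case using False by (simp add: fun_upd_idem_iff)
      next
        case (4 s)
        then show ?case using l m False by (auto simp: PiE_iff extensional_def)
      next
        case (5 p)
        then obtain t b where p: "p = (t, b)" "t l = t m" by auto
        have "t(m := b, l := (t(m := b)) m, m := (t(m := b)) l) = t(l := b)"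
          using False p by (auto simp: fun_eq_iff)
        then show ?case unfolding p by simp
      qed
      finally show ?thesis using False by simp
    qed
  qed
  also have "\<dots> = (\<Sum>l\<in>I. \<Sum>s\<in>?P. \<Sum>m\<in>I.
      (if l = m then of_nat N * A s else A (s(l := s m, m := s l))) * cnj (A s))"
    by (intro sum.cong refl sum.swap)
  also have "\<dots> = (\<Sum>s\<in>?P. \<Sum>l\<in>I. \<Sum>m\<in>I.
      (if l = m then of_nat N * A s else A (s(l := s m, m := s l))) * cnj (A s))"
    by (rule sum.swap)
  also have "\<dots> = (\<Sum>s\<in>?P. - of_real c * A s * cnj (A s))"
  proof (intro sum.cong refl)
    fix s assume s: "s \<in> ?P"
    have "(\<Sum>l\<in>I. \<Sum>m\<in>I. (if l = m then of_nat N * A s else A (s(l := s m, m := s l))))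
      = (\<Sum>m\<in>I. \<Sum>l\<in>I. (if l = m then of_nat N * A s else A (s(l := s m, m := s l))))"
      by (rule sum.swap)
    also have "\<dots> = (\<Sum>m\<in>I. of_nat N * A s + (\<Sum>l\<in>I - {m}. A (s(l := s m, m := s l))))"
    proof (intro sum.cong refl)
      fix m assume m: "m \<in> I"
      show "(\<Sum>l\<in>I. (if l = m then of_nat N * A s else A (s(l := s m, m := s l))))
        = of_nat N * A s + (\<Sum>l\<in>I - {m}. A (s(l := s m, m := s l)))"
        unfolding sum.remove[OF fin m] by simp
    qed
    also have "\<dots> = of_nat (N * card I) * A s + (\<Sum>m\<in>I. \<Sum>l\<in>I - {m}. A (s(l := s m, m := s l)))"
      by (simp add: sum.distrib)
    also have "\<dots> = - of_real c * A s" using eq[OF s] by (simp add: distrib_right add.assoc eq_neg_iff_add_eq_0 add.commute add.left_commute)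
    finally show "(\<Sum>l\<in>I. \<Sum>m\<in>I. (if l = m then of_nat N * A s else A (s(l := s m, m := s l))) * cnj (A s))
      = - of_real c * A s * cnj (A s)" by (simp flip: sum_distrib_right)
  qed
  also have "\<dots> = complex_of_real (- c * (\<Sum>s\<in>?P. (cmod (A s))\<^sup>2))"
    unfolding of_real_mult of_real_minus of_real_sum complex_norm_square
    by (simp add: sum_distrib_left mult.assoc sum_negf)
  finally have "W = - c * (\<Sum>s\<in>?P. (cmod (A s))\<^sup>2)" by (simp only: of_real_eq_iff)
  moreover have "W \<ge> 0" unfolding W_def by (intro sum_nonneg) auto
  moreover have "(\<Sum>s\<in>?P. (cmod (A s))\<^sup>2) \<ge> 0" by (intro sum_nonneg) auto
  ultimately have "(\<Sum>s\<in>?P. (cmod (A s))\<^sup>2) = 0"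
    using mult_pos_pos[OF c, of "\<Sum>s\<in>?P. (cmod (A s))\<^sup>2"] by linarith
  then show ?thesis using s sum_nonneg_eq_0_iff[OF finP, of "\<lambda>s. (cmod (A s))\<^sup>2"] by simp
qed

section \<open>The Casimir identity\<close>

text \<open>
  The basis dual to \<open>bas\<close> with respect to a form that makes \<open>(bas (2 * c), bas (2 * c + 1))\<close>
  hyperbolic pairs that are orthogonal to each other.
\<close>

definition dual_vector :: "(nat \<Rightarrow> 'v::ab_group_add) \<Rightarrow> nat \<Rightarrow> 'v" where
  "dual_vector bas a = (if even a then bas (Suc a) else - bas (a - 1))"

locale symplectic_space = complex_space smul
  for smul :: "complex \<Rightarrow> 'v::ab_group_add \<Rightarrow> 'v" (infixr "*s" 75) +
  fixes \<omega> :: "'v \<Rightarrow> 'v \<Rightarrow> complex" and k :: nat and bas :: "nat \<Rightarrow> 'v"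
  assumes bilinear: "bilinear_form smul \<omega>" and skew: "skew_symmetric \<omega>"
    and bas_form: "\<lbrakk>a < 2 * k; c < 2 * k\<rbrakk> \<Longrightarrow> \<omega> (bas a) (bas c)
      = (if even a \<and> c = Suc a then 1 else if even c \<and> a = Suc c then -1 else 0)"
    and expand: "v = (\<Sum>a<2 * k. \<omega> v (dual_vector bas a) *s bas a)"
begin

abbreviation dual :: "nat \<Rightarrow> 'v" where "dual \<equiv> dual_vector bas"

lemma form_add_right: "\<omega> u (v + w) = \<omega> u v + \<omega> u w"
  and form_scale_right: "\<omega> u (c *s v) = c * \<omega> u v"
  and form_add_left: "\<omega> (v + w) u = \<omega> v u + \<omega> w u"
  and form_scale_left: "\<omega> (c *s v) u = c * \<omega> v u"
proof -
  have r: "Vector_Spaces.linear smul (*) (\<lambda>v. \<omega> u v)" and l: "Vector_Spaces.linear smul (*) (\<lambda>v. \<omega> v u)" for u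
    using bilinear by (simp_all only: bilinear_form_def)
  note r = r[THEN Vector_Spaces.linear_iff[THEN iffD1]] and l = l[THEN Vector_Spaces.linear_iff[THEN iffD1]]
  show "\<omega> u (v + w) = \<omega> u v + \<omega> u w" "\<omega> u (c *s v) = c * \<omega> u v"
    "\<omega> (v + w) u = \<omega> v u + \<omega> w u" "\<omega> (c *s v) u = c * \<omega> v u"
    using r[of u] l[of u] by simp_all
qed

lemma form_flip: "\<omega> v u = - \<omega> u v"
  by (rule skew[unfolded skew_symmetric_def, rule_format])

lemma form_self [simp]: "\<omega> v v = 0"
  using form_flip[of v v] unfolding eq_neg_iff_add_eq_0 by simp

lemma form_zero_right [simp]: "\<omega> u 0 = 0"
  using form_scale_right[of u 0 0] by simp

lemma form_zero_left [simp]: "\<omega> 0 u = 0"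
  using form_scale_left[of 0 0 u] by simp

lemma form_minus_right: "\<omega> u (- v) = - \<omega> u v"
  using form_scale_right[of u "-1" v] by simp

lemma form_sum_left: "\<omega> (\<Sum>a\<in>S. f a) u = (\<Sum>a\<in>S. \<omega> (f a) u)"
  by (induction S rule: infinite_finite_induct) (simp_all add: form_add_left)

lemma form_sum_right: "\<omega> u (\<Sum>a\<in>S. f a) = (\<Sum>a\<in>S. \<omega> u (f a))"
  by (induction S rule: infinite_finite_induct) (simp_all add: form_add_right)

lemma nondegenerate_left:
  assumes "\<And>w. \<omega> v w = 0" shows "v = 0"
proof -
  have "(\<Sum>a<2 * k. \<omega> v (dual_vector bas a) *s bas a) = 0"
    by (simp only: assms scale_zero_left sum.neutral_const)
  then show ?thesis by (rule trans[OF expand])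
qed

lemma bas_dual: "a < 2 * k \<Longrightarrow> \<omega> (bas a) (dual a) = 1"
proof (cases "even a")
  case True
  assume a: "a < 2 * k"
  from True obtain b where "a = 2 * b" by (elim evenE)
  with a have "Suc a < 2 * k" by simp
  then show ?thesis using True a by (simp add: dual_vector_def bas_form)
next
  case False
  assume a: "a < 2 * k"
  from False obtain b where "a = Suc (2 * b)" by (auto elim: oddE)
  then show ?thesis using a by (simp add: dual_vector_def bas_form form_minus_right)
qed

lemma expand_dual: "(\<Sum>a<2 * k. \<omega> v (bas a) *s dual a) = - v"
proof -
  have "\<omega> ((\<Sum>a<2 * k. \<omega> v (bas a) *s dual a) + v) w = 0" for w
  proof -
    have "\<omega> v w = \<omega> v (\<Sum>a<2 * k. \<omega> w (dual a) *s bas a)"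
      using expand[of w, symmetric] by simp
    also have "\<dots> = (\<Sum>a<2 * k. \<omega> w (dual a) * \<omega> v (bas a))"
      by (simp add: form_sum_right form_scale_right)
    also have "\<dots> = - \<omega> (\<Sum>a<2 * k. \<omega> v (bas a) *s dual a) w"
      unfolding form_sum_left form_scale_left form_flip[of "dual _" w]
      by (simp add: sum_negf mult.commute)
    finally show ?thesis by (simp add: form_add_left)
  qed
  then show ?thesis using nondegenerate_left by (metis eq_neg_iff_add_eq_0)
qed

text \<open>
  Invariance under the Lie algebra: the endomorphisms \<open>v \<mapsto> \<omega> v a *s a\<close> span the symplectic Lie
  algebra, and they act on multilinear functions as derivations. This form of invariance passes
  to contractions by a direct computation.
\<close>

definition sp_invariant_on :: "nat set \<Rightarrow> ((nat \<Rightarrow> 'v) \<Rightarrow> complex) \<Rightarrow> bool" where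
  "sp_invariant_on I T \<longleftrightarrow> (\<forall>u a. (\<Sum>l\<in>I. T (u(l := \<omega> (u l) a *s a))) = 0)"

lemma sp_invariant_polarized:
  assumes T: "multilinear_on I T" and inv: "sp_invariant_on I T"
  shows "(\<Sum>l\<in>I. T (u(l := \<omega> (u l) a *s b + \<omega> (u l) b *s a))) = 0"
proof -
  have "0 = (\<Sum>l\<in>I. T (u(l := \<omega> (u l) (a + b) *s (a + b))))"
    using inv by (simp add: sp_invariant_on_def)
  also have "\<dots> = (\<Sum>l\<in>I. T (u(l := \<omega> (u l) a *s a)) + T (u(l := \<omega> (u l) b *s b))
      + T (u(l := \<omega> (u l) a *s b + \<omega> (u l) b *s a)))"
  proof (intro sum.cong refl)
    fix l assume l: "l \<in> I"
    have "\<omega> (u l) (a + b) *s (a + b) = \<omega> (u l) a *s a + \<omega> (u l) b *s b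
      + (\<omega> (u l) a *s b + \<omega> (u l) b *s a)"
      by (simp add: form_add_right scale_left_distrib scale_right_distrib)
    then show "T (u(l := \<omega> (u l) (a + b) *s (a + b))) = T (u(l := \<omega> (u l) a *s a)) + T (u(l := \<omega> (u l) b *s b))
      + T (u(l := \<omega> (u l) a *s b + \<omega> (u l) b *s a))"
      by (simp only: multilinear_add[OF T l])
  qed
  also have "\<dots> = (\<Sum>l\<in>I. T (u(l := \<omega> (u l) a *s b + \<omega> (u l) b *s a)))"
    using inv by (simp only: sum.distrib sp_invariant_on_def) simp
  finally show ?thesis by simp
qed

definition contraction :: "nat \<Rightarrow> nat \<Rightarrow> ((nat \<Rightarrow> 'v) \<Rightarrow> complex) \<Rightarrow> (nat \<Rightarrow> 'v) \<Rightarrow> complex" where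
  "contraction l m T u = (\<Sum>a<2 * k. T (u(m := bas a, l := dual a)))"

lemma multilinear_on_fill:
  assumes T: "multilinear_on I T"
  shows "multilinear_on (I - {l, m}) (\<lambda>u. T (u(m := x, l := y)))"
  unfolding multilinear_on_def
proof (intro conjI allI ballI impI)
  fix u u' :: "nat \<Rightarrow> 'v" assume "\<forall>j\<in>I - {l, m}. u j = u' j"
  then show "T (u(m := x, l := y)) = T (u'(m := x, l := y))"
    by (intro multilinear_cong[OF T]) auto
next
  fix u :: "nat \<Rightarrow> 'v" and j v w assume j: "j \<in> I - {l, m}"
  have upd: "u(j := z, m := x, l := y) = u(m := x, l := y, j := z)" for z
    using j by (auto simp: fun_eq_iff)
  show "T (u(j := v + w, m := x, l := y)) = T (u(j := v, m := x, l := y)) + T (u(j := w, m := x, l := y))"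
    unfolding upd using j by (intro multilinear_add[OF T]) simp
next
  fix u :: "nat \<Rightarrow> 'v" and j c w assume j: "j \<in> I - {l, m}"
  have upd: "u(j := z, m := x, l := y) = u(m := x, l := y, j := z)" for z
    using j by (auto simp: fun_eq_iff)
  show "T (u(j := c *s w, m := x, l := y)) = c * T (u(j := w, m := x, l := y))"
    unfolding upd using j by (intro multilinear_scale[OF T]) simp
qed

lemma multilinear_on_contraction:
  "multilinear_on I T \<Longrightarrow> multilinear_on (I - {l, m}) (contraction l m T)"
  unfolding contraction_def by (intro multilinear_on_sum multilinear_on_fill)

text \<open>
  Split the invariance of \<open>T\<close> at arguments \<open>bas a, dual a\<close> into the terms that act on these two
  arguments and the rest. After summation over \<open>a\<close> the first two terms cancel, since the tensor
  \<open>\<Sum>a. bas a \<otimes> dual a\<close> is invariant.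
\<close>

lemma sp_invariant_on_contraction:
  assumes T: "multilinear_on I T" and inv: "sp_invariant_on I T" and fin: "finite I"
    and l: "l \<in> I" and m: "m \<in> I" and neq: "l \<noteq> m"
  shows "sp_invariant_on (I - {l, m}) (contraction l m T)"
  unfolding sp_invariant_on_def
proof (intro allI)
  fix u x
  let ?u = "\<lambda>a. u(m := bas a, l := dual a)"
  have sum0: "(\<Sum>j\<in>I. T (w(j := \<omega> (w j) x *s x))) = 0" for w
    by (rule inv[unfolded sp_invariant_on_def, rule_format])
  have "0 = (\<Sum>a<2 * k. \<Sum>j\<in>I. T ((?u a)(j := \<omega> (?u a j) x *s x)))"
    by (simp only: sum0 sum.neutral_const)
  also have "\<dots> = (\<Sum>a<2 * k. T (u(m := bas a, l := \<omega> (dual a) x *s x)) + T (u(l := dual a, m := \<omega> (bas a) x *s x))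
      + (\<Sum>j\<in>I - {l, m}. T ((?u a)(j := \<omega> (u j) x *s x))))"
  proof (intro sum.cong refl)
    fix a
    have "(\<Sum>j\<in>I. T ((?u a)(j := \<omega> (?u a j) x *s x)))
      = T ((?u a)(l := \<omega> (?u a l) x *s x)) + T ((?u a)(m := \<omega> (?u a m) x *s x))
        + (\<Sum>j\<in>I - {l, m}. T ((?u a)(j := \<omega> (?u a j) x *s x)))"
    proof -
      have "I - {l, m} = I - {l} - {m}" by auto
      moreover have "finite (I - {l})" "m \<in> I - {l}" using fin m neq by auto
      ultimately show ?thesis
        by (simp only: sum.remove[OF fin l] sum.remove[of "I - {l}" m] add.assoc)
    qed
    also have "(?u a)(l := \<omega> (?u a l) x *s x) = u(m := bas a, l := \<omega> (dual a) x *s x)" by auto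
    also have "(?u a)(m := \<omega> (?u a m) x *s x) = u(l := dual a, m := \<omega> (bas a) x *s x)" 
      using neq by (auto simp: fun_eq_iff)
    also have "(\<Sum>j\<in>I - {l, m}. T ((?u a)(j := \<omega> (?u a j) x *s x)))
       = (\<Sum>j\<in>I - {l, m}. T ((?u a)(j := \<omega> (u j) x *s x)))" by (intro sum.cong) auto
    finally show "(\<Sum>j\<in>I. T ((?u a)(j := \<omega> (?u a j) x *s x)))
      = T (u(m := bas a, l := \<omega> (dual a) x *s x)) + T (u(l := dual a, m := \<omega> (bas a) x *s x))
      + (\<Sum>j\<in>I - {l, m}. T ((?u a)(j := \<omega> (u j) x *s x)))" .
  qed
  also have "\<dots> = (\<Sum>a<2 * k. T (u(m := bas a, l := \<omega> (dual a) x *s x)))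
      + (\<Sum>a<2 * k. T (u(l := dual a, m := \<omega> (bas a) x *s x)))
      + (\<Sum>j\<in>I - {l, m}. contraction l m T (u(j := \<omega> (u j) x *s x)))"
  proof -
    have "(\<Sum>a<2 * k. \<Sum>j\<in>I - {l, m}. T ((?u a)(j := \<omega> (u j) x *s x)))
      = (\<Sum>j\<in>I - {l, m}. contraction l m T (u(j := \<omega> (u j) x *s x)))"
      unfolding contraction_def
      by (subst sum.swap, intro sum.cong refl arg_cong[of _ _ T]) (auto simp: fun_eq_iff)
    then show ?thesis by (simp add: sum.distrib)
  qed
  also have "(\<Sum>a<2 * k. T (u(m := bas a, l := \<omega> (dual a) x *s x))) = - T (u(l := x, m := x))"
  proof -
    have "T (u(m := bas a, l := \<omega> (dual a) x *s x)) = T (u(l := x, m := \<omega> (dual a) x *s bas a))" for a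
      unfolding multilinear_scale[OF T l] multilinear_scale[OF T m]
      by (simp only: fun_upd_twist[OF neq])
    then have "(\<Sum>a<2 * k. T (u(m := bas a, l := \<omega> (dual a) x *s x)))
       = T (u(l := x, m := (\<Sum>a<2 * k. \<omega> (dual a) x *s bas a)))"
      by (simp only: multilinear_sum[OF T m])
    also have "(\<Sum>a<2 * k. \<omega> (dual a) x *s bas a) = - (\<Sum>a<2 * k. \<omega> x (dual a) *s bas a)"
      unfolding form_flip[of "dual _" x] scale_minus_left sum_negf ..
    also have "\<dots> = - x" using expand[of x, symmetric] by simp
    finally show ?thesis by (simp only: multilinear_minus[OF T m])
  qed
  also have "(\<Sum>a<2 * k. T (u(l := dual a, m := \<omega> (bas a) x *s x))) = T (u(l := x, m := x))"
  proof -
    have "T (u(l := dual a, m := \<omega> (bas a) x *s x)) = T (u(m := x, l := \<omega> (bas a) x *s dual a))" for a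
      unfolding multilinear_scale[OF T l] multilinear_scale[OF T m]
      by (simp only: fun_upd_twist[OF neq])
    then have "(\<Sum>a<2 * k. T (u(l := dual a, m := \<omega> (bas a) x *s x)))
       = T (u(m := x, l := (\<Sum>a<2 * k. \<omega> (bas a) x *s dual a)))"
      by (simp only: multilinear_sum[OF T l])
    also have "(\<Sum>a<2 * k. \<omega> (bas a) x *s dual a) = - (\<Sum>a<2 * k. \<omega> x (bas a) *s dual a)"
      unfolding form_flip[of "bas _" x] scale_minus_left sum_negf ..
    also have "\<dots> = x" by (simp only: expand_dual minus_minus)
    finally show ?thesis by (simp only: fun_upd_twist[OF neq])
  qed
  finally show "(\<Sum>j\<in>I - {l, m}. contraction l m T (u(j := \<omega> (u j) x *s x))) = 0" by (simp only: add.left_neutral left_minus)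
qed

text \<open>
  Use the polarized invariance for the pair \<open>dual a, u m\<close> at the point where the argument \<open>m\<close> is
  replaced by \<open>bas a\<close>, and sum over \<open>a\<close>. In the argument \<open>l \<noteq> m\<close> the two summands of
  \<open>\<omega> (u l) (dual a) *s u m + \<omega> (u l) (u m) *s dual a\<close> yield the swap and the contraction. The
  argument \<open>m\<close> yields \<open>2 * k\<close> from \<open>\<omega> (bas a) (dual a) = 1\<close>, and one more copy of \<open>T\<close> from
  \<open>expand_dual\<close>.
\<close>

lemma casimir_identity:
  assumes T: "multilinear_on I T" and inv: "sp_invariant_on I T" and fin: "finite I"
    and m: "m \<in> I"
  shows "(2 * of_nat k + 1) * T u
    + (\<Sum>l\<in>I - {m}. T (u(l := u m, m := u l)) + \<omega> (u l) (u m) * contraction l m T u) = 0"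
proof -
  let ?u = "\<lambda>a. u(m := bas a)"
  let ?w = "\<lambda>a j. \<omega> (?u a j) (dual a) *s u m + \<omega> (?u a j) (u m) *s dual a"
  have "0 = (\<Sum>a<2 * k. \<Sum>l\<in>I. T ((?u a)(l := ?w a l)))"
    unfolding sp_invariant_polarized[OF T inv] by simp
  also have "\<dots> = (\<Sum>a<2 * k. T ((?u a)(m := ?w a m)) + (\<Sum>l\<in>I - {m}. T ((?u a)(l := ?w a l))))"
    by (simp only: sum.remove[OF fin m])
  also have "\<dots> = (\<Sum>a<2 * k. T ((?u a)(m := ?w a m))) + (\<Sum>l\<in>I - {m}. \<Sum>a<2 * k. T ((?u a)(l := ?w a l)))"
    unfolding sum.distrib by (intro arg_cong2[of _ _ _ _ "(+)"] refl sum.swap)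
  also have "(\<Sum>a<2 * k. T ((?u a)(m := ?w a m))) = (2 * of_nat k + 1) * T u"
  proof -
    have "(\<Sum>a<2 * k. T ((?u a)(m := ?w a m)))
        = (\<Sum>a<2 * k. T (u(m := u m)) + T (u(m := \<omega> (bas a) (u m) *s dual a)))"
    proof (intro sum.cong refl)
      fix a assume "a \<in> {..<2 * k}"
      then show "T ((?u a)(m := ?w a m)) = T (u(m := u m)) + T (u(m := \<omega> (bas a) (u m) *s dual a))"
        by (simp only: fun_upd_same fun_upd_upd bas_dual lessThan_iff scale_one multilinear_add[OF T m])
    qed
    also have "\<dots> = 2 * of_nat k * T u + T (u(m := (\<Sum>a<2 * k. \<omega> (bas a) (u m) *s dual a)))"
      unfolding sum.distrib multilinear_sum[OF T m] by simp
    also have "(\<Sum>a<2 * k. \<omega> (bas a) (u m) *s dual a) = - (\<Sum>a<2 * k. \<omega> (u m) (bas a) *s dual a)"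
      unfolding form_flip[of "bas _" "u m"] scale_minus_left sum_negf ..
    also have "\<dots> = u m" by (simp only: expand_dual minus_minus)
    finally show ?thesis by (simp only: fun_upd_triv distrib_right mult_1)
  qed
  also have "(\<Sum>l\<in>I - {m}. \<Sum>a<2 * k. T ((?u a)(l := ?w a l)))
    = (\<Sum>l\<in>I - {m}. T (u(l := u m, m := u l)) + \<omega> (u l) (u m) * contraction l m T u)"
  proof (intro sum.cong refl)
    fix l assume "l \<in> I - {m}"
    then have l: "l \<in> I" and neq: "m \<noteq> l" by auto
    have "T ((?u a)(l := ?w a l)) = T (u(l := u m, m := \<omega> (u l) (dual a) *s bas a))
        + \<omega> (u l) (u m) * T (u(m := bas a, l := dual a))" for a
      unfolding fun_upd_other[OF neq[symmetric]] multilinear_add[OF T l] multilinear_scale[OF T l]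
        multilinear_scale[OF T m]
      by (simp only: fun_upd_twist[OF neq])
    then have "(\<Sum>a<2 * k. T ((?u a)(l := ?w a l)))
      = T (u(l := u m, m := (\<Sum>a<2 * k. \<omega> (u l) (dual a) *s bas a))) + \<omega> (u l) (u m) * contraction l m T u"
      by (simp only: sum.distrib multilinear_sum[OF T m] contraction_def sum_distrib_left)
    then show "(\<Sum>a<2 * k. T ((?u a)(l := ?w a l)))
      = T (u(l := u m, m := u l)) + \<omega> (u l) (u m) * contraction l m T u"
      by (simp only: expand[of "u l", symmetric])
  qed
  finally show ?thesis by simp
qed

end

section \<open>Multilinear invariants\<close>

lemma sum_fun: "(\<Sum>j\<in>J. F j) = (\<lambda>u. \<Sum>j\<in>J. F j u :: complex)"
  by (induction J rule: infinite_finite_induct) (auto simp: fun_eq_iff)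

lemma span_fun_sum:
  "(\<And>j. j \<in> J \<Longrightarrow> F j \<in> fun_vs.span S) \<Longrightarrow> (\<lambda>u. \<Sum>j\<in>J. F j u) \<in> fun_vs.span S"
  using fun_vs.span_sum[of J F S] by (simp add: sum_fun)

lemma span_fun_add:
  "F \<in> fun_vs.span S \<Longrightarrow> G \<in> fun_vs.span S \<Longrightarrow> (\<lambda>u. F u + G u) \<in> fun_vs.span S"
  using fun_vs.span_add[of F S G] by (simp add: plus_fun_def)

lemma span_fun_scale:
  "F \<in> fun_vs.span S \<Longrightarrow> (\<lambda>u. c * F u) \<in> fun_vs.span S"
  using fun_vs.span_scale[of F S c] by (simp add: fscale_def)

lemma span_fun_zero: "(\<lambda>u. 0) \<in> fun_vs.span S"
  using fun_vs.span_zero[of S] by (simp add: zero_fun_def)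

text \<open>
  Substitution in the argument followed by multiplication with a fixed function is linear, so it
  suffices to know where it takes the generators.
\<close>

lemma span_fun_image:
  assumes F: "F \<in> fun_vs.span S"
    and step: "\<And>G. G \<in> S \<Longrightarrow> (\<lambda>x. w x * G (h x)) \<in> fun_vs.span S'"
  shows "(\<lambda>x. w x * F (h x)) \<in> fun_vs.span S'"
  using F
proof (induction rule: fun_vs.span_induct)
  case base
  show ?case
    unfolding fun_vs.subspace_def
    using span_fun_zero span_fun_add span_fun_scale
    by (auto simp: fscale_def distrib_left mult.left_commute)
next
  case (step G)
  then show ?case by (rule assms(2))
qed

text \<open>
  The image of a basis under an injective linear map is independent of the same size, hence again a
  basis.
\<close>

lemma injective_operator_onto_span:
  fixes Q :: "('a \<Rightarrow> complex) \<Rightarrow> 'a \<Rightarrow> complex"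
  assumes fin: "finite S"
    and add: "\<And>F G. Q (F + G) = Q F + Q G" and scale: "\<And>c F. Q (fscale c F) = fscale c (Q F)"
    and pres: "\<And>F. F \<in> fun_vs.span S \<Longrightarrow> Q F \<in> fun_vs.span S"
    and inj: "\<And>F. F \<in> fun_vs.span S \<Longrightarrow> Q F = 0 \<Longrightarrow> F = 0"
    and y: "y \<in> fun_vs.span S"
  shows "\<exists>x \<in> fun_vs.span S. Q x = y"
proof -
  interpret vp: vector_space_pair "fscale :: complex \<Rightarrow> ('a \<Rightarrow> complex) \<Rightarrow> 'a \<Rightarrow> complex"
    "fscale :: complex \<Rightarrow> ('a \<Rightarrow> complex) \<Rightarrow> 'a \<Rightarrow> complex" ..
  have lin: "Vector_Spaces.linear fscale fscale Q"
    using add scale fun_vs.vector_space_axioms by (simp add: Vector_Spaces.linear_iff)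
  obtain B where B: "B \<subseteq> S" "fun_vs.independent B" "S \<subseteq> fun_vs.span B"
    using fun_vs.maximal_independent_subset[of S] by auto
  have sB: "fun_vs.span B = fun_vs.span S"
    using B fun_vs.span_mono fun_vs.span_minimal[OF B(3)] fun_vs.subspace_span by blast
  have finB: "finite B" using B(1) fin finite_subset by auto
  have injB: "inj_on Q (fun_vs.span B)"
    using vp.linear_inj_on_iff_eq_0[OF lin fun_vs.subspace_span, of B] inj sB by auto
  have ind: "fun_vs.independent (Q ` B)"
    by (rule vp.linear_independent_injective_image[OF lin B(2) injB])
  have card: "card (Q ` B) = card B"
    by (rule card_image) (rule inj_on_subset[OF injB fun_vs.span_superset])
  have sub: "Q ` B \<subseteq> fun_vs.span B"
    using pres fun_vs.span_base sB by auto
  have "y \<in> fun_vs.span (Q ` B)"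
  proof (rule ccontr)
    assume n: "y \<notin> fun_vs.span (Q ` B)"
    then have "y \<notin> Q ` B" using fun_vs.span_base by blast
    moreover have "fun_vs.independent (insert y (Q ` B))"
      using n ind by (simp add: fun_vs.independent_insert)
    then have "card (insert y (Q ` B)) \<le> card B"
      using fun_vs.independent_span_bound[OF finB, of "insert y (Q ` B)"] sub y sB by auto
    ultimately show False using card finB by simp
  qed
  also have "fun_vs.span (Q ` B) = Q ` fun_vs.span B"
    by (rule vp.linear_span_image[OF lin])
  finally show ?thesis using sB by auto
qed

context symplectic_space
begin

text \<open>
  Products of forms over the perfect matchings of \<open>I\<close>, with an arbitrary orientation of each pair.
  Both orientations are needed to make the set closed under permutations of the arguments.
\<close>

inductive matching_function :: "nat set \<Rightarrow> ((nat \<Rightarrow> 'v) \<Rightarrow> complex) \<Rightarrow> bool" where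
  empty: "matching_function {} (\<lambda>_. 1)"
| pair: "\<lbrakk>matching_function (I - {l, m}) g; l \<in> I; m \<in> I; l \<noteq> m\<rbrakk>
    \<Longrightarrow> matching_function I (\<lambda>u. \<omega> (u l) (u m) * g u)"

lemma multilinear_on_pair:
  assumes g: "multilinear_on (I - {l, m}) g" and lm: "l \<in> I" "m \<in> I" and neq: "l \<noteq> m"
  shows "multilinear_on I (\<lambda>u. \<omega> (u l) (u m) * g u)"
  unfolding multilinear_on_def
proof (intro conjI allI ballI impI)
  fix u u' :: "nat \<Rightarrow> 'v" assume eq: "\<forall>j\<in>I. u j = u' j"
  then have "g u = g u'" by (intro multilinear_cong[OF g]) simp
  then show "\<omega> (u l) (u m) * g u = \<omega> (u' l) (u' m) * g u'" using eq lm by simp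
next
  fix u :: "nat \<Rightarrow> 'v" and j x y assume j: "j \<in> I"
  have "g (u(j := z)) = g u" if "j = l \<or> j = m" for z
    using that by (intro multilinear_cong[OF g]) auto
  then show "\<omega> ((u(j := x + y)) l) ((u(j := x + y)) m) * g (u(j := x + y))
      = \<omega> ((u(j := x)) l) ((u(j := x)) m) * g (u(j := x)) + \<omega> ((u(j := y)) l) ((u(j := y)) m) * g (u(j := y))"
    using j neq multilinear_add[OF g, of j u x y]
    by (cases "j = l"; cases "j = m") (simp_all add: form_add_left form_add_right distrib_left distrib_right)
next
  fix u :: "nat \<Rightarrow> 'v" and j c x assume j: "j \<in> I"
  have "g (u(j := z)) = g u" if "j = l \<or> j = m" for z
    using that by (intro multilinear_cong[OF g]) auto
  then show "\<omega> ((u(j := c *s x)) l) ((u(j := c *s x)) m) * g (u(j := c *s x))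
      = c * (\<omega> ((u(j := x)) l) ((u(j := x)) m) * g (u(j := x)))"
    using j neq multilinear_scale[OF g, of j u c x]
    by (cases "j = l"; cases "j = m") (simp_all add: form_scale_left form_scale_right)
qed

lemma multilinear_on_matching_function: "matching_function I g \<Longrightarrow> multilinear_on I g"
proof (induction rule: matching_function.induct)
  case empty
  then show ?case by (simp add: multilinear_on_def)
next
  case (pair I l m g)
  then show ?case by (intro multilinear_on_pair)
qed

lemma multilinear_on_span_matching_functions:
  "F \<in> fun_vs.span {g. matching_function I g} \<Longrightarrow> multilinear_on I F"
  using fun_vs.span_minimal[OF _ subspace_multilinear_on[of I], of "{g. matching_function I g}"]
    multilinear_on_matching_function by blast

lemma finite_matching_functions: "finite I \<Longrightarrow> finite {g. matching_function I g}"
proof (induction "card I" arbitrary: I rule: less_induct)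
  case less
  have sub: "{g. matching_function I g} \<subseteq> insert (\<lambda>_. 1)
    (\<Union>(l, m) \<in> {(l, m). l \<in> I \<and> m \<in> I \<and> l \<noteq> m}. (\<lambda>g u. \<omega> (u l) (u m) * g u) ` {g. matching_function (I - {l, m}) g})"
  proof
    fix h assume "h \<in> {g. matching_function I g}"
    then have "matching_function I h" by simp
    then show "h \<in> insert (\<lambda>_. 1) (\<Union>(l, m) \<in> {(l, m). l \<in> I \<and> m \<in> I \<and> l \<noteq> m}.
        (\<lambda>g u. \<omega> (u l) (u m) * g u) ` {g. matching_function (I - {l, m}) g})"
    proof cases
      case (pair l m g)
      then show ?thesis by blast
    qed simp
  qed
  have "finite {g. matching_function (I - {l, m}) g}" if "l \<in> I" for l m
    using less that by (intro less.hyps psubset_card_mono) auto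
  moreover have "finite {(l, m). l \<in> I \<and> m \<in> I \<and> l \<noteq> m}"
    by (rule finite_subset[of _ "I \<times> I"]) (use less in auto)
  ultimately have "finite (insert (\<lambda>_. 1)
    (\<Union>(l, m) \<in> {(l, m). l \<in> I \<and> m \<in> I \<and> l \<noteq> m}. (\<lambda>g u. \<omega> (u l) (u m) * g u) ` {g. matching_function (I - {l, m}) g}))"
    by (auto simp only: finite_insert intro!: finite_UN_I)
  with sub show ?case by (rule finite_subset)
qed

lemma matching_function_permute:
  assumes "matching_function I g" and t: "inj t"
  shows "matching_function (t ` I) (\<lambda>u. g (\<lambda>i. u (t i)))"
  using assms(1)
proof (induction rule: matching_function.induct)
  case empty
  then show ?case by (simp add: matching_function.empty)
next
  case (pair I l m g)
  have "t ` (I - {l, m}) = t ` I - {t l, t m}" using t by (auto simp: inj_def)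
  with pair have "matching_function (t ` I - {t l, t m}) (\<lambda>u. g (\<lambda>i. u (t i)))" by simp
  from matching_function.pair[OF this, of] pair t show ?case by (auto simp: inj_eq)
qed

lemma span_matching_functions_swap:
  assumes F: "F \<in> fun_vs.span {g. matching_function I g}" and lm: "l \<in> I" "m \<in> I"
  shows "(\<lambda>u. F (u(l := u m, m := u l))) \<in> fun_vs.span {g. matching_function I g}"
proof -
  have t: "transpose l m ` I = I" using lm by simp
  have u: "u(l := u m, m := u l) = (\<lambda>i. u (transpose l m i))" for u :: "nat \<Rightarrow> 'v"
    by (auto simp: fun_eq_iff transpose_def)
  have "(\<lambda>u. 1 * F (u(l := u m, m := u l))) \<in> fun_vs.span {g. matching_function I g}"
    using F
  proof (rule span_fun_image)
    fix G assume "G \<in> {g. matching_function I g}"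
    then have "matching_function I (\<lambda>u. G (\<lambda>i. u (transpose l m i)))"
      using matching_function_permute[of I G "transpose l m"] t by simp
    then show "(\<lambda>u. 1 * G (u(l := u m, m := u l))) \<in> fun_vs.span {g. matching_function I g}"
      unfolding u by (auto intro: fun_vs.span_base)
  qed
  then show ?thesis by simp
qed

lemma span_matching_functions_pair:
  assumes F: "F \<in> fun_vs.span {g. matching_function (I - {l, m}) g}" and lm: "l \<in> I" "m \<in> I" "l \<noteq> m"
  shows "(\<lambda>u. \<omega> (u l) (u m) * F u) \<in> fun_vs.span {g. matching_function I g}"
proof (rule span_fun_image[OF F])
  fix G assume "G \<in> {g. matching_function (I - {l, m}) g}"
  then show "(\<lambda>u. \<omega> (u l) (u m) * G u) \<in> fun_vs.span {g. matching_function I g}"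
    using matching_function.pair[OF _ lm, of G] by (intro fun_vs.span_base) simp
qed

text \<open>
  The part of the Casimir element of the symplectic Lie algebra that does not involve
  contractions; \<open>casimir_identity\<close>, summed over \<open>m\<close>, expresses it by contractions.
\<close>

definition casimir_operator :: "nat set \<Rightarrow> ((nat \<Rightarrow> 'v) \<Rightarrow> complex) \<Rightarrow> (nat \<Rightarrow> 'v) \<Rightarrow> complex" where
  "casimir_operator I T u = of_nat (card I) * (2 * of_nat k + 1) * T u
     + (\<Sum>m\<in>I. \<Sum>l\<in>I - {m}. T (u(l := u m, m := u l)))"

text \<open>
  The constant of the operator exceeds the \<open>2 * k * card I\<close> of \<open>swap_operator_positive\<close> by
  \<open>card I\<close>, so \<open>T\<close> vanishes on all tuples of basis vectors. This excess is positive only for a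
  nonempty \<open>I\<close>.
\<close>

lemma casimir_operator_injective:
  assumes fin: "finite I" "I \<noteq> {}" and T: "multilinear_on I T" and zero: "casimir_operator I T = 0"
  shows "T = 0"
proof
  fix u
  have bas0: "T (\<lambda>l. bas (s l)) = 0" if s: "s \<in> I \<rightarrow>\<^sub>E {..<2 * k}" for s
  proof (rule swap_operator_positive[where A = "\<lambda>s. T (\<lambda>l. bas (s l))", OF fin(1) _ _ s])
    show "0 < real (card I)" using fin by (simp add: card_gt_0_iff)
    fix s :: "nat \<Rightarrow> nat"
    have upd: "(\<lambda>j. bas ((s(l := s m, m := s l)) j)) = (\<lambda>l. bas (s l))(l := bas (s m), m := bas (s l))" for l m
      by (auto simp: fun_eq_iff)
    have "casimir_operator I T (\<lambda>l. bas (s l)) = 0" using zero by simp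
    then show "(complex_of_real (real (card I)) + of_nat (2 * k * card I)) * T (\<lambda>l. bas (s l))
      + (\<Sum>m\<in>I. \<Sum>l\<in>I - {m}. T (\<lambda>j. bas ((s(l := s m, m := s l)) j))) = 0"
      unfolding upd casimir_operator_def by (simp add: algebra_simps)
  qed
  have "T u = T (\<lambda>l. \<Sum>a<2 * k. \<omega> (u l) (dual a) *s bas a)"
    by (simp only: expand[symmetric])
  also have "\<dots> = (\<Sum>t\<in>I \<rightarrow>\<^sub>E {..<2 * k}. T (\<lambda>l. \<omega> (u l) (dual (t l)) *s bas (t l)))"
    by (rule multilinear_expand[OF T fin(1)]) simp
  also have "\<dots> = 0"
    by (rule sum.neutral) (simp add: multilinear_scale_all[OF T fin(1)] bas0)
  finally show "T u = 0 u" by simp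
qed

text \<open>
  The first fundamental theorem for the symplectic group in multilinear form, by induction on the
  number of arguments: the Casimir operator takes \<open>T\<close> into the span of the matching functions,
  and there it is invertible.
\<close>

theorem multilinear_invariants:
  assumes "finite I" and "multilinear_on I T" and "sp_invariant_on I T"
  shows "T \<in> fun_vs.span {g. matching_function I g}"
  using assms
proof (induction "card I" arbitrary: I T rule: less_induct)
  case less
  note fin = less.prems(1) and T = less.prems(2) and inv = less.prems(3)
  show ?case
  proof (cases "I = {}")
    case True
    have "T = fscale (T (\<lambda>_. 0)) (\<lambda>_. 1)"
    proof
      fix u show "T u = fscale (T (\<lambda>_. 0)) (\<lambda>_. 1) u"
        using multilinear_cong[OF T, of u "\<lambda>_. 0"] True by (simp add: fscale_def)
    qed
    then show ?thesis
      using True matching_function.empty by (metis fun_vs.span_base fun_vs.span_scale mem_Collect_eq)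
  next
    case False
    let ?S = "{g. matching_function I g}"
    have contr: "(\<lambda>u. \<omega> (u l) (u m) * contraction l m T u) \<in> fun_vs.span ?S"
      if "l \<in> I" "m \<in> I" "l \<noteq> m" for l m
    proof (rule span_matching_functions_pair[OF less.hyps that])
      show "card (I - {l, m}) < card I" using fin that by (intro psubset_card_mono) auto
    qed (use fin T inv that in \<open>auto intro: multilinear_on_contraction sp_invariant_on_contraction\<close>)
    have "casimir_operator I T = (\<lambda>u. \<Sum>m\<in>I. \<Sum>l\<in>I - {m}. (-1) * (\<omega> (u l) (u m) * contraction l m T u))"
    proof
      fix u
      have "0 = (\<Sum>m\<in>I. (2 * of_nat k + 1) * T u
        + (\<Sum>l\<in>I - {m}. T (u(l := u m, m := u l)) + \<omega> (u l) (u m) * contraction l m T u))"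
        using casimir_identity[OF T inv fin] by simp
      then show "casimir_operator I T u = (\<Sum>m\<in>I. \<Sum>l\<in>I - {m}. (-1) * (\<omega> (u l) (u m) * contraction l m T u))"
        unfolding casimir_operator_def by (simp add: sum.distrib sum_negf eq_neg_iff_add_eq_0 algebra_simps)
    qed
    also have "\<dots> \<in> fun_vs.span ?S"
      using contr by (intro span_fun_sum span_fun_scale) auto
    finally have Q: "casimir_operator I T \<in> fun_vs.span ?S" .
    have "\<exists>T' \<in> fun_vs.span ?S. casimir_operator I T' = casimir_operator I T"
    proof (rule injective_operator_onto_span[OF finite_matching_functions[OF fin] _ _ _ _ Q])
      show "casimir_operator I (F + G) = casimir_operator I F + casimir_operator I G" for F G
        by (auto simp: fun_eq_iff casimir_operator_def sum.distrib algebra_simps)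
      show "casimir_operator I (fscale c F) = fscale c (casimir_operator I F)" for c F
        by (auto simp: fun_eq_iff casimir_operator_def fscale_def sum_distrib_left algebra_simps)
      show "casimir_operator I F \<in> fun_vs.span ?S" if "F \<in> fun_vs.span ?S" for F
        unfolding casimir_operator_def[abs_def]
        by (intro span_fun_add span_fun_sum span_fun_scale that span_matching_functions_swap) auto
      show "F = 0" if "F \<in> fun_vs.span ?S" "casimir_operator I F = 0" for F
        using casimir_operator_injective[OF fin False] multilinear_on_span_matching_functions that by blast
    qed
    then obtain T' where T': "T' \<in> fun_vs.span ?S" "casimir_operator I T' = casimir_operator I T" by auto
    have "multilinear_on I (T - T')"
      using fun_vs.subspace_diff[OF subspace_multilinear_on[of I], of T T'] T
        multilinear_on_span_matching_functions[OF T'(1)] by simp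
    moreover have "casimir_operator I (T - T') = 0"
    proof
      fix u
      have "casimir_operator I (T - T') u = casimir_operator I T u - casimir_operator I T' u"
        by (simp add: casimir_operator_def sum_subtractf algebra_simps)
      then show "casimir_operator I (T - T') u = 0 u" using T'(2) by simp
    qed
    ultimately have "T - T' = 0" using casimir_operator_injective[OF fin False] by blast
    then show ?thesis using T'(1) by simp
  qed
qed

end

section \<open>Polarization of polynomials\<close>

lemma homogeneous_polys_induct [consumes 1, case_names subspace product]:
  assumes f: "f \<in> homogeneous_polys smul n d"
    and sub: "fun_vs.subspace {f. P f}"
    and prod: "\<And>\<phi> \<kappa>. (\<And>l. l < d \<Longrightarrow> Vector_Spaces.linear smul (*) (\<phi> l)) \<Longrightarrow> (\<And>l. l < d \<Longrightarrow> \<kappa> l \<in> {1..n})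
      \<Longrightarrow> P (\<lambda>v. \<Prod>l<d. \<phi> l (v (\<kappa> l)))"
  shows "P f"
  using f[unfolded homogeneous_polys_def]
proof (induction rule: fun_vs.span_induct)
  case base
  then show ?case using sub by simp
next
  case (step f)
  then show ?case by (auto simp: form_products_def intro: prod)
qed

text \<open>
  The multilinear component of \<open>f (\<lambda>i. \<Sum>l | \<iota> l = i. u l)\<close> in the vectors \<open>u l\<close>, for \<open>f\<close>
  homogeneous of degree \<open>d\<close>. It is written as a finite difference rather than as a coefficient, so
  that it makes sense for every function \<open>f\<close> and visibly commutes with linear substitutions.
\<close>

definition polarization ::
    "nat \<Rightarrow> ((nat \<Rightarrow> 'v::ab_group_add) \<Rightarrow> complex) \<Rightarrow> (nat \<Rightarrow> nat) \<Rightarrow> (nat \<Rightarrow> 'v) \<Rightarrow> complex" where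
  "polarization d f \<iota> u = (\<Sum>S\<in>Pow {..<d}. (-1) ^ (d - card S) * f (\<lambda>i. \<Sum>l | l \<in> S \<and> \<iota> l = i. u l))"

lemma polarization_add: "polarization d (f + g) \<iota> u = polarization d f \<iota> u + polarization d g \<iota> u"
  by (simp add: polarization_def sum.distrib distrib_left)

lemma polarization_fscale: "polarization d (fscale c f) \<iota> u = c * polarization d f \<iota> u"
  by (simp add: polarization_def fscale_def sum_distrib_left mult.left_commute)

lemma polarization_zero: "polarization d 0 \<iota> u = 0"
  by (simp add: polarization_def)

context complex_space
begin

lemma multilinear_on_product:
  assumes "\<And>l. l < d \<Longrightarrow> Vector_Spaces.linear smul (*) (\<phi> l)"
  shows "multilinear_on {..<d} (\<lambda>w. \<Prod>l<d. \<phi> l (w l))"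
proof -
  have \<phi>: "\<phi> l (x + y) = \<phi> l x + \<phi> l y" "\<phi> l (c *s x) = c * \<phi> l x" if "l < d" for l x y c
    using assms[OF that] by (simp_all add: Vector_Spaces.linear_iff)
  have upd: "(\<Prod>l<d. \<phi> l ((w(m := x)) l)) = \<phi> m x * (\<Prod>l\<in>{..<d} - {m}. \<phi> l (w l))" if "m < d" for w m x
    using that by (subst prod.remove[of _ m]) auto
  show ?thesis
    unfolding multilinear_on_def
    by (auto simp only: upd \<phi> lessThan_iff distrib_right mult.assoc intro!: prod.cong)
qed

text \<open>
  Polarizing \<open>\<Phi>\<close> with repeated arguments distributes the vectors \<open>u m\<close> in all possible ways over the
  arguments; a vector \<open>u m\<close> may only go to an argument \<open>l\<close> that reads the entry \<open>\<iota> m\<close>.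
\<close>

lemma polarization_multilinear:
  assumes \<Phi>: "multilinear_on {..<d} \<Phi>"
  shows "polarization d (\<lambda>v. \<Phi> (\<lambda>l. v (\<kappa> l))) \<iota> u
    = (\<Sum>t | t \<in> {..<d} \<rightarrow>\<^sub>E {..<d} \<and> t ` {..<d} = {..<d}. \<Phi> (\<lambda>l. if \<iota> (t l) = \<kappa> l then u (t l) else 0))"
proof -
  have "polarization d (\<lambda>v. \<Phi> (\<lambda>l. v (\<kappa> l))) \<iota> u
    = (\<Sum>S\<in>Pow {..<d}. (-1) ^ (d - card S) * \<Phi> (\<lambda>l. \<Sum>m\<in>S. if \<iota> m = \<kappa> l then u m else 0))"
    unfolding polarization_def
  proof (rule sum.cong[OF refl], rule arg_cong2[of _ _ _ _ "(*)"], rule refl, rule arg_cong[of _ _ \<Phi>], rule ext)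
    fix S l assume "S \<in> Pow {..<d}"
    then have "finite S" by (auto intro: finite_subset)
    then show "(\<Sum>m | m \<in> S \<and> \<iota> m = \<kappa> l. u m) = (\<Sum>m\<in>S. if \<iota> m = \<kappa> l then u m else 0)"
      by (rule sum.inter_filter)
  qed
  also have "\<dots> = (\<Sum>t | t \<in> {..<d} \<rightarrow>\<^sub>E {..<d} \<and> t ` {..<d} = {..<d}. \<Phi> (\<lambda>l. if \<iota> (t l) = \<kappa> l then u (t l) else 0))"
    by (rule polarization_formula[OF \<Phi>])
  finally show ?thesis .
qed

text \<open>
  For a product of functionals, each map \<open>t\<close> in \<open>polarization_multilinear\<close> contributes either the
  product with permuted arguments or, if some argument receives no vector, zero.
\<close>

lemma multilinear_on_polarization:
  assumes "f \<in> homogeneous_polys smul n d"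
  shows "multilinear_on {..<d} (polarization d f \<iota>)"
  using assms
proof (induction rule: homogeneous_polys_induct)
  case subspace
  have "polarization d (f + g) \<iota> = polarization d f \<iota> + polarization d g \<iota>"
    "polarization d (fscale c f) \<iota> = fscale c (polarization d f \<iota>)"
    "polarization d (0 :: (nat \<Rightarrow> 'v) \<Rightarrow> complex) \<iota> = 0" for f g :: "(nat \<Rightarrow> 'v) \<Rightarrow> complex" and c
    by (auto simp: fun_eq_iff polarization_add polarization_fscale[unfolded fscale_def] polarization_zero fscale_def)
  then show ?case
    using subspace_multilinear_on[of "{..<d}"] by (auto simp: fun_vs.subspace_def)
next
  case (product \<phi> \<kappa>)
  let ?\<Phi> = "\<lambda>w. \<Prod>l<d. \<phi> l (w l)"
  have \<Phi>: "multilinear_on {..<d} ?\<Phi>" using product by (intro multilinear_on_product)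
  have "multilinear_on {..<d} (\<lambda>u. ?\<Phi> (\<lambda>l. if \<iota> (t l) = \<kappa> l then u (t l) else 0))"
    if t: "t \<in> {..<d} \<rightarrow>\<^sub>E {..<d}" "t ` {..<d} = {..<d}" for t
  proof (cases "\<forall>l<d. \<iota> (t l) = \<kappa> l")
    case True
    have "bij_betw t {..<d} {..<d}"
      using t by (simp add: bij_betw_def eq_card_imp_inj_on)
    from multilinear_on_reindex[OF \<Phi> this] show ?thesis using True by simp
  next
    case False
    then obtain m where "m < d" "\<iota> (t m) \<noteq> \<kappa> m" by auto
    then have "?\<Phi> (\<lambda>l. if \<iota> (t l) = \<kappa> l then u (t l) else 0) = 0" for u
      by (intro multilinear_zero'[OF \<Phi>, of m]) auto
    then show ?thesis by (simp only: multilinear_on_0)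
  qed
  then have "multilinear_on {..<d} (\<lambda>u. \<Sum>t | t \<in> {..<d} \<rightarrow>\<^sub>E {..<d} \<and> t ` {..<d} = {..<d}.
      ?\<Phi> (\<lambda>l. if \<iota> (t l) = \<kappa> l then u (t l) else 0))"
    by (intro multilinear_on_sum) auto
  moreover have "polarization d (\<lambda>v. \<Prod>l<d. \<phi> l (v (\<kappa> l))) \<iota>
    = (\<lambda>u. \<Sum>t | t \<in> {..<d} \<rightarrow>\<^sub>E {..<d} \<and> t ` {..<d} = {..<d}.
        ?\<Phi> (\<lambda>l. if \<iota> (t l) = \<kappa> l then u (t l) else 0))"
    by (rule ext) (rule polarization_multilinear[OF \<Phi>])
  ultimately show ?case by (simp only:)
qed

text \<open>
  Setting the arguments of the polarizations equal again gives back \<open>f\<close>: for a product of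
  functionals, each bijection \<open>t\<close> determines exactly one \<open>\<iota>\<close> whose term is nonzero. The factor
  counts the bijections.
\<close>

lemma restitution:
  assumes "f \<in> homogeneous_polys smul n d"
  shows "(\<Sum>\<iota> \<in> {..<d} \<rightarrow>\<^sub>E {1..n}. polarization d f \<iota> (\<lambda>l. v (\<iota> l)))
    = of_nat (card {t. t \<in> {..<d} \<rightarrow>\<^sub>E {..<d} \<and> t ` {..<d} = {..<d}}) * f v"
  using assms
proof (induction arbitrary: v rule: homogeneous_polys_induct)
  case subspace
  show ?case
    unfolding fun_vs.subspace_def
    by (auto simp: polarization_add polarization_fscale[unfolded fscale_def] polarization_zero fscale_def sum.distrib distrib_left
        mult.left_commute simp flip: sum_distrib_left)
next
  case (product \<phi> \<kappa>)
  let ?\<Phi> = "\<lambda>w. \<Prod>l<d. \<phi> l (w l)" and ?B = "{t. t \<in> {..<d} \<rightarrow>\<^sub>E {..<d} \<and> t ` {..<d} = {..<d}}"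
  have \<Phi>: "multilinear_on {..<d} ?\<Phi>" using product by (intro multilinear_on_product)
  have "(\<Sum>\<iota> \<in> {..<d} \<rightarrow>\<^sub>E {1..n}. polarization d (\<lambda>v. ?\<Phi> (\<lambda>l. v (\<kappa> l))) \<iota> (\<lambda>l. v (\<iota> l)))
    = (\<Sum>\<iota> \<in> {..<d} \<rightarrow>\<^sub>E {1..n}. \<Sum>t\<in>?B. ?\<Phi> (\<lambda>l. if \<iota> (t l) = \<kappa> l then v (\<iota> (t l)) else 0))"
    by (intro sum.cong refl polarization_multilinear[OF \<Phi>])
  also have "\<dots> = (\<Sum>t\<in>?B. \<Sum>\<iota> \<in> {..<d} \<rightarrow>\<^sub>E {1..n}. ?\<Phi> (\<lambda>l. if \<iota> (t l) = \<kappa> l then v (\<iota> (t l)) else 0))"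
    by (rule sum.swap)
  also have "\<dots> = (\<Sum>t\<in>?B. ?\<Phi> (\<lambda>l. v (\<kappa> l)))"
  proof (rule sum.cong[OF refl])
    fix t assume "t \<in> ?B"
    then have tim: "t ` {..<d} = {..<d}" by simp
    then have inj: "inj_on t {..<d}" by (simp add: eq_card_imp_inj_on)
    \<comment> \<open>the only distribution compatible with \<open>t\<close>\<close>
    define \<iota>0 where "\<iota>0 = restrict (\<lambda>m. \<kappa> (inv_into {..<d} t m)) {..<d}"
    have inv: "inv_into {..<d} t m < d" "t (inv_into {..<d} t m) = m" if "m < d" for m
      using that tim inv_into_into[of m t "{..<d}"] f_inv_into_f[of m t "{..<d}"] by auto
    have \<iota>0: "\<iota>0 \<in> {..<d} \<rightarrow>\<^sub>E {1..n}" using product(2) inv by (auto simp: \<iota>0_def)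
    have \<iota>0_t: "\<iota>0 (t l) = \<kappa> l" if "l < d" for l
      using that tim inj by (auto simp: \<iota>0_def)
    have "?\<Phi> (\<lambda>l. if \<iota> (t l) = \<kappa> l then v (\<iota> (t l)) else 0) = (if \<iota> = \<iota>0 then ?\<Phi> (\<lambda>l. v (\<kappa> l)) else 0)"
      if \<iota>: "\<iota> \<in> {..<d} \<rightarrow>\<^sub>E {1..n}" for \<iota>
    proof (cases "\<iota> = \<iota>0")
      case True
      then show ?thesis using \<iota>0_t by simp
    next
      case False
      then obtain m where m: "m < d" "\<iota> m \<noteq> \<iota>0 m" using PiE_ext[OF \<iota> \<iota>0] by auto
      then have "\<iota> (t (inv_into {..<d} t m)) \<noteq> \<kappa> (inv_into {..<d} t m)" using inv by (simp add: \<iota>0_def)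
      with inv m have "?\<Phi> (\<lambda>l. if \<iota> (t l) = \<kappa> l then v (\<iota> (t l)) else 0) = 0"
        by (intro multilinear_zero'[OF \<Phi>, of "inv_into {..<d} t m"]) auto
      then show ?thesis using False by simp
    qed
    then have "(\<Sum>\<iota> \<in> {..<d} \<rightarrow>\<^sub>E {1..n}. ?\<Phi> (\<lambda>l. if \<iota> (t l) = \<kappa> l then v (\<iota> (t l)) else 0))
      = (\<Sum>\<iota> \<in> {..<d} \<rightarrow>\<^sub>E {1..n}. if \<iota> = \<iota>0 then ?\<Phi> (\<lambda>l. v (\<kappa> l)) else 0)"
      by (intro sum.cong refl)
    also have "\<dots> = ?\<Phi> (\<lambda>l. v (\<kappa> l))"
      using \<iota>0 finite_PiE[of "{..<d}" "\<lambda>_. {1..n}"] by (simp add: sum.delta')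
    finally show "(\<Sum>\<iota> \<in> {..<d} \<rightarrow>\<^sub>E {1..n}. ?\<Phi> (\<lambda>l. if \<iota> (t l) = \<kappa> l then v (\<iota> (t l)) else 0))
      = ?\<Phi> (\<lambda>l. v (\<kappa> l))" .
  qed
  finally show ?case by simp
qed

lemma card_surjections_pos: "card {t. t \<in> {..<d} \<rightarrow>\<^sub>E {..<d::nat} \<and> t ` {..<d} = {..<d}} > 0"
proof -
  have "finite {t. t \<in> {..<d} \<rightarrow>\<^sub>E {..<d} \<and> t ` {..<d} = {..<d}}"
    by (rule finite_subset[of _ "{..<d} \<rightarrow>\<^sub>E {..<d}"]) (auto intro: finite_PiE)
  moreover have "restrict id {..<d} \<in> {t. t \<in> {..<d} \<rightarrow>\<^sub>E {..<d} \<and> t ` {..<d} = {..<d}}" by auto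
  ultimately show ?thesis by (metis card_gt_0_iff empty_iff)
qed

lemma polarization_invariant:
  assumes inv: "\<And>v. f (\<lambda>i. g (v i)) = f v" and g: "Vector_Spaces.linear smul smul g"
  shows "polarization d f \<iota> (\<lambda>l. g (u l)) = polarization d f \<iota> u"
proof -
  have "g (\<Sum>l\<in>S. h l) = (\<Sum>l\<in>S. g (h l))" for S and h :: "nat \<Rightarrow> 'v"
    using g module_hom.sum[of smul smul g h S] by (simp add: linear_iff_module_hom)
  then show ?thesis unfolding polarization_def by (simp flip: inv[of "\<lambda>i. \<Sum>l | l \<in> _ \<and> \<iota> l = i. u l"])
qed

end

context symplectic_space
begin

text \<open>
  The symplectic transvections; as polynomials in \<open>s\<close> they have the Lie algebra elements of
  \<open>sp_invariant_on\<close> as linear coefficients.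
\<close>

lemma transvection_in_Sp: "(\<lambda>v. v + (s * \<omega> v a) *s a) \<in> Sp smul \<omega>"
proof -
  let ?g = "\<lambda>s v. v + (s * \<omega> v a) *s a"
  have inv: "?g (- s) (?g s v) = v" for s v
    by (simp add: form_add_left form_scale_left)
  have "bij (?g s)"
    by (rule bijI'[of "?g s"]) (metis inv, metis inv minus_minus)
  moreover have "Vector_Spaces.linear smul smul (?g s)"
    using vector_space_axioms
    by (simp add: Vector_Spaces.linear_iff form_add_left form_scale_left distrib_left
        scale_left_distrib scale_right_distrib mult.left_commute)
  moreover have "\<omega> (?g s u) (?g s v) = \<omega> u v" for u v
    by (simp add: form_add_left form_add_right form_scale_left form_scale_right form_flip[of a v])
  ultimately show ?thesis by (simp add: Sp_def)
qed

text \<open>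
  Invariance under the transvection with parameter \<open>s\<close> is an identity between polynomials in \<open>s\<close>,
  and \<open>sp_invariant_on\<close> is the vanishing of the coefficient of \<open>s\<close>.
\<close>

lemma sp_invariant_on_if_Sp_invariant:
  assumes fin: "finite I" and T: "multilinear_on I T"
    and inv: "\<And>g u. g \<in> Sp smul \<omega> \<Longrightarrow> T (\<lambda>l. g (u l)) = T u"
  shows "sp_invariant_on I T"
  unfolding sp_invariant_on_def
proof (intro allI)
  fix u :: "nat \<Rightarrow> 'v" and a
  let ?E = "I \<rightarrow>\<^sub>E (UNIV :: bool set)"
  let ?w = "\<lambda>l. \<omega> (u l) a *s a"
  \<comment> \<open>the map \<open>t\<close> records in which arguments the transvection is expanded by its second summand\<close>
  define C where "C t = T (\<lambda>l. if t l then ?w l else u l)" for t :: "nat \<Rightarrow> bool"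
  define N where "N t = card {l \<in> I. t l}" for t :: "nat \<Rightarrow> bool"
  have finE: "finite ?E" using fin by (intro finite_PiE) auto
  have "(\<Sum>i\<le>card I. (\<Sum>t | t \<in> ?E \<and> N t = i. C t) * s ^ i) = T u" for s
  proof -
    have "T u = T (\<lambda>l. u l + (s * \<omega> (u l) a) *s a)"
      using inv[OF transvection_in_Sp] by simp
    also have "\<dots> = T (\<lambda>l. \<Sum>b\<in>UNIV. if b then s *s ?w l else u l)"
      by (simp add: UNIV_bool add.commute)
    also have "\<dots> = (\<Sum>t\<in>?E. T (\<lambda>l. if t l then s *s ?w l else u l))"
      by (rule multilinear_expand[OF T fin]) simp
    also have "\<dots> = (\<Sum>t\<in>?E. C t * s ^ N t)"
    proof (intro sum.cong refl)
      fix t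
      have "T (\<lambda>l. if t l then s *s ?w l else u l) = T (\<lambda>l. (if t l then s else 1) *s (if t l then ?w l else u l))"
        by (intro multilinear_cong[OF T]) simp
      also have "\<dots> = (\<Prod>l\<in>I. if t l then s else 1) * C t"
        unfolding C_def by (rule multilinear_scale_all[OF T fin])
      also have "(\<Prod>l\<in>I. if t l then s else 1) = s ^ N t"
        using fin by (simp add: N_def prod.If_cases Int_def)
      finally show "T (\<lambda>l. if t l then s *s ?w l else u l) = C t * s ^ N t" by simp
    qed
    also have "\<dots> = (\<Sum>i\<le>card I. \<Sum>t | t \<in> ?E \<and> N t = i. C t * s ^ N t)"
      by (rule sum.group[OF finE, symmetric]) (use fin in \<open>auto simp: N_def intro: card_mono\<close>)
    also have "\<dots> = (\<Sum>i\<le>card I. (\<Sum>t | t \<in> ?E \<and> N t = i. C t) * s ^ i)"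
      by (simp add: sum_distrib_right)
    finally show ?thesis by simp
  qed
  then have coeff: "\<forall>i\<in>{1..card I}. (\<Sum>t | t \<in> ?E \<and> N t = i. C t) = 0"
    using polyfun_eq_const[of "\<lambda>i. \<Sum>t | t \<in> ?E \<and> N t = i. C t" "card I" "T u"] by auto
  show "(\<Sum>l\<in>I. T (u(l := \<omega> (u l) a *s a))) = 0"
  proof (cases "I = {}")
    case False
    have "(\<Sum>l\<in>I. T (u(l := \<omega> (u l) a *s a))) = (\<Sum>t | t \<in> ?E \<and> N t = 1. C t)"
    proof (rule sum.reindex_bij_witness[where j = "\<lambda>l. restrict (\<lambda>j. j = l) I" and i = "\<lambda>t. THE l. l \<in> I \<and> t l"], goal_cases)
      case (1 l)
      then show ?case by (auto intro: the_equality)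
    next
      case (2 l)
      then have "{j \<in> I. restrict (\<lambda>j. j = l) I j} = {l}" by auto
      then show ?case by (simp add: N_def)
    next
      case (3 t)
      then obtain m where "{l \<in> I. t l} = {m}" by (auto simp: N_def card_1_singleton_iff)
      then have m: "j \<in> I \<and> t j \<longleftrightarrow> j = m" for j unfolding set_eq_iff by blast
      then have "(THE l. l \<in> I \<and> t l) = m" by simp
      moreover have "restrict (\<lambda>j. j = m) I = t"
      proof
        fix j show "restrict (\<lambda>j. j = m) I j = t j"
          using m[of j] 3 by (cases "j \<in> I") (simp_all add: PiE_iff extensional_def)
      qed
      ultimately show ?case by simp
    next
      case (4 t)
      then obtain m where "{l \<in> I. t l} = {m}" by (auto simp: N_def card_1_singleton_iff)
      then have m: "j \<in> I \<and> t j \<longleftrightarrow> j = m" for j unfolding set_eq_iff by blast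
      then have "(THE l. l \<in> I \<and> t l) = m" by simp
      then show ?case using m[of m] by simp
    next
      case (5 l)
      then show ?case unfolding C_def by (intro multilinear_cong[OF T]) auto
    qed
    also have "\<dots> = 0" using coeff False fin by (simp add: Suc_le_eq card_gt_0_iff)
    finally show ?thesis .
  qed simp
qed

end

section \<open>Diagram functions and the first fundamental theorem\<close>

lemma total_degree_eq: "arc_diagram n D \<Longrightarrow> total_degree n D = 2 * size D"
proof (induction D)
  case empty
  then show ?case by (simp add: total_degree_def vertex_degree_def)
next
  case (add a D)
  obtain i j where a: "a = (i, j)" by (cases a)
  have ij: "1 \<le> i" "i < j" "j \<le> n" using add.prems by (auto simp: arc_diagram_def a)
  have "total_degree n (add_mset a D) = (\<Sum>x = 1..n. (if x = i then 1 else 0) + (if x = j then 1 else 0) + vertex_degree D x)"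
    unfolding total_degree_def using ij by (intro sum.cong refl) (auto simp: vertex_degree_def a)
  also have "\<dots> = 2 + total_degree n D"
    using ij by (simp add: sum.distrib total_degree_def)
  finally show ?case using add by (simp add: arc_diagram_def)
qed

lemma arc_diagram_add_mset:
  "arc_diagram n (add_mset (i, j) D) \<longleftrightarrow> 1 \<le> i \<and> i < j \<and> j \<le> n \<and> arc_diagram n D"
  by (auto simp: arc_diagram_def)

lemma diagram_function_empty [simp]: "diagram_function \<omega> {#} = (\<lambda>v. 1)"
  by (simp add: diagram_function_def)

lemma diagram_function_add_mset:
  "diagram_function \<omega> (add_mset (i, j) D) = (\<lambda>v. \<omega> (v i) (v j) * diagram_function \<omega> D v)"
  by (simp add: diagram_function_def)

lemma diagram_function_union:
  "diagram_function \<omega> (D + E) v = diagram_function \<omega> D v * diagram_function \<omega> E v"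
  by (simp add: diagram_function_def)

context symplectic_space
begin

text \<open>
  All diagrams of total degree \<open>d\<close>, without a restriction on the nestings.
\<close>

definition diagram_functions :: "nat \<Rightarrow> nat \<Rightarrow> ((nat \<Rightarrow> 'v) \<Rightarrow> complex) set" where
  "diagram_functions n d = diagram_function \<omega> ` {D. arc_diagram n D \<and> 2 * size D = d}"

text \<open>
  Identifying arguments turns a matching function into a diagram function up to sign, or into zero
  if both ends of a pair are identified.
\<close>

lemma restitution_of_matching:
  assumes "matching_function I g" and "finite I" and "\<iota> ` I \<subseteq> {1..n}"
  shows "(\<lambda>v. g (\<lambda>l. v (\<iota> l))) \<in> fun_vs.span (diagram_functions n (card I))"
  using assms
proof (induction rule: matching_function.induct)
  case empty
  have "diagram_function \<omega> {#} \<in> diagram_functions n 0"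
    unfolding diagram_functions_def by (rule imageI) (simp add: arc_diagram_def)
  then show ?case by (auto intro: fun_vs.span_base)
next
  case (pair I l m g)
  have card: "card I = card (I - {l, m}) + 2"
  proof -
    have "card {l, m} \<le> card I" using pair by (intro card_mono) auto
    then show ?thesis using pair by (subst card_Diff_subset) auto
  qed
  have IH: "(\<lambda>v. g (\<lambda>l. v (\<iota> l))) \<in> fun_vs.span (diagram_functions n (card (I - {l, m})))"
    using pair by auto
  have mult: "(\<lambda>v. \<omega> (v i) (v j) * g (\<lambda>l. v (\<iota> l))) \<in> fun_vs.span (diagram_functions n (card I))"
    if "1 \<le> i" "i < j" "j \<le> n" for i j
    using IH
  proof (rule span_fun_image)
    fix G assume "G \<in> diagram_functions n (card (I - {l, m}))"
    then obtain D where D: "G = diagram_function \<omega> D" "arc_diagram n D" "2 * size D = card (I - {l, m})"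
      by (auto simp: diagram_functions_def)
    have "diagram_function \<omega> (add_mset (i, j) D) \<in> diagram_functions n (card I)"
      unfolding diagram_functions_def
      by (rule imageI) (use D that card in \<open>simp add: arc_diagram_add_mset\<close>)
    then show "(\<lambda>v. \<omega> (v i) (v j) * G v) \<in> fun_vs.span (diagram_functions n (card I))"
      unfolding D(1) diagram_function_add_mset by (rule fun_vs.span_base)
  qed
  have lm: "\<iota> l \<in> {1..n}" "\<iota> m \<in> {1..n}" using pair by auto
  consider "\<iota> l < \<iota> m" | "\<iota> m < \<iota> l" | "\<iota> l = \<iota> m" by linarith
  then show ?case
  proof cases
    case 1
    then show ?thesis using mult[of "\<iota> l" "\<iota> m"] lm by simp
  next
    case 2
    then have "(\<lambda>v. (-1) * (\<omega> (v (\<iota> m)) (v (\<iota> l)) * g (\<lambda>l. v (\<iota> l)))) \<in> fun_vs.span (diagram_functions n (card I))"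
      using mult[of "\<iota> m" "\<iota> l"] lm by (intro span_fun_scale) simp
    then show ?thesis by (simp add: form_flip[of "_ (\<iota> l)" "_ (\<iota> m)"])
  next
    case 3
    then show ?thesis by (simp add: span_fun_zero)
  qed
qed

lemma homogeneous_polys_mult_linear:
  assumes f: "f \<in> homogeneous_polys smul n d"
    and \<phi>: "Vector_Spaces.linear smul (*) \<phi>" and i: "i \<in> {1..n}"
  shows "(\<lambda>v. \<phi> (v i) * f v) \<in> homogeneous_polys smul n (Suc d)"
  using f unfolding homogeneous_polys_def
proof (rule span_fun_image)
  fix G assume "G \<in> form_products smul n d"
  then obtain \<psi> \<iota> where G: "G = (\<lambda>v. \<Prod>l<d. \<psi> l (v (\<iota> l)))"
    and \<psi>: "\<forall>l<d. Vector_Spaces.linear smul (*) (\<psi> l) \<and> \<iota> l \<in> {1..n}"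
    by (auto simp: form_products_def)
  have "(\<lambda>v. \<phi> (v i) * G v) = (\<lambda>v. \<Prod>l<Suc d. (\<psi>(d := \<phi>)) l (v ((\<iota>(d := i)) l)))"
    unfolding G by (simp add: mult.commute)
  also have "\<dots> \<in> form_products smul n (Suc d)"
    unfolding form_products_def using \<psi> \<phi> i
    by (intro CollectI exI[of _ "\<psi>(d := \<phi>)"] exI[of _ "\<iota>(d := i)"] conjI refl) (auto simp: less_Suc_eq)
  finally show "(\<lambda>v. \<phi> (v i) * G v) \<in> fun_vs.span (form_products smul n (Suc d))"
    by (rule fun_vs.span_base)
qed

text \<open>
  Expanding in the symplectic basis writes \<open>\<omega> (v i) (v j)\<close> as a sum of products of two linear
  functionals.
\<close>

lemma diagram_function_homogeneous:
  "arc_diagram n D \<Longrightarrow> diagram_function \<omega> D \<in> homogeneous_polys smul n (2 * size D)"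
proof (induction D)
  case empty
  have "(\<lambda>v :: nat \<Rightarrow> 'v. 1 :: complex) \<in> form_products smul n 0"
    by (auto simp: form_products_def)
  then show ?case by (simp add: homogeneous_polys_def fun_vs.span_base)
next
  case (add a D)
  obtain i j where a: "a = (i, j)" by (cases a)
  have ij: "i \<in> {1..n}" "j \<in> {1..n}" and D: "arc_diagram n D"
    using add.prems by (auto simp: a arc_diagram_add_mset)
  have lin: "Vector_Spaces.linear smul (*) (\<omega> u)" "Vector_Spaces.linear smul (*) (\<lambda>v. \<omega> v u)" for u
    using bilinear by (simp_all add: bilinear_form_def)
  have "(\<lambda>v. \<Sum>c<2 * k. \<omega> (v i) (dual c) * (\<omega> (bas c) (v j) * diagram_function \<omega> D v))
      \<in> homogeneous_polys smul n (Suc (Suc (2 * size D)))"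
    unfolding homogeneous_polys_def
    by (intro span_fun_sum)
       (intro homogeneous_polys_mult_linear[unfolded homogeneous_polys_def] lin ij
         add.IH[OF D, unfolded homogeneous_polys_def])
  also have "(\<lambda>v. \<Sum>c<2 * k. \<omega> (v i) (dual c) * (\<omega> (bas c) (v j) * diagram_function \<omega> D v))
      = diagram_function \<omega> (add_mset a D)"
  proof
    fix v
    have "\<omega> (v i) (v j) = \<omega> (\<Sum>c<2 * k. \<omega> (v i) (dual c) *s bas c) (v j)"
      by (simp only: expand[symmetric])
    also have "\<dots> = (\<Sum>c<2 * k. \<omega> (v i) (dual c) * \<omega> (bas c) (v j))"
      by (simp only: form_sum_left form_scale_left)
    finally show "(\<Sum>c<2 * k. \<omega> (v i) (dual c) * (\<omega> (bas c) (v j) * diagram_function \<omega> D v))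
      = diagram_function \<omega> (add_mset a D) v"
      by (simp add: a diagram_function_add_mset sum_distrib_right mult.assoc)
  qed
  finally show ?case by simp
qed

lemma diagram_function_invariant:
  "g \<in> Sp smul \<omega> \<Longrightarrow> diagram_function \<omega> D (\<lambda>i. g (v i)) = diagram_function \<omega> D v"
  by (simp add: diagram_function_def Sp_def)

lemma homogeneous_polys_subset_polys: "homogeneous_polys smul n d \<subseteq> polys smul n"
  unfolding homogeneous_polys_def polys_def by (intro fun_vs.span_mono) auto

lemma diagram_functions_subset_invariants:
  "diagram_functions n d \<subseteq> homogeneous_Sp_invariants smul \<omega> n d"
  using diagram_function_homogeneous subsetD[OF homogeneous_polys_subset_polys diagram_function_homogeneous]
  by (auto simp: diagram_functions_def homogeneous_Sp_invariants_def Sp_invariants_def diagram_function_invariant)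

lemma subspace_homogeneous_Sp_invariants: "fun_vs.subspace (homogeneous_Sp_invariants smul \<omega> n d)"
proof -
  have "fun_vs.subspace {p :: (nat \<Rightarrow> 'v) \<Rightarrow> complex. \<forall>g \<in> Sp smul \<omega>. \<forall>v. p (\<lambda>i. g (v i)) = p v}"
    by (auto simp: fun_vs.subspace_def fscale_def)
  moreover have "homogeneous_Sp_invariants smul \<omega> n d
    = (polys smul n \<inter> {p. \<forall>g \<in> Sp smul \<omega>. \<forall>v. p (\<lambda>i. g (v i)) = p v}) \<inter> homogeneous_polys smul n d"
    by (auto simp: homogeneous_Sp_invariants_def Sp_invariants_def)
  ultimately show ?thesis
    by (simp only: homogeneous_polys_def polys_def) (intro fun_vs.subspace_inter fun_vs.subspace_span)
qed

text \<open>
  The first fundamental theorem for polynomial invariants: polarize, apply the multilinear version,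
  and restitute.
\<close>

theorem span_diagram_functions:
  "fun_vs.span (diagram_functions n d) = homogeneous_Sp_invariants smul \<omega> n d"
proof (intro equalityI subsetI)
  fix f assume "f \<in> fun_vs.span (diagram_functions n d)"
  then show "f \<in> homogeneous_Sp_invariants smul \<omega> n d"
    using fun_vs.span_minimal[OF diagram_functions_subset_invariants subspace_homogeneous_Sp_invariants] by auto
next
  fix f assume f: "f \<in> homogeneous_Sp_invariants smul \<omega> n d"
  then have hom: "f \<in> homogeneous_polys smul n d"
    and inv: "\<And>g v. g \<in> Sp smul \<omega> \<Longrightarrow> f (\<lambda>i. g (v i)) = f v"
    by (auto simp: homogeneous_Sp_invariants_def Sp_invariants_def)
  let ?c = "of_nat (card {t. t \<in> {..<d} \<rightarrow>\<^sub>E {..<d} \<and> t ` {..<d} = {..<d}}) :: complex"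
  have "(\<lambda>v. polarization d f \<iota> (\<lambda>l. v (\<iota> l))) \<in> fun_vs.span (diagram_functions n d)"
    if \<iota>: "\<iota> \<in> {..<d} \<rightarrow>\<^sub>E {1..n}" for \<iota>
  proof -
    have ml: "multilinear_on {..<d} (polarization d f \<iota>)" by (rule multilinear_on_polarization[OF hom])
    have "sp_invariant_on {..<d} (polarization d f \<iota>)"
    proof (rule sp_invariant_on_if_Sp_invariant[OF _ ml])
      fix g u assume "g \<in> Sp smul \<omega>"
      then show "polarization d f \<iota> (\<lambda>l. g (u l)) = polarization d f \<iota> u"
        using inv by (intro polarization_invariant) (auto simp: Sp_def)
    qed simp
    then have "polarization d f \<iota> \<in> fun_vs.span {g. matching_function {..<d} g}"
      using ml by (intro multilinear_invariants) auto
    then have "(\<lambda>v. 1 * polarization d f \<iota> (\<lambda>l. v (\<iota> l))) \<in> fun_vs.span (diagram_functions n d)"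
    proof (rule span_fun_image)
      fix G assume "G \<in> {g. matching_function {..<d} g}"
      then show "(\<lambda>v. 1 * G (\<lambda>l. v (\<iota> l))) \<in> fun_vs.span (diagram_functions n d)"
        using restitution_of_matching[of "{..<d}" G \<iota> n] \<iota> by auto
    qed
    then show ?thesis by simp
  qed
  then have "(\<lambda>v. 1 / ?c * (\<Sum>\<iota> \<in> {..<d} \<rightarrow>\<^sub>E {1..n}. polarization d f \<iota> (\<lambda>l. v (\<iota> l))))
      \<in> fun_vs.span (diagram_functions n d)"
    by (intro span_fun_scale span_fun_sum)
  moreover have "?c \<noteq> 0" using card_surjections_pos[of d] by simp
  ultimately show "f \<in> fun_vs.span (diagram_functions n d)"
    unfolding restitution[OF hom] by simp
qed

end

section \<open>Straightening by the Pfaffian relation\<close>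

lemma prod_pair_flip:
  assumes "finite L" and "l0 \<in> L"
    and "\<And>l. l \<in> L \<Longrightarrow> l \<noteq> l0 \<Longrightarrow> f l = g l" and "f l0 = - g l0"
  shows "(\<Prod>l\<in>L. f l) = - (\<Prod>l\<in>L. g l :: complex)"
proof -
  have "(\<Prod>l\<in>L - {l0}. f l) = (\<Prod>l\<in>L - {l0}. g l)" using assms by (intro prod.cong) auto
  then show ?thesis by (simp add: prod.remove[OF assms(1,2)] assms(4))
qed

context symplectic_space
begin

lemma alternating_sum_transpose:
  assumes "i \<in> I" and "j \<in> I" and "i \<noteq> j" and fin: "finite I"
  shows "(\<Sum>\<sigma> | \<sigma> permutes I. of_int (sign \<sigma>) * \<Phi> (\<lambda>l. z (transpose i j (\<sigma> l))))
    = - (\<Sum>\<sigma> | \<sigma> permutes I. of_int (sign \<sigma>) * (\<Phi> (\<lambda>l. z (\<sigma> l)) :: complex))"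
proof -
  have t: "transpose i j permutes I" using assms by (intro permutes_swap_id)
  have invol: "transpose i j \<circ> (transpose i j \<circ> \<sigma>) = \<sigma>" for \<sigma> by (simp add: fun_eq_iff)
  have "(\<Sum>\<sigma> | \<sigma> permutes I. of_int (sign \<sigma>) * \<Phi> (\<lambda>l. z (transpose i j (\<sigma> l))))
    = (\<Sum>\<sigma> | \<sigma> permutes I. of_int (sign (transpose i j \<circ> \<sigma>)) * \<Phi> (\<lambda>l. z (\<sigma> l)))"
    by (rule sum.reindex_bij_witness[where i = "\<lambda>\<sigma>. transpose i j \<circ> \<sigma>" and j = "\<lambda>\<sigma>. transpose i j \<circ> \<sigma>"])
       (use permutes_compose[OF _ t] in \<open>auto simp only: invol mem_Collect_eq o_apply\<close>)
  also have "\<dots> = - (\<Sum>\<sigma> | \<sigma> permutes I. of_int (sign \<sigma>) * \<Phi> (\<lambda>l. z (\<sigma> l)))"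
    unfolding sum_negf[symmetric]
  proof (intro sum.cong refl)
    fix \<sigma> assume "\<sigma> \<in> {\<sigma>. \<sigma> permutes I}"
    then have "permutation \<sigma>" using fin permutation_permutes by blast
    moreover have "permutation (transpose i j)" by (rule permutation_swap_id)
    ultimately show "of_int (sign (transpose i j \<circ> \<sigma>)) * \<Phi> (\<lambda>l. z (\<sigma> l)) = - (of_int (sign \<sigma>) * \<Phi> (\<lambda>l. z (\<sigma> l)))"
      using assms by (simp add: sign_compose sign_swap_id)
  qed
  finally show ?thesis .
qed

text \<open>
  The sum is an alternating multilinear function of \<open>z\<close>, and it vanishes on tuples of basis vectors
  because two of them must agree.
\<close>

lemma alternating_sum_zero:
  assumes \<Phi>: "multilinear_on I \<Phi>" and fin: "finite I" and card: "card I > 2 * k"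
  shows "(\<Sum>\<sigma> | \<sigma> permutes I. of_int (sign \<sigma>) * \<Phi> (\<lambda>l. z (\<sigma> l))) = 0"
proof -
  define \<Psi> where "\<Psi> z = (\<Sum>\<sigma> | \<sigma> permutes I. of_int (sign \<sigma>) * \<Phi> (\<lambda>l. z (\<sigma> l)))" for z
  have "multilinear_on I (\<lambda>z. of_int (sign \<sigma>) * \<Phi> (\<lambda>l. z (\<sigma> l)))" if "\<sigma> permutes I" for \<sigma>
    using fun_vs.subspace_scale[OF subspace_multilinear_on[of I], of "\<lambda>z. \<Phi> (\<lambda>l. z (\<sigma> l))" "of_int (sign \<sigma>)"]
      multilinear_on_reindex[OF \<Phi>, of \<sigma> I] that
    by (simp add: fscale_def permutes_imp_bij)
  then have \<Psi>: "multilinear_on I \<Psi>"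
    unfolding \<Psi>_def[abs_def] by (intro multilinear_on_sum) auto
  have bas0: "\<Psi> (\<lambda>l. bas (t l)) = 0" if t: "t \<in> I \<rightarrow>\<^sub>E {..<2 * k}" for t
  proof -
    have "\<not> inj_on t I"
      using card_inj_on_le[of t I "{..<2 * k}"] t card by auto
    then obtain i j where ij: "i \<in> I" "j \<in> I" "i \<noteq> j" "t i = t j" by (auto simp: inj_on_def)
    have "t (transpose i j x) = t x" for x using ij(4) by (auto simp: transpose_def)
    then have "\<Psi> (\<lambda>l. bas (t l)) = \<Psi> (\<lambda>l. bas (t (transpose i j l)))" by simp
    also have "\<dots> = - \<Psi> (\<lambda>l. bas (t l))"
      unfolding \<Psi>_def using alternating_sum_transpose[OF ij(1-3) fin, of \<Phi> "\<lambda>l. bas (t l)"] by simp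
    finally show ?thesis by (simp add: eq_neg_iff_add_eq_0)
  qed
  have "\<Psi> z = \<Psi> (\<lambda>l. \<Sum>a<2 * k. \<omega> (z l) (dual a) *s bas a)"
    by (simp only: expand[symmetric])
  also have "\<dots> = (\<Sum>t\<in>I \<rightarrow>\<^sub>E {..<2 * k}. \<Psi> (\<lambda>l. \<omega> (z l) (dual (t l)) *s bas (t l)))"
    by (rule multilinear_expand[OF \<Psi> fin]) simp
  also have "\<dots> = 0"
    by (rule sum.neutral) (simp add: multilinear_scale_all[OF \<Psi> fin] bas0)
  finally show ?thesis by (simp add: \<Psi>_def)
qed

text \<open>
  A permutation of the points \<open>2 * l, 2 * l + 1\<close> that respects the blocks contributes the same term
  as the identity: interchanging two blocks is an even permutation, and interchanging the two
  points of a block changes the sign of the permutation and of the form. The induction uses such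
  moves to make the block of \<open>l0\<close> fixed pointwise.
\<close>

lemma block_permutation_term:
  fixes L :: "nat set"
  assumes "finite L" and "\<sigma> permutes (\<Union>l\<in>L. {2 * l, 2 * l + 1})"
    and "\<And>l. l \<in> L \<Longrightarrow> \<exists>l'\<in>L. {\<sigma> (2 * l), \<sigma> (2 * l + 1)} = {2 * l', 2 * l' + 1}"
  shows "of_int (sign \<sigma>) * (\<Prod>l\<in>L. \<omega> (z (\<sigma> (2 * l))) (z (\<sigma> (2 * l + 1))))
    = (\<Prod>l\<in>L. \<omega> (z (2 * l)) (z (2 * l + 1)))"
  using assms
proof (induction L arbitrary: \<sigma> rule: finite_induct)
  case empty
  then show ?case by simp
next
  case (insert l0 L)
  let ?L = "insert l0 L"
  let ?B = "\<Union>l\<in>?L. {2 * l, 2 * l + 1}"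
  let ?G = "\<lambda>\<sigma> l. \<omega> (z (\<sigma> (2 * l))) (z (\<sigma> (2 * l + 1)))"
  have finB: "finite ?B" using insert.hyps by auto
  have perm: "permutation \<tau>" if "\<tau> permutes ?B" for \<tau>
    using that finB permutation_permutes by blast
  have "\<exists>l1\<in>?L. {\<sigma> (2 * l1), \<sigma> (2 * l1 + 1)} = {2 * l0, 2 * l0 + 1}"
  proof -
    have "2 * l0 \<in> \<sigma> ` ?B" using permutes_image[OF insert.prems(1)] by auto
    then obtain l1 where l1: "l1 \<in> ?L" "2 * l0 \<in> {\<sigma> (2 * l1), \<sigma> (2 * l1 + 1)}" by auto
    obtain l' where l': "{\<sigma> (2 * l1), \<sigma> (2 * l1 + 1)} = {2 * l', 2 * l' + 1}"
      using insert.prems(2)[OF l1(1)] by auto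
    have "2 * l0 \<in> {2 * l', 2 * l' + 1}" using l1(2) unfolding l' .
    then have "2 * l0 = 2 * l' \<or> 2 * l0 = 2 * l' + 1" by simp
    then have "l' = l0" by presburger
    then show ?thesis using l1(1) l' by auto
  qed
  then obtain l1 where l1: "l1 \<in> ?L" "{\<sigma> (2 * l1), \<sigma> (2 * l1 + 1)} = {2 * l0, 2 * l0 + 1}" by auto
  \<comment> \<open>interchange the blocks of \<open>l0\<close> and \<open>l1\<close>; for \<open>l1 = l0\<close> this is the identity\<close>
  define \<tau> where "\<tau> = transpose l0 l1"
  define t where "t = transpose (2 * l0) (2 * l1) \<circ> transpose (2 * l0 + 1) (2 * l1 + 1)"
  have t: "t (2 * l) = 2 * \<tau> l" "t (2 * l + 1) = 2 * \<tau> l + 1" for l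
  proof -
    have odd: "2 * a \<noteq> 2 * b + (1::nat)" "2 * b + (1::nat) \<noteq> 2 * a" for a b by presburger+
    show "t (2 * l) = 2 * \<tau> l" "t (2 * l + 1) = 2 * \<tau> l + 1"
      using odd by (auto simp: t_def \<tau>_def transpose_def)
  qed
  have \<tau>: "\<tau> permutes ?L" unfolding \<tau>_def using l1 by (intro permutes_swap_id) auto
  have tB: "t permutes ?B"
    unfolding t_def using l1(1) by (intro permutes_compose permutes_swap_id) auto
  have "sign t = 1" unfolding t_def by (simp add: sign_compose permutation_swap_id sign_swap_id)
  define \<sigma>1 where "\<sigma>1 = \<sigma> \<circ> t"
  have \<sigma>1: "\<sigma>1 permutes ?B" unfolding \<sigma>1_def by (rule permutes_compose[OF tB insert.prems(1)])
  have sign1: "sign \<sigma>1 = sign \<sigma>"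
    unfolding \<sigma>1_def using perm[OF tB] perm[OF insert.prems(1)] \<open>sign t = 1\<close> by (simp add: sign_compose)
  have prod1: "(\<Prod>l\<in>?L. ?G \<sigma>1 l) = (\<Prod>l\<in>?L. ?G \<sigma> l)"
    unfolding \<sigma>1_def o_def t using prod.permute[OF \<tau>, of "?G \<sigma>"] by (simp add: o_def)
  have block1: "\<exists>l'\<in>?L. {\<sigma>1 (2 * l), \<sigma>1 (2 * l + 1)} = {2 * l', 2 * l' + 1}" if "l \<in> ?L" for l
    unfolding \<sigma>1_def o_def t using that permutes_in_image[OF \<tau>, of l] by (intro insert.prems(2)) auto
  have at0: "{\<sigma>1 (2 * l0), \<sigma>1 (2 * l0 + 1)} = {2 * l0, 2 * l0 + 1}"
    unfolding \<sigma>1_def o_def t using l1(2) by (simp add: \<tau>_def)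
  obtain \<sigma>2 where \<sigma>2: "\<sigma>2 permutes ?B" "\<sigma>2 (2 * l0) = 2 * l0" "\<sigma>2 (2 * l0 + 1) = 2 * l0 + 1"
    "\<And>x. x \<noteq> 2 * l0 \<Longrightarrow> x \<noteq> 2 * l0 + 1 \<Longrightarrow> \<sigma>2 x = \<sigma>1 x"
    "of_int (sign \<sigma>2) * (\<Prod>l\<in>?L. ?G \<sigma>2 l) = of_int (sign \<sigma>1) * (\<Prod>l\<in>?L. ?G \<sigma>1 l)"
  proof (cases "\<sigma>1 (2 * l0) = 2 * l0")
    case True
    then have "\<sigma>1 (2 * l0 + 1) = 2 * l0 + 1" using at0 by (auto simp: doubleton_eq_iff)
    then show ?thesis using that[of \<sigma>1] True \<sigma>1 by simp
  next
    case False
    then have flip: "\<sigma>1 (2 * l0) = 2 * l0 + 1" "\<sigma>1 (2 * l0 + 1) = 2 * l0"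
      using at0 by (auto simp: doubleton_eq_iff)
    define s where "s = transpose (2 * l0) (2 * l0 + 1)"
    have s: "s permutes ?B" unfolding s_def by (intro permutes_swap_id) auto
    have eq: "(\<sigma>1 \<circ> s) (2 * l0) = 2 * l0" "(\<sigma>1 \<circ> s) (2 * l0 + 1) = 2 * l0 + 1"
      "\<And>x. x \<noteq> 2 * l0 \<Longrightarrow> x \<noteq> 2 * l0 + 1 \<Longrightarrow> (\<sigma>1 \<circ> s) x = \<sigma>1 x"
      using flip by (auto simp: s_def)
    have "(\<Prod>l\<in>?L. ?G (\<sigma>1 \<circ> s) l) = - (\<Prod>l\<in>?L. ?G \<sigma>1 l)"
    proof (rule prod_pair_flip[of _ l0])
      fix l assume "l \<noteq> l0"
      then have "2 * l \<noteq> 2 * l0" "2 * l \<noteq> 2 * l0 + 1" "2 * l + 1 \<noteq> 2 * l0" "2 * l + 1 \<noteq> 2 * l0 + 1" by presburger+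
      then show "?G (\<sigma>1 \<circ> s) l = ?G \<sigma>1 l" by (simp only: eq(3) simp_thms)
    next
      show "?G (\<sigma>1 \<circ> s) l0 = - ?G \<sigma>1 l0"
        unfolding eq(1,2) flip by (rule form_flip)
    qed (use insert.hyps in auto)
    moreover have "sign (\<sigma>1 \<circ> s) = - sign \<sigma>1"
      using perm[OF s] perm[OF \<sigma>1] by (simp add: sign_compose s_def sign_swap_id)
    ultimately show ?thesis
      using that[of "\<sigma>1 \<circ> s"] eq permutes_compose[OF s \<sigma>1] by simp
  qed
  have \<sigma>2L: "\<sigma>2 permutes (\<Union>l\<in>L. {2 * l, 2 * l + 1})"
  proof (rule permutes_superset[OF \<sigma>2(1)])
    fix x assume "x \<in> ?B - (\<Union>l\<in>L. {2 * l, 2 * l + 1})"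
    then have "x = 2 * l0 \<or> x = 2 * l0 + 1" by auto
    then show "\<sigma>2 x = x" using \<sigma>2 by auto
  qed
  have "of_int (sign \<sigma>2) * (\<Prod>l\<in>L. ?G \<sigma>2 l) = (\<Prod>l\<in>L. \<omega> (z (2 * l)) (z (2 * l + 1)))"
  proof (rule insert.IH[OF \<sigma>2L])
    fix l assume l: "l \<in> L"
    then have "l \<noteq> l0" using insert.hyps by auto
    then have ne: "2 * l \<noteq> 2 * l0" "2 * l \<noteq> 2 * l0 + 1" "2 * l + 1 \<noteq> 2 * l0" "2 * l + 1 \<noteq> 2 * l0 + 1" by presburger+
    obtain l' where l': "l' \<in> ?L" "{\<sigma>1 (2 * l), \<sigma>1 (2 * l + 1)} = {2 * l', 2 * l' + 1}"
      using block1[of l] l by auto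
    have "l' \<noteq> l0"
    proof
      assume "l' = l0"
      have "\<sigma>1 (2 * l) \<in> {2 * l', 2 * l' + 1}" unfolding l'(2)[symmetric] by simp
      then have "\<sigma>1 (2 * l) \<in> {\<sigma>1 (2 * l0), \<sigma>1 (2 * l0 + 1)}"
        unfolding at0 \<open>l' = l0\<close> .
      then show False using ne(1,2) by (simp only: insert_iff empty_iff inj_eq[OF permutes_inj[OF \<sigma>1]] simp_thms)
    qed
    then have "l' \<in> L" using l'(1) by simp
    moreover have "{\<sigma>2 (2 * l), \<sigma>2 (2 * l + 1)} = {2 * l', 2 * l' + 1}"
      unfolding \<sigma>2(4)[OF ne(1,2)] \<sigma>2(4)[OF ne(3,4)] by (rule l'(2))
    ultimately show "\<exists>l'\<in>L. {\<sigma>2 (2 * l), \<sigma>2 (2 * l + 1)} = {2 * l', 2 * l' + 1}" ..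
  qed
  then have "of_int (sign \<sigma>2) * (\<Prod>l\<in>?L. ?G \<sigma>2 l) = (\<Prod>l\<in>?L. \<omega> (z (2 * l)) (z (2 * l + 1)))"
    using insert.hyps \<sigma>2(2,3) by (simp add: mult.left_commute)
  then show ?case using \<sigma>2(5) sign1 prod1 by simp
qed

lemma multilinear_on_standard_matching:
  "multilinear_on {..<2 * m} (\<lambda>w. \<Prod>l<m. \<omega> (w (2 * l)) (w (2 * l + 1)))"
proof -
  have "matching_function {..<2 * m} (\<lambda>w. \<Prod>l<m. \<omega> (w (2 * l)) (w (2 * l + 1)))"
  proof (induction m)
    case 0
    then show ?case using matching_function.empty by simp
  next
    case (Suc m)
    have "{..<2 * Suc m} - {2 * m, 2 * m + 1} = {..<2 * m}" by auto
    then have "matching_function ({..<2 * Suc m} - {2 * m, 2 * m + 1}) (\<lambda>w. \<Prod>l<m. \<omega> (w (2 * l)) (w (2 * l + 1)))"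
      using Suc by simp
    from matching_function.pair[OF this] show ?case by (simp add: mult.commute)
  qed
  then show ?thesis by (rule multilinear_on_matching_function)
qed

end

abbreviation arc_length :: "arc \<Rightarrow> nat" where "arc_length a \<equiv> snd a - fst a"

text \<open>
  The multiset order on the arc lengths, which decreases when a nesting is straightened.
\<close>

definition shorter :: "(arc multiset \<times> arc multiset) set" where
  "shorter = inv_image (mult less_than) (image_mset arc_length)"

lemma wf_shorter: "wf shorter"
  unfolding shorter_def by (intro wf_inv_image wf_mult wf_less_than)

lemma shorter_exchange:
  assumes fin: "finite S" "finite T" and a: "a \<in> S - T"
    and less: "\<And>b. b \<in> T - S \<Longrightarrow> arc_length b < arc_length a"
  shows "(R + mset_set T, R + mset_set S) \<in> shorter"
proof -
  have S: "mset_set S = mset_set (S \<inter> T) + mset_set (S - T)"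
    and T: "mset_set T = mset_set (S \<inter> T) + mset_set (T - S)"
    using fin by (subst mset_set_Union[symmetric]; auto intro!: arg_cong[of _ _ mset_set])+
  have "(image_mset arc_length (R + mset_set (S \<inter> T)) + image_mset arc_length (mset_set (T - S)),
      image_mset arc_length (R + mset_set (S \<inter> T)) + image_mset arc_length (mset_set (S - T))) \<in> mult less_than"
    using a less fin by (intro one_step_implies_mult) (auto simp: mset_set_empty_iff)
  then show ?thesis by (simp add: shorter_def S T add.assoc)
qed

definition sort_arc :: "nat \<Rightarrow> nat \<Rightarrow> arc" where "sort_arc i j = (min i j, max i j)"

lemma sort_arc_ends: "{fst (sort_arc i j), snd (sort_arc i j)} = {i, j}"
  by (auto simp: sort_arc_def min_def max_def)

lemma strictly_nested_inside:
  assumes "strict_nesting S" and "a \<in> S" and "b \<in> S" and "arc_length b \<le> arc_length a"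
  shows "fst a \<le> fst b \<and> snd b \<le> snd a"
proof (cases "a = b")
  case False
  then have "strictly_nested a b" using assms by (auto simp: strict_nesting_def)
  then show ?thesis using assms(4) by (cases a; cases b) (auto simp: strictly_nested_def)
qed simp

lemma strict_nesting_disjoint_ends:
  assumes "strict_nesting S" and "a \<in> S" and "b \<in> S" and "a \<noteq> b"
    and "x \<in> {fst a, snd a}" and "y \<in> {fst b, snd b}"
  shows "x \<noteq> y"
proof -
  have "strictly_nested a b" using assms by (auto simp: strict_nesting_def)
  then show ?thesis using assms(5,6) by (cases a; cases b) (auto simp: strictly_nested_def)
qed

context symplectic_space
begin

lemma form_sort_arc:
  "\<omega> (v i) (v j) = (if i < j then 1 else -1) * (case sort_arc i j of (a, b) \<Rightarrow> \<omega> (v a) (v b))"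
  using form_flip[of "v i" "v j"] by (auto simp: sort_arc_def min_def max_def)

text \<open>
  The Pfaffian relation for the \<open>2 * k + 2\<close> ends of the nesting \<open>S\<close>, multiplied by the function of
  the other arcs of \<open>D\<close>. A permutation \<open>\<sigma>\<close> that does not respect the matching \<open>S\<close> replaces it by the
  arcs \<open>T \<sigma>\<close>. Let \<open>a\<close> be the longest arc of \<open>S - T \<sigma>\<close>. The arcs of \<open>T \<sigma> - S\<close> join ends of arcs in
  \<open>S - T \<sigma>\<close>, which all lie inside \<open>a\<close>, and so they are shorter than \<open>a\<close>.
\<close>

lemma straightening_step:
  assumes D: "arc_diagram n D" and S: "S \<subseteq> set_mset D" "strict_nesting S" "card S = Suc k"
  shows "diagram_function \<omega> D \<in> fun_vs.span (diagram_function \<omega> `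
    {E. arc_diagram n E \<and> size E = size D \<and> (E, D) \<in> shorter})"
proof -
  let ?m = "Suc k"
  have finS: "finite S" using S(3) card_ge_0_finite by force
  have arcs: "1 \<le> fst a" "fst a < snd a" "snd a \<le> n" if "a \<in> S" for a
    using that S(1) D by (auto simp: arc_diagram_def split: prod.splits)
  obtain \<alpha> where \<alpha>: "bij_betw \<alpha> {..<?m} S"
    using ex_bij_betw_nat_finite[OF finS] S(3) by (auto simp: lessThan_atLeast0)
  \<comment> \<open>number the ends of the arcs of \<open>S\<close>: the arc \<open>\<alpha> l\<close> has its ends at \<open>2 * l\<close> and \<open>2 * l + 1\<close>\<close>
  define pos where "pos x = (if even x then fst (\<alpha> (x div 2)) else snd (\<alpha> (x div 2)))" for x :: nat
  have pos_end: "pos x \<in> {fst (\<alpha> (x div 2)), snd (\<alpha> (x div 2))}" for x by (simp add: pos_def)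
  have pos_pair: "pos (2 * l) = fst (\<alpha> l)" "pos (2 * l + 1) = snd (\<alpha> l)" for l by (auto simp: pos_def)
  have \<alpha>S: "\<alpha> l \<in> S" if "l < ?m" for l using \<alpha> that by (auto simp: bij_betw_def)
  have pos_inj: "x = y" if xy: "x < 2 * ?m" "y < 2 * ?m" "pos x = pos y" for x y
  proof -
    have "x div 2 = y div 2"
    proof (rule ccontr)
      assume "x div 2 \<noteq> y div 2"
      then have "\<alpha> (x div 2) \<noteq> \<alpha> (y div 2)"
        using \<alpha> xy by (auto simp: bij_betw_def inj_on_def)
      then show False
        using strict_nesting_disjoint_ends[OF S(2) _ _ _ pos_end[of x] pos_end[of y]] \<alpha>S xy by auto
    qed
    moreover have "even x \<longleftrightarrow> even y"
      using xy(3) arcs(2)[OF \<alpha>S, of "x div 2"] xy(1) \<open>x div 2 = y div 2\<close> div_less_iff_less_mult[of 2 x ?m]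
      by (auto simp: pos_def split: if_splits)
    ultimately show "x = y" by (metis div_mult_mod_eq even_iff_mod_2_eq_zero not_mod_2_eq_0_eq_1)
  qed
  define A where "A \<sigma> l = sort_arc (pos (\<sigma> (2 * l))) (pos (\<sigma> (2 * l + 1)))" for \<sigma> :: "nat \<Rightarrow> nat" and l
  define T where "T \<sigma> = A \<sigma> ` {..<?m}" for \<sigma>
  define R where "R = D - mset_set S"
  have DR: "D = R + mset_set S"
  proof -
    have "mset_set S \<subseteq># mset_set (set_mset D)" by (rule subset_imp_msubset_mset_set[OF S(1)]) simp
    also have "\<dots> \<subseteq># D" by (simp add: subseteq_mset_def count_mset_set')
    finally show ?thesis by (simp add: R_def)
  qed
  \<comment> \<open>the permutations that reproduce the matching \<open>S\<close>\<close>
  define H where "H = {\<sigma>. \<sigma> permutes {..<2 * ?m} \<and>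
    (\<forall>l\<in>{..<?m}. \<exists>l'\<in>{..<?m}. {\<sigma> (2 * l), \<sigma> (2 * l + 1)} = {2 * l', 2 * l' + 1})}"
  define F where "F \<sigma> v = of_int (sign \<sigma>) * (\<Prod>l<?m. \<omega> (v (pos (\<sigma> (2 * l)))) (v (pos (\<sigma> (2 * l + 1)))))"
    for \<sigma> and v :: "nat \<Rightarrow> 'v"
  have blocks: "(\<Union>l\<in>{..<?m}. {2 * l, 2 * l + 1}) = {..<2 * ?m}"
  proof (intro equalityI subsetI)
    fix x assume "x \<in> {..<2 * ?m}"
    then have "x div 2 < ?m" "x = 2 * (x div 2) \<or> x = 2 * (x div 2) + 1" by auto
    then show "x \<in> (\<Union>l\<in>{..<?m}. {2 * l, 2 * l + 1})" by blast
  qed auto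
  have finP: "finite {\<sigma>. \<sigma> permutes {..<2 * ?m}}" by (intro finite_permutations) simp
  have sum0: "(\<Sum>\<sigma> | \<sigma> permutes {..<2 * ?m}. F \<sigma> v) = 0" for v
    unfolding F_def using alternating_sum_zero[OF multilinear_on_standard_matching, of ?m "\<lambda>x. v (pos x)"] by simp
  have FH: "F \<sigma> v = diagram_function \<omega> (mset_set S) v" if "\<sigma> \<in> H" for \<sigma> v
  proof -
    have "F \<sigma> v = (\<Prod>l<?m. \<omega> (v (pos (2 * l))) (v (pos (2 * l + 1))))"
      unfolding F_def using that blocks
      by (intro block_permutation_term[where z = "\<lambda>x. v (pos x)"]) (auto simp: H_def)
    also have "\<dots> = (\<Prod>l<?m. case \<alpha> l of (i, j) \<Rightarrow> \<omega> (v i) (v j))"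
      unfolding pos_pair by (simp add: case_prod_beta)
    also have "\<dots> = (\<Prod>(i, j)\<in>S. \<omega> (v i) (v j))"
      by (rule prod.reindex_bij_betw[OF \<alpha>])
    finally show ?thesis by (simp add: diagram_function_def prod_unfold_prod_mset)
  qed
  have not_H: "(\<lambda>v. diagram_function \<omega> R v * F \<sigma> v) \<in> fun_vs.span (diagram_function \<omega> `
    {E. arc_diagram n E \<and> size E = size D \<and> (E, D) \<in> shorter})"
    if \<sigma>: "\<sigma> permutes {..<2 * ?m}" "\<sigma> \<notin> H" for \<sigma>
  proof -
    have in_range: "\<sigma> x < 2 * ?m" if "x < 2 * ?m" for x
      using permutes_in_image[OF \<sigma>(1), of x] that by simp
    have ends: "{fst (A \<sigma> l), snd (A \<sigma> l)} = {pos (\<sigma> (2 * l)), pos (\<sigma> (2 * l + 1))}" for l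
      unfolding A_def by (rule sort_arc_ends)
    have pos_\<sigma>_inj: "x = y" if "x < 2 * ?m" "y < 2 * ?m" "pos (\<sigma> x) = pos (\<sigma> y)" for x y
      using pos_inj[OF in_range in_range] that permutes_inj[OF \<sigma>(1)] by (auto dest: injD)
    have common: "l = l'" if l: "l < ?m" "l' < ?m"
      and x: "x \<in> {fst (A \<sigma> l), snd (A \<sigma> l)}" "x \<in> {fst (A \<sigma> l'), snd (A \<sigma> l')}" for l l' x
    proof -
      have "\<exists>y\<in>{2 * l, 2 * l + 1}. x = pos (\<sigma> y)" "\<exists>y\<in>{2 * l', 2 * l' + 1}. x = pos (\<sigma> y)"
        using x unfolding ends by blast+
      then obtain y y' where y: "y \<in> {2 * l, 2 * l + 1}" "y' \<in> {2 * l', 2 * l' + 1}" "pos (\<sigma> y) = pos (\<sigma> y')" by metis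
      have "y < 2 * ?m" using y(1) l(1) by auto
      moreover have "y' < 2 * ?m" using y(2) l(2) by auto
      ultimately have "y = y'" using y(3) by (rule pos_\<sigma>_inj)
      then have "(y = 2 * l \<or> y = 2 * l + 1) \<and> (y = 2 * l' \<or> y = 2 * l' + 1)" using y(1,2) by simp
      then show ?thesis by presburger
    qed
    have injA: "inj_on (A \<sigma>) {..<?m}"
    proof (rule inj_onI)
      fix l l' assume "l \<in> {..<?m}" "l' \<in> {..<?m}" "A \<sigma> l = A \<sigma> l'"
      then show "l = l'" using common[of l l' "fst (A \<sigma> l)"] by simp
    qed
    have cardT: "card (T \<sigma>) = card S" unfolding T_def S(3) using card_image[OF injA] by simp
    have finT: "finite (T \<sigma>)" by (simp add: T_def)
    have pos_range: "1 \<le> pos x" "pos x \<le> n" if "x < 2 * ?m" for x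
    proof -
      have "x div 2 < ?m" using that by auto
      from arcs[OF \<alpha>S[OF this]] show "1 \<le> pos x" "pos x \<le> n" by (auto simp: pos_def)
    qed
    have A_arc: "1 \<le> fst (A \<sigma> l) \<and> fst (A \<sigma> l) < snd (A \<sigma> l) \<and> snd (A \<sigma> l) \<le> n" if l: "l < ?m" for l
    proof -
      have r: "2 * l < 2 * ?m" "2 * l + 1 < 2 * ?m" using l by auto
      have "pos (\<sigma> (2 * l)) \<noteq> pos (\<sigma> (2 * l + 1))"
        using pos_\<sigma>_inj[OF r] by (metis add_eq_self_zero zero_neq_one)
      then show ?thesis
        using pos_range[OF in_range[OF r(1)]] pos_range[OF in_range[OF r(2)]]
        by (auto simp: A_def sort_arc_def min_def max_def)
    qed
    have "T \<sigma> \<noteq> S"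
    proof
      assume TS: "T \<sigma> = S"
      have "\<exists>l'\<in>{..<?m}. {\<sigma> (2 * l), \<sigma> (2 * l + 1)} = {2 * l', 2 * l' + 1}" if l: "l < ?m" for l
      proof -
        have r: "2 * l < 2 * ?m" "2 * l + 1 < 2 * ?m" using l by auto
        have "A \<sigma> l \<in> S" using TS l by (auto simp: T_def)
        then obtain l' where l': "l' < ?m" "A \<sigma> l = \<alpha> l'" using \<alpha> by (auto simp: bij_betw_def)
        have "pos ` {\<sigma> (2 * l), \<sigma> (2 * l + 1)} = pos ` {2 * l', 2 * l' + 1}"
          using ends[of l] unfolding l'(2) image_insert image_empty pos_pair by simp
        moreover have "inj_on pos {..<2 * ?m}" using pos_inj by (auto intro: inj_onI)
        moreover have "{\<sigma> (2 * l), \<sigma> (2 * l + 1)} \<subseteq> {..<2 * ?m}" "{2 * l', 2 * l' + 1} \<subseteq> {..<2 * ?m}"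
          using in_range[OF r(1)] in_range[OF r(2)] l' by auto
        ultimately have "{\<sigma> (2 * l), \<sigma> (2 * l + 1)} = {2 * l', 2 * l' + 1}"
          by (simp only: inj_on_image_eq_iff)
        then show ?thesis using l'(1) by auto
      qed
      then show False using \<sigma> by (auto simp: H_def)
    qed
    then have "S - T \<sigma> \<noteq> {}" using cardT finT card_subset_eq[of "T \<sigma>" S] by auto
    then have "Max (arc_length ` (S - T \<sigma>)) \<in> arc_length ` (S - T \<sigma>)"
      using finS by (intro Max_in) auto
    then obtain a where "a \<in> S - T \<sigma>" "arc_length a = Max (arc_length ` (S - T \<sigma>))" by auto
    then have a: "a \<in> S - T \<sigma>" "\<And>b. b \<in> S - T \<sigma> \<Longrightarrow> arc_length b \<le> arc_length a"
      using finS by auto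
    have shorter: "arc_length b < arc_length a" if b: "b \<in> T \<sigma> - S" for b
    proof -
      obtain l where l: "l < ?m" "b = A \<sigma> l" using b by (auto simp: T_def)
      have inside: "fst a \<le> pos (\<sigma> x) \<and> pos (\<sigma> x) \<le> snd a" if x: "x \<in> {2 * l, 2 * l + 1}" for x
      proof -
        let ?c = "\<alpha> (\<sigma> x div 2)"
        have x': "\<sigma> x < 2 * ?m" using x l(1) by (intro in_range) auto
        have cS: "?c \<in> S" using x' by (intro \<alpha>S) auto
        have e: "pos (\<sigma> x) \<in> {fst ?c, snd ?c}" by (rule pos_end)
        have "?c \<notin> T \<sigma>"
        proof
          assume "?c \<in> T \<sigma>"
          then obtain l' where l': "l' < ?m" "?c = A \<sigma> l'" by (auto simp: T_def)
          have "pos (\<sigma> x) \<in> {fst (A \<sigma> l), snd (A \<sigma> l)}" unfolding ends using x by auto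
          then have "l = l'" using common[OF l(1) l'(1)] e l'(2) by simp
          then show False using b l l' cS by simp
        qed
        then have "fst a \<le> fst ?c \<and> snd ?c \<le> snd a"
          using a cS by (intro strictly_nested_inside[OF S(2)]) auto
        moreover have "fst ?c < snd ?c" using arcs[OF cS] by simp
        ultimately show ?thesis using e unfolding insert_iff empty_iff by (elim disjE) simp_all
      qed
      have "fst b \<in> {pos (\<sigma> (2 * l)), pos (\<sigma> (2 * l + 1))}" "snd b \<in> {pos (\<sigma> (2 * l)), pos (\<sigma> (2 * l + 1))}"
        unfolding l(2) ends[symmetric] by simp_all
      then have "fst a \<le> fst b" "snd b \<le> snd a" using inside by auto
      moreover have "b \<noteq> a" using a b by auto
      moreover have "fst b < snd b" using A_arc l by auto
      ultimately show ?thesis by (cases a; cases b) auto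
    qed
    define E where "E = R + mset_set (T \<sigma>)"
    have "(E, D) \<in> shorter"
      unfolding E_def by (subst DR) (rule shorter_exchange[OF finS finT a(1) shorter])
    moreover have "size E = size D" using cardT by (simp add: E_def DR)
    moreover have "arc_diagram n E"
    proof -
      have "set_mset R \<subseteq> set_mset D" by (simp add: R_def set_mset_mono)
      moreover have "T \<sigma> \<subseteq> {(i, j). 1 \<le> i \<and> i < j \<and> j \<le> n}"
        unfolding T_def using A_arc by (intro image_subsetI) (simp add: case_prod_beta)
      moreover have "set_mset E = set_mset R \<union> T \<sigma>" using finT by (simp add: E_def)
      ultimately show ?thesis using D unfolding arc_diagram_def by blast
    qed
    ultimately have E: "diagram_function \<omega> E \<in> diagram_function \<omega> ` {E. arc_diagram n E \<and> size E = size D \<and> (E, D) \<in> shorter}"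
      by auto
    define c where "c = of_int (sign \<sigma>) * (\<Prod>l<?m. if pos (\<sigma> (2 * l)) < pos (\<sigma> (2 * l + 1)) then 1 else (-1 :: complex))"
    have "diagram_function \<omega> R v * F \<sigma> v = c * diagram_function \<omega> E v" for v
    proof -
      have "(\<Prod>l<?m. case A \<sigma> l of (i, j) \<Rightarrow> \<omega> (v i) (v j)) = (\<Prod>(i, j)\<in>T \<sigma>. \<omega> (v i) (v j))"
        unfolding T_def by (subst prod.reindex[OF injA]) simp
      moreover have "(\<Prod>l<?m. \<omega> (v (pos (\<sigma> (2 * l)))) (v (pos (\<sigma> (2 * l + 1)))))
        = (\<Prod>l<?m. (if pos (\<sigma> (2 * l)) < pos (\<sigma> (2 * l + 1)) then 1 else -1)
            * (case A \<sigma> l of (i, j) \<Rightarrow> \<omega> (v i) (v j)))"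
        unfolding A_def by (intro prod.cong refl form_sort_arc)
      ultimately have "F \<sigma> v = c * (\<Prod>(i, j)\<in>T \<sigma>. \<omega> (v i) (v j))"
        unfolding F_def c_def by (simp only: prod.distrib mult.assoc)
      then have "F \<sigma> v = c * diagram_function \<omega> (mset_set (T \<sigma>)) v"
        by (simp only: diagram_function_def prod_unfold_prod_mset)
      then show ?thesis by (simp add: E_def diagram_function_union)
    qed
    then show ?thesis using fun_vs.span_base[OF E] by (simp add: span_fun_scale)
  qed
  have "id \<in> H" by (auto simp: H_def permutes_id)
  have "H \<subseteq> {\<sigma>. \<sigma> permutes {..<2 * ?m}}" by (auto simp: H_def)
  then have finH: "finite H" using finP finite_subset by auto
  with \<open>id \<in> H\<close> have cardH: "card H > 0" by (auto simp: card_gt_0_iff)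
  have "diagram_function \<omega> D v = (- 1 / of_nat (card H)) *
      (\<Sum>\<sigma>\<in>{\<sigma>. \<sigma> permutes {..<2 * ?m}} - H. diagram_function \<omega> R v * F \<sigma> v)" for v
  proof -
    have "0 = diagram_function \<omega> R v * (\<Sum>\<sigma> | \<sigma> permutes {..<2 * ?m}. F \<sigma> v)" using sum0 by simp
    also have "(\<Sum>\<sigma> | \<sigma> permutes {..<2 * ?m}. F \<sigma> v)
      = (\<Sum>\<sigma>\<in>{\<sigma>. \<sigma> permutes {..<2 * ?m}} - H. F \<sigma> v) + (\<Sum>\<sigma>\<in>H. F \<sigma> v)"
      by (rule sum.subset_diff) (use finP in \<open>auto simp: H_def\<close>)
    also have "(\<Sum>\<sigma>\<in>H. F \<sigma> v) = of_nat (card H) * diagram_function \<omega> (mset_set S) v"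
      by (simp add: FH)
    finally have "of_nat (card H) * diagram_function \<omega> D v
      = - (\<Sum>\<sigma>\<in>{\<sigma>. \<sigma> permutes {..<2 * ?m}} - H. diagram_function \<omega> R v * F \<sigma> v)"
      by (subst DR) (simp add: diagram_function_union eq_neg_iff_add_eq_0 sum_distrib_left algebra_simps)
    then show ?thesis using cardH by (simp add: field_simps)
  qed
  then have "diagram_function \<omega> D = (\<lambda>v. (- 1 / of_nat (card H)) *
      (\<Sum>\<sigma>\<in>{\<sigma>. \<sigma> permutes {..<2 * ?m}} - H. diagram_function \<omega> R v * F \<sigma> v))" by (rule ext)
  also have "\<dots> \<in> fun_vs.span (diagram_function \<omega> `
    {E. arc_diagram n E \<and> size E = size D \<and> (E, D) \<in> shorter})"
    by (intro span_fun_scale span_fun_sum not_H) auto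
  finally show ?thesis .
qed

theorem straightening:
  assumes "arc_diagram n D"
  shows "diagram_function \<omega> D \<in> fun_vs.span (diagram_function \<omega> ` admissible_diagrams k n (2 * size D))"
  using assms
proof (induction D rule: wf_induct_rule[OF wf_shorter])
  case (1 D)
  show ?case
  proof (cases "D \<in> admissible_diagrams k n (2 * size D)")
    case True
    then show ?thesis by (intro fun_vs.span_base imageI)
  next
    case False
    then obtain S where S: "S \<subseteq> set_mset D" "strict_nesting S" "card S > k"
      using 1 total_degree_eq[of n D] by (auto simp: admissible_diagrams_def not_le)
    then obtain S' where S': "S' \<subseteq> S" "card S' = Suc k"
      by (meson Suc_leI obtain_subset_with_card_n)
    moreover have "strict_nesting S'" using S(2) S'(1) unfolding strict_nesting_def by blast
    ultimately have "diagram_function \<omega> D \<in> fun_vs.span (diagram_function \<omega> `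
        {E. arc_diagram n E \<and> size E = size D \<and> (E, D) \<in> shorter})"
      using S(1) 1 by (intro straightening_step[of n D S']) auto
    also have "\<dots> \<subseteq> fun_vs.span (diagram_function \<omega> ` admissible_diagrams k n (2 * size D))"
      using 1 by (intro fun_vs.span_minimal fun_vs.subspace_span) force
    finally show ?thesis .
  qed
qed

end

section \<open>Linear independence of the admissible diagrams\<close>

text \<open>
  The multiplicity of \<open>(i, j)\<close> is the mixed second difference of the counts of the pairs above
  \<open>(s, t)\<close>.
\<close>

lemma mset_eq_from_upper_counts:
  fixes X Y :: "(nat \<times> nat) multiset"
  assumes "\<And>s t. size {#p \<in># X. s \<le> fst p \<and> t \<le> snd p#} = size {#p \<in># Y. s \<le> fst p \<and> t \<le> snd p#}"
  shows "X = Y"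
proof (rule multiset_eqI)
  fix p :: "nat \<times> nat"
  let ?N = "\<lambda>Z s t. size {#p \<in># Z. s \<le> fst p \<and> t \<le> snd p#}"
  have "count Z (i, j) + ?N Z (Suc i) j + ?N Z i (Suc j) = ?N Z i j + ?N Z (Suc i) (Suc j)" for Z i j
  proof (induction Z)
    case (add q Z)
    obtain a b where q: "q = (a, b)" by (cases q)
    show ?case using add by (auto simp: q not_le less_Suc_eq_le Suc_le_eq)
  qed simp
  from this[of X "fst p" "snd p"] this[of Y "fst p" "snd p"] show "count X p = count Y p"
    using assms by simp
qed

lemma product_as_upper_counts:
  fixes p q :: "'a \<Rightarrow> nat"
  assumes "finite A" and "\<And>l. l \<in> A \<Longrightarrow> p l \<le> M \<and> q l \<le> M"
  shows "(\<Sum>l\<in>A. p l * q l) = (\<Sum>s=1..M. \<Sum>t=1..M. card {l \<in> A. s \<le> p l \<and> t \<le> q l})"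
proof -
  have "(\<Sum>s=1..M. \<Sum>t=1..M. card {l \<in> A. s \<le> p l \<and> t \<le> q l})
    = (\<Sum>s=1..M. \<Sum>t=1..M. \<Sum>l\<in>A. if s \<le> p l \<and> t \<le> q l then 1 else 0)"
    using assms(1) by (simp add: sum.inter_filter[symmetric])
  also have "\<dots> = (\<Sum>s=1..M. \<Sum>l\<in>A. \<Sum>t=1..M. if s \<le> p l \<and> t \<le> q l then 1 else 0)"
    by (intro sum.cong refl sum.swap)
  also have "\<dots> = (\<Sum>l\<in>A. \<Sum>s=1..M. \<Sum>t=1..M. if s \<le> p l \<and> t \<le> q l then 1 else 0)"
    by (rule sum.swap)
  also have "\<dots> = (\<Sum>l\<in>A. p l * q l)"
  proof (rule sum.cong[OF refl])
    fix l assume l: "l \<in> A"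
    have c: "(\<Sum>t=1..M. if t \<le> x then 1 else 0) = x" if "x \<le> M" for x :: nat
    proof -
      have "{t \<in> {1..M}. t \<le> x} = {1..x}" using that by auto
      then show ?thesis by (simp add: sum.inter_filter[symmetric])
    qed
    have "(\<Sum>s=1..M. \<Sum>t=1..M. if s \<le> p l \<and> t \<le> q l then 1 else 0)
      = (\<Sum>s=1..M. (if s \<le> p l then 1 else 0 :: nat) * (\<Sum>t=1..M. if t \<le> q l then 1 else 0))"
      unfolding sum_distrib_left by (intro sum.cong refl) auto
    also have "\<dots> = p l * q l"
      using assms(2)[OF l] c[of "p l"] c[of "q l"] by (simp add: sum_distrib_right[symmetric])
    finally show "(\<Sum>s=1..M. \<Sum>t=1..M. if s \<le> p l \<and> t \<le> q l then 1 else 0) = p l * q l" .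
  qed
  finally show ?thesis by simp
qed

text \<open>
  The rearrangement inequality, with its case of equality, for pairs that may be rematched within
  colour classes. Instead of the products themselves it compares, for all thresholds \<open>s, t\<close>, the
  number of pairs with first entry at least \<open>s\<close> and second entry at least \<open>t\<close>. A colour class is a
  chain, so the originally matched pairs attain the obvious upper bound, the smaller of the numbers
  for the two single conditions. In the case of equality all these counts agree, and they determine
  the multiset of pairs.
\<close>

lemma rearrangement:
  fixes p q :: "nat \<Rightarrow> nat" and c :: "nat \<Rightarrow> 'c"
  assumes chain: "\<And>l l'. l < N \<Longrightarrow> l' < N \<Longrightarrow> c l = c l' \<Longrightarrow>
      (p l \<le> p l' \<and> q l \<le> q l') \<or> (p l' \<le> p l \<and> q l' \<le> q l)"
    and bij: "bij_betw \<rho> {..<N} {..<N}" "bij_betw \<tau> {..<N} {..<N}"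
    and col: "\<And>r. r < N \<Longrightarrow> c (\<rho> r) = c (\<tau> r)"
    and pos: "\<And>l. l < N \<Longrightarrow> 1 \<le> p l \<and> 1 \<le> q l"
  shows "(\<Sum>r<N. p (\<rho> r) * q (\<tau> r)) \<le> (\<Sum>l<N. p l * q l)"
    and "(\<Sum>r<N. p (\<rho> r) * q (\<tau> r)) = (\<Sum>l<N. p l * q l) \<Longrightarrow>
      {#(p (\<rho> r), q (\<tau> r)). r \<in># mset_set {..<N}#} = {#(p l, q l). l \<in># mset_set {..<N}#}"
proof -
  let ?n' = "\<lambda>s t. card {r \<in> {..<N}. s \<le> p (\<rho> r) \<and> t \<le> q (\<tau> r)}"
  let ?n = "\<lambda>s t. card {l \<in> {..<N}. s \<le> p l \<and> t \<le> q l}"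
  have \<rho>: "\<rho> r < N" "\<tau> r < N" if "r < N" for r using bij that by (auto simp: bij_betw_def)
  have inj: "inj_on \<rho> {..<N}" "inj_on \<tau> {..<N}" using bij by (auto simp: bij_betw_def)
  have le: "?n' s t \<le> ?n s t" for s t
  proof -
    let ?X = "{r \<in> {..<N}. s \<le> p (\<rho> r) \<and> t \<le> q (\<tau> r)}" and ?Y = "{l \<in> {..<N}. s \<le> p l \<and> t \<le> q l}"
    \<comment> \<open>in a chain one of the two conditions implies the other one, so only one of them has to be counted\<close>
    have fibre: "card {r \<in> ?X. c (\<rho> r) = \<gamma>} \<le> card {l \<in> ?Y. c l = \<gamma>}" for \<gamma>
    proof (cases "\<forall>l<N. c l = \<gamma> \<longrightarrow> s \<le> p l \<longrightarrow> t \<le> q l")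
      case True
      have "inj_on \<rho> {r \<in> ?X. c (\<rho> r) = \<gamma>}" by (rule inj_on_subset[OF inj(1)]) auto
      moreover have "\<rho> ` {r \<in> ?X. c (\<rho> r) = \<gamma>} \<subseteq> {l \<in> ?Y. c l = \<gamma>}" using True \<rho> by auto
      ultimately show ?thesis by (rule card_inj_on_le) simp
    next
      case False
      then obtain l where l: "l < N" "c l = \<gamma>" "s \<le> p l" "\<not> t \<le> q l" by auto
      have up: "s \<le> p l'" if "l' < N" "c l' = \<gamma>" "t \<le> q l'" for l'
        using chain[of l l'] l that by auto
      have "inj_on \<tau> {r \<in> ?X. c (\<rho> r) = \<gamma>}" by (rule inj_on_subset[OF inj(2)]) auto
      moreover have "\<tau> ` {r \<in> ?X. c (\<rho> r) = \<gamma>} \<subseteq> {l \<in> ?Y. c l = \<gamma>}" using up \<rho> col by auto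
      ultimately show ?thesis by (rule card_inj_on_le) simp
    qed
    have sub: "(\<lambda>r. c (\<rho> r)) ` ?X \<subseteq> c ` {..<N}" using \<rho> by auto
    have "card ?X = (\<Sum>\<gamma>\<in>c ` {..<N}. card {r \<in> ?X. c (\<rho> r) = \<gamma>})"
      using sum.group[of ?X "c ` {..<N}" "\<lambda>r. c (\<rho> r)" "\<lambda>_. 1 :: nat"] sub by simp
    also have "\<dots> \<le> (\<Sum>\<gamma>\<in>c ` {..<N}. card {l \<in> ?Y. c l = \<gamma>})" by (intro sum_mono fibre)
    also have "\<dots> = card ?Y"
      using sum.group[of ?Y "c ` {..<N}" c "\<lambda>_. 1 :: nat"] by auto
    finally show ?thesis .
  qed
  define M where "M = Max (insert 0 (p ` {..<N} \<union> q ` {..<N}))"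
  have M: "p l \<le> M" "q l \<le> M" if "l < N" for l
    using that by (auto simp: M_def intro!: Max_ge)
  have s': "(\<Sum>r<N. p (\<rho> r) * q (\<tau> r)) = (\<Sum>s=1..M. \<Sum>t=1..M. ?n' s t)"
    using M \<rho> by (intro product_as_upper_counts) auto
  have s: "(\<Sum>l<N. p l * q l) = (\<Sum>s=1..M. \<Sum>t=1..M. ?n s t)"
    using M by (intro product_as_upper_counts) auto
  show "(\<Sum>r<N. p (\<rho> r) * q (\<tau> r)) \<le> (\<Sum>l<N. p l * q l)"
    unfolding s s' by (intro sum_mono le)
  assume eq: "(\<Sum>r<N. p (\<rho> r) * q (\<tau> r)) = (\<Sum>l<N. p l * q l)"
  have inner: "(\<Sum>t=1..M. ?n' s t) = (\<Sum>t=1..M. ?n s t)" if "s \<in> {1..M}" for s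
    by (rule sum_mono_inv[OF eq[unfolded s s'] _ that]) (intro sum_mono le, simp)
  have same: "?n' s t = ?n s t" if "s \<in> {1..M}" "t \<in> {1..M}" for s t
    by (rule sum_mono_inv[OF inner[OF that(1)] _ that(2)]) (rule le, simp)
  have all: "?n' s t = ?n s t" for s t
  proof (cases "s \<le> M \<and> t \<le> M")
    case False
    have none: "\<not> (s \<le> p l \<and> t \<le> q l')" if "l < N" "l' < N" for l l'
      using False M(1)[OF that(1)] M(2)[OF that(2)] by auto
    have "{r \<in> {..<N}. s \<le> p (\<rho> r) \<and> t \<le> q (\<tau> r)} = {}" using none[OF \<rho>] by blast
    moreover have "{l \<in> {..<N}. s \<le> p l \<and> t \<le> q l} = {}" using none by blast
    ultimately show ?thesis by (simp only:)
  next
    case True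
    show ?thesis
    proof (cases "N = 0")
      case False
      have "M \<ge> 1" using M[of 0] pos[of 0] False by auto
      then have "?n' (max 1 s) (max 1 t) = ?n (max 1 s) (max 1 t)" using True by (intro same) auto
      moreover have "{r \<in> {..<N}. max 1 s \<le> p (\<rho> r) \<and> max 1 t \<le> q (\<tau> r)} = {r \<in> {..<N}. s \<le> p (\<rho> r) \<and> t \<le> q (\<tau> r)}"
        using pos \<rho> by auto
      moreover have "{l \<in> {..<N}. max 1 s \<le> p l \<and> max 1 t \<le> q l} = {l \<in> {..<N}. s \<le> p l \<and> t \<le> q l}"
        using pos by auto
      ultimately show ?thesis by simp
    qed simp
  qed
  show "{#(p (\<rho> r), q (\<tau> r)). r \<in># mset_set {..<N}#} = {#(p l, q l). l \<in># mset_set {..<N}#}"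
    by (rule mset_eq_from_upper_counts) (use all in \<open>simp add: filter_mset_image_mset\<close>)
qed

text \<open>
  The colour of \<open>a\<close> is one less than the largest size of a nesting with outermost arc \<open>a\<close>; an arc
  strictly around \<open>a\<close> has a larger colour.
\<close>

lemma nesting_colouring:
  assumes D: "D \<in> admissible_diagrams k n d"
  obtains col :: "arc \<Rightarrow> nat" where "\<And>a. a \<in># D \<Longrightarrow> col a < k"
    and "\<And>a b. a \<in># D \<Longrightarrow> b \<in># D \<Longrightarrow> col a = col b \<Longrightarrow> \<not> strictly_nested a b"
proof -
  define inside where "inside b a \<longleftrightarrow> fst a < fst b \<and> snd b < snd a" for a b :: arc
  define \<N> where "\<N> a = {S. S \<subseteq> set_mset D \<and> strict_nesting S \<and> a \<in> S \<and> (\<forall>b\<in>S. b = a \<or> inside b a)}" for a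
  define h where "h a = Max (card ` \<N> a)" for a
  have arc: "fst a < snd a" if "a \<in># D" for a
    using that D by (auto simp: admissible_diagrams_def arc_diagram_def)
  have fin: "finite (\<N> a)" for a
    by (rule finite_subset[of _ "Pow (set_mset D)"]) (auto simp: \<N>_def)
  have single: "{a} \<in> \<N> a" if "a \<in># D" for a using that by (auto simp: \<N>_def strict_nesting_def)
  have hk: "1 \<le> h a" "h a \<le> k" if "a \<in># D" for a
  proof -
    have "card {a} \<le> h a" unfolding h_def by (intro Max_ge finite_imageI fin imageI single that)
    then show "1 \<le> h a" by simp
    show "h a \<le> k"
      unfolding h_def using fin single[OF that] D
      by (subst Max_le_iff) (auto simp: \<N>_def admissible_diagrams_def)
  qed
  have less: "h a < h b" if ab: "a \<in># D" "b \<in># D" "inside a b" for a b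
  proof -
    have "h a \<in> card ` \<N> a" unfolding h_def using single[OF ab(1)] fin by (intro Max_in) auto
    then obtain S where S: "S \<in> \<N> a" "h a = card S" by auto
    have inb: "inside x b" if "x \<in> S" for x using S(1) that ab(3) by (auto simp: \<N>_def inside_def)
    have "b \<notin> S" using inb[of b] by (auto simp: inside_def)
    have nest: "strictly_nested b x" "strictly_nested x b" if "x \<in> S" for x
    proof -
      have "x \<in># D" using S(1) that by (auto simp: \<N>_def)
      then show "strictly_nested b x" "strictly_nested x b"
        using inb[OF that] arc by (auto simp: strictly_nested_def inside_def split: prod.splits)
    qed
    have "insert b S \<in> \<N> b"
      using S(1) ab inb nest by (auto simp: \<N>_def strict_nesting_def)
    then have "card (insert b S) \<le> h b" unfolding h_def using fin by (intro Max_ge) auto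
    moreover have "finite S" using S(1) by (auto simp: \<N>_def intro: finite_subset)
    ultimately show ?thesis using S(2) \<open>b \<notin> S\<close> by simp
  qed
  show thesis
  proof (rule that[of "\<lambda>a. h a - 1"])
    fix a assume "a \<in># D"
    then show "h a - 1 < k" using hk[of a] by auto
  next
    fix a b assume ab: "a \<in># D" "b \<in># D" "h a - 1 = h b - 1"
    then have "h a = h b" using hk[of a] hk[of b] by auto
    then have "\<not> inside a b" "\<not> inside b a" using less[of a b] less[of b a] ab by auto
    then show "\<not> strictly_nested a b" by (auto simp: strictly_nested_def inside_def split: prod.splits)
  qed
qed

text \<open>
  Numbers the arc ends such that the left end of the \<open>r\<close>-th arc is \<open>2 * r\<close> and its right end
  \<open>2 * r + 1\<close>.
\<close>

definition endpoint :: "arc list \<Rightarrow> nat \<Rightarrow> nat" where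
  "endpoint L x = (if even x then fst (L ! (x div 2)) else snd (L ! (x div 2)))"

lemma endpoint_simps [simp]:
  "endpoint L (2 * r) = fst (L ! r)" "endpoint L (Suc (2 * r)) = snd (L ! r)"
  by (simp_all add: endpoint_def)

lemma prod_mset_mset_nth: "(\<Prod>a\<in>#mset L. f a) = (\<Prod>r<length L. f (L ! r))"
proof -
  have "(\<Prod>a\<in>#mset L. f a) = prod_list (map f L)" by (simp flip: prod_mset_prod_list)
  then show ?thesis by (simp add: prod.list_conv_set_nth lessThan_atLeast0)
qed

lemma diagram_function_mset:
  "diagram_function \<omega> (mset L) v
    = (\<Prod>r<length L. \<omega> (v (endpoint L (2 * r))) (v (endpoint L (2 * r + 1))))"
  unfolding diagram_function_def prod_mset_mset_nth by (simp add: case_prod_beta)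

definition product_weight :: "arc multiset \<Rightarrow> nat" where
  "product_weight D = (\<Sum>(i, j)\<in>#D. i * j)"

lemma product_weight_mset: "product_weight (mset L) = (\<Sum>r<length L. fst (L ! r) * snd (L ! r))"
proof -
  have "product_weight (mset L) = sum_list (map (\<lambda>(i, j). i * j) L)"
    unfolding product_weight_def by (simp flip: sum_mset_sum_list)
  then show ?thesis by (simp add: sum.list_conv_set_nth lessThan_atLeast0 case_prod_beta)
qed

lemma mset_nth: "mset L = {#L ! r. r \<in># mset_set {..<length L}#}"
  by (metis map_nth mset_map mset_upt atLeast0LessThan)

context symplectic_space
begin

text \<open>
  The vector placed at the arc end \<open>x\<close>: the first member of the hyperbolic pair of the colour for
  left ends, the second one for right ends.
\<close>

definition colour_vector :: "(arc \<Rightarrow> nat) \<Rightarrow> arc list \<Rightarrow> nat \<Rightarrow> 'v" where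
  "colour_vector col L x = bas (2 * col (L ! (x div 2)) + x mod 2)"

lemma form_colour_vector:
  assumes "col (L ! (x div 2)) < k" and "col (L ! (y div 2)) < k"
  shows "\<omega> (colour_vector col L x) (colour_vector col L y)
    = (if col (L ! (x div 2)) = col (L ! (y div 2)) then
         if even x \<and> odd y then 1 else if odd x \<and> even y then -1 else 0
       else 0)"
proof -
  let ?c = "col (L ! (x div 2))" and ?d = "col (L ! (y div 2))"
  have "2 * ?c + x mod 2 < 2 * k" "2 * ?d + y mod 2 < 2 * k" using assms by auto
  then have "\<omega> (colour_vector col L x) (colour_vector col L y)
    = (if even (2 * ?c + x mod 2) \<and> 2 * ?d + y mod 2 = Suc (2 * ?c + x mod 2) then 1
       else if even (2 * ?d + y mod 2) \<and> 2 * ?c + x mod 2 = Suc (2 * ?d + y mod 2) then -1 else 0)"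
    unfolding colour_vector_def by (rule bas_form)
  also have "\<dots> = (if ?c = ?d then if even x \<and> odd y then 1 else if odd x \<and> even y then -1 else 0 else 0)"
  proof -
    have "x mod 2 = (if even x then 0 else 1)" "y mod 2 = (if even y then 0 else 1)" by presburger+
    moreover have "2 * ?d \<noteq> Suc (2 * ?c)" "2 * ?c \<noteq> Suc (2 * ?d)" by presburger+
    ultimately show ?thesis by auto
  qed
  finally show ?thesis .
qed

text \<open>
  The coefficient of the monomial of \<open>L\<close> in the function of \<open>K\<close> is a polarization, hence by
  \<open>polarization_multilinear\<close> a sum over bijections \<open>t\<close>. This is the term of \<open>t\<close>, which takes the
  vector for the arc end \<open>x\<close> of \<open>K\<close> from the arc end \<open>t x\<close> of \<open>L\<close>.
\<close>

definition colour_term :: "(arc \<Rightarrow> nat) \<Rightarrow> arc list \<Rightarrow> arc list \<Rightarrow> (nat \<Rightarrow> nat) \<Rightarrow> complex" where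
  "colour_term col L K t = (\<Prod>r<length K.
     \<omega> (if endpoint L (t (2 * r)) = endpoint K (2 * r) then colour_vector col L (t (2 * r)) else 0)
       (if endpoint L (t (2 * r + 1)) = endpoint K (2 * r + 1) then colour_vector col L (t (2 * r + 1)) else 0))"

lemma colour_coefficient:
  "polarization (2 * length K) (diagram_function \<omega> (mset K)) (endpoint L) (colour_vector col L)
    = (\<Sum>t | t \<in> {..<2 * length K} \<rightarrow>\<^sub>E {..<2 * length K} \<and> t ` {..<2 * length K} = {..<2 * length K}.
        colour_term col L K t)"
  unfolding diagram_function_mset[abs_def] colour_term_def
  using polarization_multilinear[OF multilinear_on_standard_matching, of "length K" "endpoint K" "endpoint L"
      "colour_vector col L"]
  by simp

text \<open>
  If the term is nonzero, \<open>t\<close> matches each left end of \<open>L\<close> with a right end of the same colour, and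
  \<open>K\<close> consists of the arcs between matched ends. So \<open>rearrangement\<close> applies. In the case of equality
  each pair is also oriented from a left to a right end, and no factor \<open>-1\<close> occurs.
\<close>

lemma colour_term_nonzero:
  assumes L: "arc_diagram n (mset L)" and K: "arc_diagram n (mset K)" and len: "length K = length L"
    and col: "\<And>a. a \<in> set L \<Longrightarrow> col a < k"
    and colour_class: "\<And>a b. a \<in> set L \<Longrightarrow> b \<in> set L \<Longrightarrow> col a = col b \<Longrightarrow> \<not> strictly_nested a b"
    and t: "t ` {..<2 * length L} = {..<2 * length L}"
    and nz: "colour_term col L K t \<noteq> 0"
  shows "product_weight (mset K) \<le> product_weight (mset L)"
    and "product_weight (mset K) = product_weight (mset L) \<Longrightarrow> mset K = mset L \<and> colour_term col L K t = 1"
proof -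
  let ?N = "length L"
  have arcL: "1 \<le> fst (L ! l)" "fst (L ! l) < snd (L ! l)" if "l < ?N" for l
    using L nth_mem[OF that] by (auto simp: arc_diagram_def)
  have arcK: "fst (K ! r) < snd (K ! r)" if "r < ?N" for r
  proof -
    have "K ! r \<in> set K" using that len by simp
    then show ?thesis using K by (auto simp: arc_diagram_def)
  qed
  have t_less: "t x < 2 * ?N" if "x < 2 * ?N" for x using t that by auto
  have t_div: "t x div 2 < ?N" if "x < 2 * ?N" for x using t_less[OF that] by auto
  have t_inj: "inj_on t {..<2 * ?N}" using t by (simp add: eq_card_imp_inj_on)
  have colL: "col (L ! (t x div 2)) < k" if "x < 2 * ?N" for x using t_div[OF that] col by auto
  have fac: "endpoint L (t (2 * r)) = fst (K ! r)" "endpoint L (t (2 * r + 1)) = snd (K ! r)"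
      "\<omega> (colour_vector col L (t (2 * r))) (colour_vector col L (t (2 * r + 1))) \<noteq> 0" if "r < ?N" for r
  proof -
    have "\<omega> (if endpoint L (t (2 * r)) = endpoint K (2 * r) then colour_vector col L (t (2 * r)) else 0)
       (if endpoint L (t (2 * r + 1)) = endpoint K (2 * r + 1) then colour_vector col L (t (2 * r + 1)) else 0) \<noteq> 0"
      using nz that len unfolding colour_term_def by (subst (asm) prod_zero_iff) auto
    then show "endpoint L (t (2 * r)) = fst (K ! r)" "endpoint L (t (2 * r + 1)) = snd (K ! r)"
      "\<omega> (colour_vector col L (t (2 * r))) (colour_vector col L (t (2 * r + 1))) \<noteq> 0"
      by (auto split: if_splits)
  qed
  have form: "\<omega> (colour_vector col L (t (2 * r))) (colour_vector col L (t (2 * r + 1)))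
    = (if col (L ! (t (2 * r) div 2)) = col (L ! (t (2 * r + 1) div 2)) then
         if even (t (2 * r)) \<and> odd (t (2 * r + 1)) then 1
         else if odd (t (2 * r)) \<and> even (t (2 * r + 1)) then -1 else 0 else 0)" if "r < ?N" for r
    using that by (intro form_colour_vector colL) auto
  have colours: "col (L ! (t (2 * r) div 2)) = col (L ! (t (2 * r + 1) div 2))"
    and parity: "even (t (2 * r)) \<longleftrightarrow> odd (t (2 * r + 1))" if "r < ?N" for r
    using fac(3)[OF that] unfolding form[OF that] by (auto split: if_splits)
  \<comment> \<open>the arcs of \<open>L\<close> that supply the left end and the right end for the \<open>r\<close>-th arc of \<open>K\<close>\<close>
  define \<rho> where "\<rho> r = (if even (t (2 * r)) then t (2 * r) else t (2 * r + 1)) div 2" for r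
  define \<tau> where "\<tau> r = (if even (t (2 * r)) then t (2 * r + 1) else t (2 * r)) div 2" for r
  have \<rho>_t: "2 * \<rho> r \<in> {t (2 * r), t (2 * r + 1)}" and \<tau>_t: "Suc (2 * \<tau> r) \<in> {t (2 * r), t (2 * r + 1)}" if "r < ?N" for r
    using parity[OF that] by (auto simp: \<rho>_def \<tau>_def elim!: evenE oddE)
  have same: "r = r'" if r: "r < ?N" "r' < ?N" and x: "x \<in> {t (2 * r), t (2 * r + 1)}" "x \<in> {t (2 * r'), t (2 * r' + 1)}" for r r' x
  proof -
    obtain y y' where y: "y \<in> {2 * r, 2 * r + 1}" "y' \<in> {2 * r', 2 * r' + 1}" "t y = t y'" using x by blast
    have "y < 2 * ?N" using y(1) r(1) by auto
    moreover have "y' < 2 * ?N" using y(2) r(2) by auto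
    ultimately have "y = y'" using t_inj y(3) by (auto dest: inj_onD)
    then have "(y = 2 * r \<or> y = 2 * r + 1) \<and> (y = 2 * r' \<or> y = 2 * r' + 1)" using y(1,2) by simp
    then show ?thesis by presburger
  qed
  have bij: "bij_betw \<rho> {..<?N} {..<?N}" "bij_betw \<tau> {..<?N} {..<?N}"
  proof -
    have "inj_on \<rho> {..<?N}" using same \<rho>_t by (intro inj_onI) (metis lessThan_iff)
    moreover have "inj_on \<tau> {..<?N}" using same \<tau>_t by (intro inj_onI) (metis lessThan_iff)
    moreover have "\<rho> ` {..<?N} \<subseteq> {..<?N}" "\<tau> ` {..<?N} \<subseteq> {..<?N}"
      using t_div by (auto simp: \<rho>_def \<tau>_def)
    ultimately show "bij_betw \<rho> {..<?N} {..<?N}" "bij_betw \<tau> {..<?N} {..<?N}"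
      by (auto simp: bij_betw_def endo_inj_surj)
  qed
  have ends: "(fst (K ! r), snd (K ! r)) = (if even (t (2 * r)) then (fst (L ! \<rho> r), snd (L ! \<tau> r)) else (snd (L ! \<tau> r), fst (L ! \<rho> r)))"
    if "r < ?N" for r
    using fac(1,2)[OF that] parity[OF that] by (auto simp: endpoint_def \<rho>_def \<tau>_def)
  have weight: "product_weight (mset K) = (\<Sum>r<?N. fst (L ! \<rho> r) * snd (L ! \<tau> r))"
    unfolding product_weight_mset len
  proof (rule sum.cong[OF refl])
    fix r assume "r \<in> {..<?N}"
    then show "fst (K ! r) * snd (K ! r) = fst (L ! \<rho> r) * snd (L ! \<tau> r)"
      using ends[of r] by (auto split: if_splits)
  qed
  have chain: "(fst (L ! l) \<le> fst (L ! l') \<and> snd (L ! l) \<le> snd (L ! l')) \<or> (fst (L ! l') \<le> fst (L ! l) \<and> snd (L ! l') \<le> snd (L ! l))"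
    if l: "l < ?N" "l' < ?N" "col (L ! l) = col (L ! l')" for l l'
    using colour_class[of "L ! l" "L ! l'"] l arcL[of l] arcL[of l']
    by (auto simp: strictly_nested_def case_prod_beta)
  have cols: "col (L ! \<rho> r) = col (L ! \<tau> r)" if "r < ?N" for r
    using colours[OF that] by (auto simp: \<rho>_def \<tau>_def)
  have pos: "1 \<le> fst (L ! l) \<and> 1 \<le> snd (L ! l)" if "l < ?N" for l using arcL[OF that] by auto
  note rearr = rearrangement[where c = "\<lambda>l. col (L ! l)" and p = "\<lambda>l. fst (L ! l)" and q = "\<lambda>l. snd (L ! l)"
      and N = ?N, OF chain bij cols pos]
  show "product_weight (mset K) \<le> product_weight (mset L)"
    unfolding weight unfolding product_weight_mset by (rule rearr(1)) auto
  assume "product_weight (mset K) = product_weight (mset L)"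
  then have pairs: "{#(fst (L ! \<rho> r), snd (L ! \<tau> r)). r \<in># mset_set {..<?N}#} = {#(fst (L ! l), snd (L ! l)). l \<in># mset_set {..<?N}#}"
    unfolding weight unfolding product_weight_mset by (intro rearr(2)) auto
  have less: "fst (L ! \<rho> r) < snd (L ! \<tau> r)" if "r < ?N" for r
  proof -
    have "(fst (L ! \<rho> r), snd (L ! \<tau> r)) \<in># {#(fst (L ! \<rho> r), snd (L ! \<tau> r)). r \<in># mset_set {..<?N}#}"
      using that by auto
    then obtain l where "l < ?N" "fst (L ! \<rho> r) = fst (L ! l)" "snd (L ! \<tau> r) = snd (L ! l)"
      unfolding pairs by (auto simp: prod_eq_iff)
    then show ?thesis using arcL(2)[of l] by simp
  qed
  have even_t: "even (t (2 * r))" if "r < ?N" for r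
    using ends[OF that] less[OF that] arcK[OF that] by (auto split: if_splits)
  have "mset K = {#(fst (L ! \<rho> r), snd (L ! \<tau> r)). r \<in># mset_set {..<?N}#}"
    unfolding mset_nth[of K] len
  proof (rule image_mset_cong)
    fix r assume "r \<in># mset_set {..<?N}"
    then have "r < ?N" by simp
    then show "K ! r = (fst (L ! \<rho> r), snd (L ! \<tau> r))" using ends[of r] even_t[of r] by (simp add: prod_eq_iff)
  qed
  also have "\<dots> = mset L" unfolding pairs prod.collapse by (rule mset_nth[symmetric])
  finally have "mset K = mset L" .
  moreover have "colour_term col L K t = 1"
    unfolding colour_term_def len
  proof (rule prod.neutral, rule ballI)
    fix r assume "r \<in> {..<?N}"
    then have r: "r < ?N" by simp
    have "\<omega> (colour_vector col L (t (2 * r))) (colour_vector col L (t (2 * r + 1))) = 1"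
      using colours[OF r] parity[OF r] even_t[OF r] unfolding form[OF r] by auto
    then show "\<omega> (if endpoint L (t (2 * r)) = endpoint K (2 * r) then colour_vector col L (t (2 * r)) else 0)
       (if endpoint L (t (2 * r + 1)) = endpoint K (2 * r + 1) then colour_vector col L (t (2 * r + 1)) else 0) = 1"
      using fac(1,2)[OF r] by simp
  qed
  ultimately show "mset K = mset L \<and> colour_term col L K t = 1" ..
qed

text \<open>
  The diagonal coefficient counts the assignments with a nonzero term, among them the identity.
\<close>

lemma colour_coefficient_self:
  assumes L: "arc_diagram n (mset L)" and col: "\<And>a. a \<in> set L \<Longrightarrow> col a < k"
    and colour_class: "\<And>a b. a \<in> set L \<Longrightarrow> b \<in> set L \<Longrightarrow> col a = col b \<Longrightarrow> \<not> strictly_nested a b"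
  shows "polarization (2 * length L) (diagram_function \<omega> (mset L)) (endpoint L) (colour_vector col L) \<noteq> 0"
proof -
  let ?I = "{..<2 * length L}"
  let ?B = "{t. t \<in> ?I \<rightarrow>\<^sub>E ?I \<and> t ` ?I = ?I}"
  let ?id = "restrict id ?I"
  have fin: "finite ?B" by (rule finite_subset[of _ "?I \<rightarrow>\<^sub>E ?I"]) (auto intro: finite_PiE)
  have one: "colour_term col L L t = 1" if "t \<in> ?B" "colour_term col L L t \<noteq> 0" for t
  proof -
    have "t ` ?I = ?I" using that(1) by simp
    from colour_term_nonzero(2)[OF L L refl col colour_class this that(2) refl] show ?thesis ..
  qed
  have "colour_term col L L ?id = 1"
    unfolding colour_term_def
  proof (rule prod.neutral, rule ballI)
    fix r assume r: "r \<in> {..<length L}"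
    then have "?id (2 * r) = 2 * r" "?id (2 * r + 1) = 2 * r + 1" by auto
    moreover have "\<omega> (colour_vector col L (2 * r)) (colour_vector col L (2 * r + 1)) = 1"
      using r col by (subst form_colour_vector) auto
    ultimately show "\<omega> (if endpoint L (?id (2 * r)) = endpoint L (2 * r) then colour_vector col L (?id (2 * r)) else 0)
       (if endpoint L (?id (2 * r + 1)) = endpoint L (2 * r + 1) then colour_vector col L (?id (2 * r + 1)) else 0) = 1"
      by simp
  qed
  moreover have "?id \<in> ?B" by auto
  ultimately have "{t \<in> ?B. colour_term col L L t \<noteq> 0} \<noteq> {}" by force
  moreover have "(\<Sum>t\<in>?B. colour_term col L L t) = (\<Sum>t\<in>{t \<in> ?B. colour_term col L L t \<noteq> 0}. 1)"
    by (rule sum.mono_neutral_cong_right) (use fin one in auto)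
  moreover have "finite {t \<in> ?B. colour_term col L L t \<noteq> 0}" using fin by (rule rev_finite_subset) auto
  ultimately show ?thesis
    unfolding colour_coefficient by (simp only: sum_constant card_eq_0_iff of_nat_eq_0_iff mult_1_right) simp
qed

text \<open>
  Stated for families rather than sets of functions, so that it also gives injectivity. In a
  vanishing combination take a diagram \<open>D0\<close> of least weight among those with nonzero coefficient:
  by \<open>colour_term_nonzero\<close> no other diagram of the combination contains the monomial of \<open>D0\<close>.
\<close>

theorem admissible_diagrams_independent:
  assumes F: "finite F" "F \<subseteq> admissible_diagrams k n d"
    and zero: "\<And>v. (\<Sum>D\<in>F. a D * diagram_function \<omega> D v) = 0"
    and D: "D \<in> F"
  shows "a D = 0"
proof (rule ccontr)
  assume "a D \<noteq> 0"
  let ?G = "{D \<in> F. a D \<noteq> 0}"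
  have "finite ?G" "?G \<noteq> {}" using F D \<open>a D \<noteq> 0\<close> by auto
  then have "Min (product_weight ` ?G) \<in> product_weight ` ?G" by (intro Min_in) auto
  then obtain D0 where "D0 \<in> ?G" "product_weight D0 = Min (product_weight ` ?G)" by auto
  then have D0: "D0 \<in> F" "a D0 \<noteq> 0" and min: "\<And>E. E \<in> F \<Longrightarrow> a E \<noteq> 0 \<Longrightarrow> product_weight D0 \<le> product_weight E"
    using \<open>finite ?G\<close> by auto
  obtain L where L: "mset L = D0" using ex_mset by blast
  have adm: "D0 \<in> admissible_diagrams k n d" using D0 F by auto
  obtain col where col: "\<And>x. x \<in># D0 \<Longrightarrow> col x < k"
    and colour_class: "\<And>x y. x \<in># D0 \<Longrightarrow> y \<in># D0 \<Longrightarrow> col x = col y \<Longrightarrow> \<not> strictly_nested x y"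
    using nesting_colouring[OF adm] by blast
  have arcs: "arc_diagram n E" "2 * size E = d" if "E \<in> F" for E
    using that F(2) total_degree_eq[of n E] by (auto simp: admissible_diagrams_def)
  have colL: "\<And>x. x \<in> set L \<Longrightarrow> col x < k"
    "\<And>x y. x \<in> set L \<Longrightarrow> y \<in> set L \<Longrightarrow> col x = col y \<Longrightarrow> \<not> strictly_nested x y"
    using col colour_class unfolding L[symmetric] by auto
  have d: "d = 2 * length L" using arcs(2)[OF D0(1)] L by auto
  \<comment> \<open>the coefficient of the monomial of \<open>D0\<close>\<close>
  define \<Lambda> where "\<Lambda> f = polarization d f (endpoint L) (colour_vector col L)" for f
  have other: "\<Lambda> (diagram_function \<omega> E) = 0" if E: "E \<in> F" "a E \<noteq> 0" "E \<noteq> D0" for E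
  proof -
    obtain K where K: "mset K = E" using ex_mset by blast
    have len: "length K = length L" using arcs(2)[OF E(1)] K d by auto
    have "colour_term col L K t = 0" if t: "t ` {..<2 * length L} = {..<2 * length L}" for t
    proof (rule ccontr)
      assume nz: "colour_term col L K t \<noteq> 0"
      have aL: "arc_diagram n (mset L)" and aK: "arc_diagram n (mset K)"
        using arcs(1) D0(1) E(1) L K by auto
      note nonzero = colour_term_nonzero[OF aL aK len colL t nz]
      have "product_weight (mset K) \<le> product_weight (mset L)" by (rule nonzero(1))
      then have "product_weight (mset K) = product_weight (mset L)" using min[OF E(1,2)] L K by simp
      then have "mset K = mset L" using nonzero(2) by blast
      then show False using E(3) L K by simp
    qed
    then have "(\<Sum>t | t \<in> {..<2 * length K} \<rightarrow>\<^sub>E {..<2 * length K} \<and> t ` {..<2 * length K} = {..<2 * length K}.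
        colour_term col L K t) = 0"
      unfolding len by (intro sum.neutral) auto
    then show ?thesis
      unfolding \<Lambda>_def d K[symmetric] len[symmetric] colour_coefficient .
  qed
  have "0 = \<Lambda> (\<lambda>v. \<Sum>E\<in>F. a E * diagram_function \<omega> E v)"
    unfolding zero by (simp add: \<Lambda>_def polarization_def)
  also have "\<dots> = (\<Sum>E\<in>F. a E * \<Lambda> (diagram_function \<omega> E))"
    unfolding \<Lambda>_def polarization_def sum_distrib_left
    by (subst sum.swap) (simp add: mult.left_commute)
  also have "\<dots> = (\<Sum>E\<in>F. if E = D0 then a D0 * \<Lambda> (diagram_function \<omega> D0) else 0)"
    using other by (intro sum.cong refl) auto
  also have "\<dots> = a D0 * \<Lambda> (diagram_function \<omega> D0)" using F(1) D0(1) by simp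
  finally have "\<Lambda> (diagram_function \<omega> D0) = 0" using D0(2) by simp
  moreover have "arc_diagram n (mset L)" using arcs(1)[OF D0(1)] L by simp
  ultimately show False
    using colour_coefficient_self[of n L col] colL unfolding \<Lambda>_def d L by auto
qed

end

section \<open>Symplectic bases and the main result\<close>

definition symplectic_system :: "('v::ab_group_add \<Rightarrow> 'v \<Rightarrow> complex) \<Rightarrow> nat \<Rightarrow> (nat \<Rightarrow> 'v) \<Rightarrow> bool" where
  "symplectic_system \<omega> m b \<longleftrightarrow> (\<forall>a<2 * m. \<forall>c<2 * m.
     \<omega> (b a) (b c) = (if even a \<and> c = Suc a then 1 else if even c \<and> a = Suc c then -1 else 0))"

text \<open>
  A largest system of mutually orthogonal hyperbolic pairs. It spans the space: otherwise the
  orthogonal complement contains a nonzero vector, and nondegeneracy provides a partner, which can be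
  projected to the complement and scaled to extend the system.
\<close>

lemma symplectic_basis_exists:
  fixes smul :: "complex \<Rightarrow> 'v::ab_group_add \<Rightarrow> 'v"
  assumes "finite_dimensional_vector_space smul B"
    and dim: "vector_space.dim smul (UNIV :: 'v set) = 2 * k"
    and bil: "bilinear_form smul \<omega>" and skew: "skew_symmetric \<omega>" and nondeg: "nondegenerate \<omega>"
  shows "\<exists>bas. symplectic_space smul \<omega> k bas"
proof -
  interpret V: finite_dimensional_vector_space smul B by fact
  have addl: "\<omega> (u + v) w = \<omega> u w + \<omega> v w" and scl: "\<omega> (smul c u) w = c * \<omega> u w"
    and addr: "\<omega> w (u + v) = \<omega> w u + \<omega> w v" and scr: "\<omega> w (smul c u) = c * \<omega> w u" for u v w c
    using bil by (auto simp: bilinear_form_def Vector_Spaces.linear_iff)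
  have flip: "\<omega> u v = - \<omega> v u" for u v by (rule skew[unfolded skew_symmetric_def, rule_format])
  have self: "\<omega> u u = 0" for u using flip[of u u] unfolding eq_neg_iff_add_eq_0 by simp
  have zl: "\<omega> 0 w = 0" and zr: "\<omega> w 0 = 0" for w using scl[of 0 0 w] scr[of w 0 0] by simp_all
  have minr: "\<omega> w (- u) = - \<omega> w u" for u w using scr[of w "-1" u] by simp
  have minl: "\<omega> (- u) w = - \<omega> u w" for u w using scl[of "-1" u w] by simp
  have suml: "\<omega> (\<Sum>a\<in>S. f a) w = (\<Sum>a\<in>S. \<omega> (f a) w)" for S w and f :: "nat \<Rightarrow> 'v"
    by (induction S rule: infinite_finite_induct) (simp_all add: addl zl)
  have sumr: "\<omega> w (\<Sum>a\<in>S. f a) = (\<Sum>a\<in>S. \<omega> w (f a))" for S w and f :: "nat \<Rightarrow> 'v"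
    by (induction S rule: infinite_finite_induct) (simp_all add: addr zr)
  have delta: "\<omega> (b a) (dual_vector b a') = (if a = a' then 1 else 0)"
    if b: "symplectic_system \<omega> m b" and a: "a < 2 * m" "a' < 2 * m" for m b a a'
  proof (cases "even a'")
    case True
    then have "Suc a' < 2 * m" using a(2) by (auto elim!: evenE)
    then show ?thesis using b a True by (auto simp: symplectic_system_def dual_vector_def)
  next
    case False
    then obtain e where "a' = Suc (2 * e)" by (auto elim: oddE)
    moreover have "even a \<Longrightarrow> 2 * e \<noteq> Suc a" by presburger
    ultimately show ?thesis using b a by (auto simp: symplectic_system_def dual_vector_def minr)
  qed
  have inj: "inj_on b {..<2 * m}" if b: "symplectic_system \<omega> m b" for m b
  proof (rule inj_onI)
    fix a a' assume a: "a \<in> {..<2 * m}" "a' \<in> {..<2 * m}" "b a = b a'"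
    have "\<omega> (b a) (dual_vector b a) = \<omega> (b a') (dual_vector b a)" using a(3) by simp
    then show "a = a'" using delta[OF b, of a a] delta[OF b, of a' a] a by (auto split: if_splits)
  qed
  have indep: "V.independent (b ` {..<2 * m})" if b: "symplectic_system \<omega> m b" for m b
  proof
    assume "V.dependent (b ` {..<2 * m})"
    then obtain u x where x: "x \<in> b ` {..<2 * m}" "u x \<noteq> 0" and zero: "(\<Sum>x\<in>b ` {..<2 * m}. smul (u x) x) = 0"
      using V.dependent_finite[of "b ` {..<2 * m}"] by auto
    from x obtain a where a: "a < 2 * m" "x = b a" by auto
    have "0 = \<omega> (\<Sum>c<2 * m. smul (u (b c)) (b c)) (dual_vector b a)"
      using zero by (simp add: sum.reindex[OF inj[OF b]] zl)
    also have "\<dots> = (\<Sum>c<2 * m. u (b c) * \<omega> (b c) (dual_vector b a))" by (simp add: suml scl)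
    also have "\<dots> = (\<Sum>c<2 * m. if c = a then u (b a) else 0)"
      using delta[OF b _ a(1)] by (intro sum.cong refl) auto
    also have "\<dots> = u (b a)" using a(1) by simp
    finally show False using x a by simp
  qed
  have bound: "m \<le> k" if b: "symplectic_system \<omega> m b" for m b
    using V.independent_card_le_dim[OF subset_UNIV indep[OF b]] card_image[OF inj[OF b]] dim by simp
  have "symplectic_system \<omega> 0 (\<lambda>_. 0)" by (simp add: symplectic_system_def)
  then have zero: "\<exists>b. symplectic_system \<omega> 0 b" by blast
  define m where "m = (GREATEST m. \<exists>b. symplectic_system \<omega> m b)"
  have "\<exists>b. symplectic_system \<omega> m b"
    unfolding m_def by (rule GreatestI_nat[of "\<lambda>m. \<exists>b. symplectic_system \<omega> m b", OF zero]) (elim exE, rule bound)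
  then obtain b where b: "symplectic_system \<omega> m b" by blast
  have max: "m' \<le> m" if "symplectic_system \<omega> m' b'" for m' b'
    unfolding m_def by (rule Greatest_le_nat[of "\<lambda>m. \<exists>b. symplectic_system \<omega> m b", OF exI[of _ b']])
      (rule that, elim exE, rule bound)
  \<comment> \<open>the orthogonal projection to the span of the system\<close>
  define proj where "proj v = (\<Sum>a<2 * m. smul (\<omega> v (dual_vector b a)) (b a))" for v
  have orth: "\<omega> (v - proj v) (b c) = 0" if c: "c < 2 * m" for v c
  proof -
    let ?d = "if even c then Suc c else c - 1"
    have d: "?d < 2 * m" "dual_vector b ?d = (if even c then - b c else b c)"
      "\<omega> (b ?d) (b c) = (if even c then - 1 else 1)"
    proof (atomize (full), cases "even c")
      case True
      then have "Suc c < 2 * m" using c by (auto elim!: evenE)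
      then show "?d < 2 * m \<and> dual_vector b ?d = (if even c then - b c else b c) \<and>
          \<omega> (b ?d) (b c) = (if even c then - 1 else 1)"
        using b[unfolded symplectic_system_def, rule_format, of "Suc c" c] True c by (simp add: dual_vector_def)
    next
      case False
      then obtain e where "c = Suc (2 * e)" by (auto elim: oddE)
      then show "?d < 2 * m \<and> dual_vector b ?d = (if even c then - b c else b c) \<and>
          \<omega> (b ?d) (b c) = (if even c then - 1 else 1)"
        using b[unfolded symplectic_system_def, rule_format, of "2 * e" c] c by (simp add: dual_vector_def)
    qed
    have "\<omega> (proj v) (b c) = (\<Sum>a<2 * m. \<omega> v (dual_vector b a) * \<omega> (b a) (b c))"
      by (simp add: proj_def suml scl)
    also have "\<dots> = (\<Sum>a<2 * m. if a = ?d then \<omega> v (dual_vector b ?d) * \<omega> (b ?d) (b c) else 0)"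
    proof (rule sum.cong[OF refl])
      fix a assume a: "a \<in> {..<2 * m}"
      have "\<omega> (b a) (b c) = 0" if "a \<noteq> ?d"
      proof (cases "even c")
        case True
        then show ?thesis
          using b[unfolded symplectic_system_def, rule_format, of a c] a c that by auto
      next
        case False
        then obtain e where "c = Suc (2 * e)" by (auto elim: oddE)
        then show ?thesis
          using b[unfolded symplectic_system_def, rule_format, of a c] a c that by auto
      qed
      then show "\<omega> v (dual_vector b a) * \<omega> (b a) (b c) = (if a = ?d then \<omega> v (dual_vector b ?d) * \<omega> (b ?d) (b c) else 0)"
        by (cases "a = ?d") (simp_all only: if_True if_False mult_zero_right simp_thms)
    qed
    also have "\<dots> = \<omega> v (dual_vector b ?d) * \<omega> (b ?d) (b c)" using d(1) by simp
    also have "\<dots> = \<omega> v (b c)" unfolding d by (simp add: minr)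
    finally show ?thesis using addl[of v "- proj v" "b c"] minl[of "proj v"] by simp
  qed
  have expand: "proj v = v" for v
  proof (rule ccontr)
    assume ne: "proj v \<noteq> v"
    define u where "u = v - proj v"
    have "u \<noteq> 0" using ne by (simp add: u_def)
    then obtain w0 where w0: "\<omega> u w0 \<noteq> 0" using nondeg by (auto simp: nondegenerate_def)
    have ub: "\<omega> u (b c) = 0" if "c < 2 * m" for c unfolding u_def by (rule orth[OF that])
    define w where "w = smul (1 / \<omega> u w0) (w0 - proj w0)"
    have wb: "\<omega> w (b c) = 0" if "c < 2 * m" for c unfolding w_def by (simp add: scl orth[OF that])
    have "\<omega> u (proj w0) = 0" by (simp add: proj_def sumr scr ub)
    then have uw: "\<omega> u w = 1"
      using addr[of u w0 "- proj w0"] minr[of u "proj w0"] w0 by (simp add: w_def scr)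
    have bu: "\<omega> (b c) u = 0" "\<omega> (b c) w = 0" if "c < 2 * m" for c
      using ub[OF that] wb[OF that] flip[of "b c" u] flip[of "b c" w] by simp_all
    have "symplectic_system \<omega> (Suc m) (b(2 * m := u, Suc (2 * m) := w))"
      unfolding symplectic_system_def
    proof (intro allI impI)
      fix a c assume ac: "a < 2 * Suc m" "c < 2 * Suc m"
      let ?b = "b(2 * m := u, Suc (2 * m) := w)"
      have wu: "\<omega> w u = - 1" using flip[of w u] uw by simp
      consider "a < 2 * m" "c < 2 * m" | "a < 2 * m" "c \<in> {2 * m, Suc (2 * m)}"
        | "c < 2 * m" "a \<in> {2 * m, Suc (2 * m)}" | "a \<in> {2 * m, Suc (2 * m)}" "c \<in> {2 * m, Suc (2 * m)}"
        using ac by auto linarith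
      then show "\<omega> (?b a) (?b c) = (if even a \<and> c = Suc a then 1 else if even c \<and> a = Suc c then - 1 else 0)"
      proof cases
        case 1
        then show ?thesis using b by (auto simp: symplectic_system_def)
      next
        case 2
        moreover have "even a \<Longrightarrow> 2 * m \<noteq> Suc a" by presburger
        ultimately show ?thesis using bu[of a] by auto
      next
        case 3
        moreover have "even c \<Longrightarrow> 2 * m \<noteq> Suc c" by presburger
        ultimately show ?thesis using ub[of c] wb[of c] by auto
      next
        case 4
        then show ?thesis using uw wu self by auto
      qed
    qed
    from max[OF this] show False by simp
  qed
  have "x \<in> V.span (b ` {..<2 * m})" for x
  proof -
    have "proj x \<in> V.span (b ` {..<2 * m})"
      unfolding proj_def by (intro V.span_sum V.span_scale V.span_base) auto
    then show ?thesis unfolding expand .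
  qed
  then have "V.dim (UNIV :: 'v set) = card (b ` {..<2 * m})"
    by (intro V.dim_unique[OF subset_UNIV _ indep[OF b] refl]) auto
  then have mk: "m = k" using dim card_image[OF inj[OF b]] by simp
  have "symplectic_space smul \<omega> k b"
  proof (unfold_locales)
    show "bilinear_form smul \<omega>" "skew_symmetric \<omega>" by fact+
    show "\<omega> (b a) (b c) = (if even a \<and> c = Suc a then 1 else if even c \<and> a = Suc c then - 1 else 0)"
      if "a < 2 * k" "c < 2 * k" for a c
      using b that by (auto simp: symplectic_system_def mk)
    show "v = (\<Sum>a<2 * k. smul (\<omega> v (dual_vector b a)) (b a))" for v
      using expand[of v] by (simp only: proj_def mk)
  qed
  then show ?thesis by blast
qed

theorem proposition4p5p1:
  fixes smul :: "complex \<Rightarrow> 'v::ab_group_add \<Rightarrow> 'v"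
    and B :: "'v set"
    and \<omega> :: "'v \<Rightarrow> 'v \<Rightarrow> complex"
    and k n d :: nat
  assumes "finite_dimensional_vector_space smul B"
    and "vector_space.dim smul (UNIV :: 'v set) = 2 * k"
    and "bilinear_form smul \<omega>"
    and "skew_symmetric \<omega>"
    and "nondegenerate \<omega>"
  shows "inj_on (diagram_function \<omega>) (admissible_diagrams k n d)
    \<and> fun_vs.independent (diagram_function \<omega> ` admissible_diagrams k n d)
    \<and> fun_vs.span (diagram_function \<omega> ` admissible_diagrams k n d)
        = homogeneous_Sp_invariants smul \<omega> n d"
proof -
  obtain bas where "symplectic_space smul \<omega> k bas"
    using symplectic_basis_exists[OF assms] by blast
  then interpret symplectic_space smul \<omega> k bas .
  let ?A = "admissible_diagrams k n d"
  have inj: "inj_on (diagram_function \<omega>) ?A"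
  proof (rule inj_onI, rule ccontr)
    fix D E assume DE: "D \<in> ?A" "E \<in> ?A" "diagram_function \<omega> D = diagram_function \<omega> E" "D \<noteq> E"
    have "(if D = D then 1 else - 1 :: complex) = 0"
      by (rule admissible_diagrams_independent[of "{D, E}" n d "\<lambda>x. if x = D then 1 else - 1"])
         (use DE in auto)
    then show False by simp
  qed
  moreover have "fun_vs.independent (diagram_function \<omega> ` ?A)"
  proof
    assume "fun_vs.dependent (diagram_function \<omega> ` ?A)"
    then obtain t u f where t: "finite t" "t \<subseteq> diagram_function \<omega> ` ?A" "(\<Sum>g\<in>t. fscale (u g) g) = 0"
      and f: "f \<in> t" "u f \<noteq> 0"
      unfolding fun_vs.dependent_explicit by blast
    obtain F where F: "F \<subseteq> ?A" "finite F" "t = diagram_function \<omega> ` F"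
      using finite_subset_image[OF t(1,2)] by blast
    have injF: "inj_on (diagram_function \<omega>) F" by (rule inj_on_subset[OF inj F(1)])
    obtain D where D: "D \<in> F" "f = diagram_function \<omega> D" using f F by auto
    have "(\<Sum>E\<in>F. u (diagram_function \<omega> E) * diagram_function \<omega> E v) = 0" for v
    proof -
      have "(\<Sum>E\<in>F. u (diagram_function \<omega> E) * diagram_function \<omega> E v) = (\<Sum>g\<in>t. fscale (u g) g) v"
        unfolding F(3) sum.reindex[OF injF] by (simp add: sum_fun fscale_def)
      then show ?thesis using t(3) by simp
    qed
    then have "u (diagram_function \<omega> D) = 0"
      by (rule admissible_diagrams_independent[OF F(2,1) _ D(1)])
    then show False using f D by simp
  qed
  moreover have "fun_vs.span (diagram_function \<omega> ` ?A) = homogeneous_Sp_invariants smul \<omega> n d"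
  proof -
    have "diagram_function \<omega> ` ?A \<subseteq> diagram_functions n d"
      using total_degree_eq by (auto simp: diagram_functions_def admissible_diagrams_def)
    moreover have "diagram_functions n d \<subseteq> fun_vs.span (diagram_function \<omega> ` ?A)"
      using straightening[of n] by (auto simp: diagram_functions_def)
    ultimately have "fun_vs.span (diagram_function \<omega> ` ?A) = fun_vs.span (diagram_functions n d)"
      by (intro equalityI fun_vs.span_mono fun_vs.span_minimal fun_vs.subspace_span)
    then show ?thesis by (simp only: span_diagram_functions)
  qed
  ultimately show ?thesis by blast
qed

end
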